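(* Let $n\ge 1$ and $k\ge 2$ be integers and let $\varphi(x)=|x|^2$ on $\mathbb{R}^{4n}$. Then: (1) $\Box_\varphi$ has a bounded, self-adjoint and non-negative inverse $N_\varphi$ on $L^2_\varphi(\mathbb{R}^{4n},\mathscr V_1)$ such that $$\|N_\varphi f\|_\varphi\le \tfrac14\|f\|_\varphi\qquad\text{for any } f\in L^2_\varphi(\mathbb{R}^{4n},\mathscr V_1).$$ (2) $\mathscr D_0^*N_\varphi$ is the canonical solution operator to the nonhomogeneous $k$-Cauchy-Fueter equation $\mathscr D_0u=f$, i.e. if $f\in\mathrm{Dom}(\mathscr D_1)$ satisfies $\mathscr D_1f=0$, then $$\mathscr D_0\mathscr D_0^*N_\varphi f=f$$ and $\mathscr D_0^*N_\varphi f$ is orthogonal to $A^2_{(k)}(\mathbb{R}^{4n},\varphi)$ in $L^2_\varphi(\mathbb{R}^{4n},\mathscr V_0)$. Moreover, for any $f\in L^2_\varphi(\mathbb{R}^{4n},\mathscr V_1)$, $$\|\mathscr D_0^*N_\varphi f\|_\varphi\le\tfrac12\|f\|_\varphi,\qquad \|\mathscr D_1N_\varphi f\|_\varphi\le\tfrac12\|f\|_\varphi .$$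
   Context: Primed indices $A',B',A_1',\dots$ range over $\{0',1'\}$; unprimed indices $A,B$ range over $\{0,\dots,2n-1\}$; $i=\sqrt{-1}$. Vector fields on $\mathbb{R}^{4n}$: for $l=0,\dots,n-1$, $Z_{(2l)0'}=\partial_{x_{4l+1}}+i\partial_{x_{4l+2}}$, $Z_{(2l)1'}=-\partial_{x_{4l+3}}-i\partial_{x_{4l+4}}$, $Z_{(2l+1)0'}=\partial_{x_{4l+3}}-i\partial_{x_{4l+4}}$, $Z_{(2l+1)1'}=\partial_{x_{4l+1}}-i\partial_{x_{4l+2}}$. Put $Z_A^{0'}:=Z_{A1'}$, $Z_A^{1'}:=-Z_{A0'}$. Spaces: $\mathscr V_0=\odot^k\mathbb{C}^2$ (tuples $(f_{A_1'\ldots A_k'})$ symmetric in all indices), $\mathscr V_1=\odot^{k-1}\mathbb{C}^2\otimes\mathbb{C}^{2n}$ (tuples $(f_{A_2'\ldots A_k'A})$ symmetric in the primed indices; also written $f_{AA_2'\ldots A_k'}$), $\mathscr V_2=\odot^{k-2}\mathbb{C}^2\otimes\wedge^2\mathbb{C}^{2n}$ (tuples $(f_{ABA_3'\ldots A_k'})$ symmetric in the primed indices and antisymmetric in $A,B$). The inner product $\langle f,g\rangle$ on each $\mathscr V_j$ is the sum of $f_I\overline{g_I}$ over all index tuples $I$ (all values of every index). $L^2_\varphi(\mathbb{R}^{4n},\mathscr V_j)$ is the Hilbert space with inner product $\langle f,g\rangle_\varphi=\int_{\mathbb{R}^{4n}}\langle f,g\rangle e^{-2\varphi}dV$ ($dV$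 Lebesgue measure) and norm $\|f\|_\varphi=\langle f,f\rangle_\varphi^{1/2}$. Operators: $(\mathscr D_0f)_{A_2'\ldots A_k'A}=\sum_{A_1'=0',1'}Z_A^{A_1'}f_{A_1'A_2'\ldots A_k'}$ (the $k$-Cauchy-Fueter operator), and $(\mathscr D_1h)_{ABA_3'\ldots A_k'}=\sum_{A'=0',1'}\big(Z_A^{A'}h_{BA'A_3'\ldots A_k'}-Z_B^{A'}h_{AA'A_3'\ldots A_k'}\big)$. They are viewed as densely defined closed operators $L^2_\varphi(\mathbb{R}^{4n},\mathscr V_0)\to L^2_\varphi(\mathbb{R}^{4n},\mathscr V_1)\to L^2_\varphi(\mathbb{R}^{4n},\mathscr V_2)$, acting in the sense of distributions, with $\mathrm{Dom}(\mathscr D_j)=\{f\in L^2_\varphi(\mathbb{R}^{4n},\mathscr V_j):\mathscr D_jf\in L^2_\varphi(\mathbb{R}^{4n},\mathscr V_{j+1})\}$. $\mathscr D_0^*,\mathscr D_1^*$ are their Hilbert space adjoints with respect to $\langle\cdot,\cdot\rangle_\varphi$. $\Box_\varphi=\mathscr D_0\mathscr D_0^*+\mathscr D_1^*\mathscr D_1$ on $L^2_\varphi(\mathbb{R}^{4n},\mathscr V_1)$, with $\mathrm{Dom}(\Box_\varphi)=\{f\in\mathrm{Dom}(\mathscr D_0^* )\cap\mathrm{Dom}(\mathscr D_1):\mathscr D_0^*f\in\mathrm{Dom}(\mathscr D_0),\ \mathscr D_1f\in\mathrm{Dom}(\mathscr D_1^* )\}$. Weighted $k$-Bergman space: $A^2_{(k)}(\mathbb{R}^{4n},\varphi)=\{f\in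 L^2_\varphi(\mathbb{R}^{4n},\mathscr V_0):\mathscr D_0f=0\}$. The canonical solution of $\mathscr D_0u=f$ (for $\mathscr D_1f=0$) is the solution $u\in\mathrm{Dom}(\mathscr D_0)$ orthogonal to $A^2_{(k)}(\mathbb{R}^{4n},\varphi)$, which is unique if it exists. *)

theory Defs
  imports "HOL-Analysis.Analysis"
begin

(* Conventions.
   - R^{4n} is real^4^'n with n = CARD('n): for l :: 'n and j = 1,..,4 the coordinate x_{4l+j}
     is x $ l $ j.  (In the type 4 the numeral 4 is 0, so 1, 2, 3, 4 are the four elements.)
   - The unprimed index 2l + p, p in {0,1}, is the pair (l, p) :: 'n * 2.
   - Primed indices 0', 1' are the elements 0, 1 of the type 2.
   - A string of primed indices is a list, since its length depends on k.  A tuple is a function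
     on indices that vanishes off the relevant index set.
   - Elements of L^2 are represented by functions, equality in L^2 being equality almost
     everywhere.  An unbounded operator is represented by its graph, a set of pairs of
     representatives which is closed under changes on null sets. *)

type_synonym 'n pt = "real^4^'n"
type_synonym 'n unprimed = "'n \<times> 2"
type_synonym primed = 2


section \<open>Vector fields, test functions and distributions\<close>

definition partial :: "'n::finite \<Rightarrow> 4 \<Rightarrow> ('n pt \<Rightarrow> complex) \<Rightarrow> 'n pt \<Rightarrow> complex" where
  "partial l j \<psi> x = frechet_derivative \<psi> (at x) (axis l (axis j 1))"

definition Z :: "'n::finite unprimed \<Rightarrow> primed \<Rightarrow> ('n pt \<Rightarrow> complex) \<Rightarrow> 'n pt \<Rightarrow> complex" where
  "Z A A' \<psi> x = (let l = fst A in
     if snd A = 0 then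
       (if A' = 0 then partial l 1 \<psi> x + \<i> * partial l 2 \<psi> x
        else - partial l 3 \<psi> x - \<i> * partial l 4 \<psi> x)
     else
       (if A' = 0 then partial l 3 \<psi> x - \<i> * partial l 4 \<psi> x
        else partial l 1 \<psi> x - \<i> * partial l 2 \<psi> x))"

definition Z_up :: "'n::finite unprimed \<Rightarrow> primed \<Rightarrow> ('n pt \<Rightarrow> complex) \<Rightarrow> 'n pt \<Rightarrow> complex" where
  "Z_up A A' \<psi> x = (if A' = 0 then Z A 1 \<psi> x else - Z A 0 \<psi> x)"

(* C^infinity: every iterated directional derivative exists and is differentiable everywhere. *)
definition smooth :: "('a::real_normed_vector \<Rightarrow> complex) \<Rightarrow> bool" where
  "smooth \<psi> \<longleftrightarrow>
     (\<forall>vs. foldr (\<lambda>v h x. frechet_derivative h (at x) v) vs \<psi> differentiable_on UNIV)"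

definition test_functions :: "('n::finite pt \<Rightarrow> complex) set" where
  "test_functions = {\<psi>. smooth \<psi> \<and> (\<exists>K. compact K \<and> (\<forall>x. x \<notin> K \<longrightarrow> \<psi> x = 0))}"

definition distr_of :: "('n::finite pt \<Rightarrow> complex) \<Rightarrow> ('n pt \<Rightarrow> complex) \<Rightarrow> complex" where
  "distr_of u \<psi> = (\<integral>x. u x * \<psi> x \<partial>lborel)"

(* Z_A^{A'} applied to a distribution; the field has constant coefficients, so its formal
   transpose is its negative. *)
definition Z_up_distr ::
  "'n::finite unprimed \<Rightarrow> primed \<Rightarrow> (('n pt \<Rightarrow> complex) \<Rightarrow> complex) \<Rightarrow> ('n pt \<Rightarrow> complex) \<Rightarrow> complex" where
  "Z_up_distr A A' T \<psi> = - T (Z_up A A' \<psi>)"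


section \<open>The spaces of tuples\<close>

type_synonym idx0 = "primed list"
type_synonym 'n idx1 = "'n unprimed \<times> primed list"
type_synonym 'n idx2 = "'n unprimed \<times> 'n unprimed \<times> primed list"

definition I0 :: "nat \<Rightarrow> idx0 set" where
  "I0 k = {As. length As = k}"

definition I1 :: "nat \<Rightarrow> 'n idx1 set" where
  "I1 k = {(A, As). length As = k - 1}"

definition I2 :: "nat \<Rightarrow> 'n idx2 set" where
  "I2 k = {(A, B, As). length As = k - 2}"

(* Symmetry in the primed indices: two strings are permutations of each other iff their
   multisets agree. *)
definition V0 :: "nat \<Rightarrow> (idx0 \<Rightarrow> complex) set" where
  "V0 k = {v. (\<forall>I. I \<notin> I0 k \<longrightarrow> v I = 0) \<and>
              (\<forall>As Bs. mset As = mset Bs \<longrightarrow> v As = v Bs)}"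

definition V1 :: "nat \<Rightarrow> ('n idx1 \<Rightarrow> complex) set" where
  "V1 k = {v. (\<forall>I. I \<notin> I1 k \<longrightarrow> v I = 0) \<and>
              (\<forall>A As Bs. mset As = mset Bs \<longrightarrow> v (A, As) = v (A, Bs))}"

definition V2 :: "nat \<Rightarrow> ('n idx2 \<Rightarrow> complex) set" where
  "V2 k = {v. (\<forall>I. I \<notin> I2 k \<longrightarrow> v I = 0) \<and>
              (\<forall>A B As Bs. mset As = mset Bs \<longrightarrow> v (A, B, As) = v (A, B, Bs)) \<and>
              (\<forall>A B As. v (A, B, As) = - v (B, A, As))}"


section \<open>Weighted spaces and operators on them\<close>

type_synonym ('n, 'i) field = "'n pt \<Rightarrow> 'i \<Rightarrow> complex"

definition L2 :: "('n::finite pt \<Rightarrow> real) \<Rightarrow> ('i \<Rightarrow> complex) set \<Rightarrow> ('n, 'i) field set" where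
  "L2 \<phi> V = {f. (\<forall>x. f x \<in> V) \<and>
                (\<forall>I. (\<lambda>x. f x I) \<in> borel_measurable lborel \<and>
                     integrable lborel (\<lambda>x. (cmod (f x I))\<^sup>2 * exp (- 2 * \<phi> x)))}"

definition ip :: "('n::finite pt \<Rightarrow> real) \<Rightarrow> 'i set \<Rightarrow> ('n, 'i) field \<Rightarrow> ('n, 'i) field \<Rightarrow> complex" where
  "ip \<phi> S f g = (\<integral>x. (\<Sum>I\<in>S. f x I * cnj (g x I)) * of_real (exp (- 2 * \<phi> x)) \<partial>lborel)"

definition nrm :: "('n::finite pt \<Rightarrow> real) \<Rightarrow> 'i set \<Rightarrow> ('n, 'i) field \<Rightarrow> real" where
  "nrm \<phi> S f = sqrt (Re (ip \<phi> S f f))"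

definition ae_eq :: "('n::finite, 'i) field \<Rightarrow> ('n, 'i) field \<Rightarrow> bool" where
  "ae_eq f g \<longleftrightarrow> (AE x in lborel. f x = g x)"

(* Graph of the Hilbert space adjoint of the operator from H to K with graph T. *)
definition adjoint_graph ::
  "'f set \<Rightarrow> ('f \<Rightarrow> 'f \<Rightarrow> complex) \<Rightarrow> 'g set \<Rightarrow> ('g \<Rightarrow> 'g \<Rightarrow> complex) \<Rightarrow>
   ('f \<times> 'g) set \<Rightarrow> ('g \<times> 'f) set" where
  "adjoint_graph H ipH K ipK T =
     {(v, u). v \<in> K \<and> u \<in> H \<and> (\<forall>(f, g) \<in> T. ipK g v = ipH f u)}"

(* N induces an everywhere defined bounded linear operator on the classes of H. *)
definition bounded_op ::
  "('n::finite, 'i) field set \<Rightarrow> (('n, 'i) field \<Rightarrow> real) \<Rightarrow>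
   (('n, 'i) field \<Rightarrow> ('n, 'i) field) \<Rightarrow> bool" where
  "bounded_op H nr N \<longleftrightarrow>
     (\<forall>f\<in>H. N f \<in> H) \<and>
     (\<forall>f\<in>H. \<forall>g\<in>H. ae_eq f g \<longrightarrow> ae_eq (N f) (N g)) \<and>
     (\<forall>f\<in>H. \<forall>g\<in>H. \<forall>a b. ae_eq (N (\<lambda>x I. a * f x I + b * g x I))
                                (\<lambda>x I. a * N f x I + b * N g x I)) \<and>
     (\<exists>C. \<forall>f\<in>H. nr (N f) \<le> C * nr f)"

definition op_graph ::
  "('n::finite, 'i) field set \<Rightarrow> (('n, 'i) field \<Rightarrow> ('n, 'i) field) \<Rightarrow>
   (('n, 'i) field \<times> ('n, 'i) field) set" where
  "op_graph H N = {(f, g). f \<in> H \<and> g \<in> H \<and> ae_eq g (N f)}"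

definition self_adjoint_op ::
  "('n::finite, 'i) field set \<Rightarrow> (('n, 'i) field \<Rightarrow> ('n, 'i) field \<Rightarrow> complex) \<Rightarrow>
   (('n, 'i) field \<Rightarrow> ('n, 'i) field) \<Rightarrow> bool" where
  "self_adjoint_op H ipH N \<longleftrightarrow> adjoint_graph H ipH H ipH (op_graph H N) = op_graph H N"

definition nonneg_op ::
  "'f set \<Rightarrow> ('f \<Rightarrow> 'f \<Rightarrow> complex) \<Rightarrow> ('f \<Rightarrow> 'f) \<Rightarrow> bool" where
  "nonneg_op H ipH N \<longleftrightarrow> (\<forall>f\<in>H. ipH (N f) f \<in> \<real> \<and> 0 \<le> Re (ipH (N f) f))"

(* N is a two-sided inverse, on H, of the operator with graph T. *)
definition inverse_op ::
  "('n::finite, 'i) field set \<Rightarrow> (('n, 'i) field \<times> ('n, 'i) field) set \<Rightarrow>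
   (('n, 'i) field \<Rightarrow> ('n, 'i) field) \<Rightarrow> bool" where
  "inverse_op H T N \<longleftrightarrow>
     (\<forall>f\<in>H. (N f, f) \<in> T) \<and> (\<forall>(u, f) \<in> T. ae_eq (N f) u)"


section \<open>The operators of the complex, their adjoints, and the box operator\<close>

definition D0 :: "nat \<Rightarrow> ('n::finite pt \<Rightarrow> real) \<Rightarrow> (('n, idx0) field \<times> ('n, 'n idx1) field) set" where
  "D0 k \<phi> = {(f, g). f \<in> L2 \<phi> (V0 k) \<and> g \<in> L2 \<phi> (V1 k) \<and>
     (\<forall>(A, As) \<in> I1 k. \<forall>\<psi> \<in> test_functions.
        distr_of (\<lambda>x. g x (A, As)) \<psi> =
        (\<Sum>A'\<in>UNIV. Z_up_distr A A' (distr_of (\<lambda>x. f x (A' # As))) \<psi>))}"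

definition D1 :: "nat \<Rightarrow> ('n::finite pt \<Rightarrow> real) \<Rightarrow> (('n, 'n idx1) field \<times> ('n, 'n idx2) field) set" where
  "D1 k \<phi> = {(h, g). h \<in> L2 \<phi> (V1 k) \<and> g \<in> L2 \<phi> (V2 k) \<and>
     (\<forall>(A, B, As) \<in> I2 k. \<forall>\<psi> \<in> test_functions.
        distr_of (\<lambda>x. g x (A, B, As)) \<psi> =
        (\<Sum>A'\<in>UNIV. Z_up_distr A A' (distr_of (\<lambda>x. h x (B, A' # As))) \<psi>
                  - Z_up_distr B A' (distr_of (\<lambda>x. h x (A, A' # As))) \<psi>))}"

definition D0_adj :: "nat \<Rightarrow> ('n::finite pt \<Rightarrow> real) \<Rightarrow> (('n, 'n idx1) field \<times> ('n, idx0) field) set" where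
  "D0_adj k \<phi> =
     adjoint_graph (L2 \<phi> (V0 k)) (ip \<phi> (I0 k)) (L2 \<phi> (V1 k)) (ip \<phi> (I1 k)) (D0 k \<phi>)"

definition D1_adj :: "nat \<Rightarrow> ('n::finite pt \<Rightarrow> real) \<Rightarrow> (('n, 'n idx2) field \<times> ('n, 'n idx1) field) set" where
  "D1_adj k \<phi> =
     adjoint_graph (L2 \<phi> (V1 k)) (ip \<phi> (I1 k)) (L2 \<phi> (V2 k)) (ip \<phi> (I2 k)) (D1 k \<phi>)"

definition Box :: "nat \<Rightarrow> ('n::finite pt \<Rightarrow> real) \<Rightarrow> (('n, 'n idx1) field \<times> ('n, 'n idx1) field) set" where
  "Box k \<phi> = {(f, g). g \<in> L2 \<phi> (V1 k) \<and>
     (\<exists>u v p q. (f, u) \<in> D0_adj k \<phi> \<and> (u, v) \<in> D0 k \<phi> \<and>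
                (f, p) \<in> D1 k \<phi> \<and> (p, q) \<in> D1_adj k \<phi> \<and>
                ae_eq g (\<lambda>x I. v x I + q x I))}"

definition Bergman :: "nat \<Rightarrow> ('n::finite pt \<Rightarrow> real) \<Rightarrow> ('n, idx0) field set" where
  "Bergman k \<phi> = {f \<in> L2 \<phi> (V0 k). (f, \<lambda>x I. 0) \<in> D0 k \<phi>}"

definition canonical_solution ::
  "nat \<Rightarrow> ('n::finite pt \<Rightarrow> real) \<Rightarrow> ('n, 'n idx1) field \<Rightarrow> ('n, idx0) field \<Rightarrow> bool" where
  "canonical_solution k \<phi> f u \<longleftrightarrow>
     (u, f) \<in> D0 k \<phi> \<and> (\<forall>h \<in> Bergman k \<phi>. ip \<phi> (I0 k) u h = 0)"

end

theory Submission
  imports Defs "HOL-Library.Function_Algebras" "HOL-Real_Asymp.Real_Asymp"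
begin

text \<open>
  For \<open>\<phi>(x) = |x|\<^sup>2\<close> the weight \<open>exp (-2 \<phi>)\<close> is Gaussian, so the weighted space has an orthonormal basis
  of Hermite functions. In it \<open>\<partial>\<^sub>j\<close> is an annihilation operator, its adjoint \<open>4 x\<^sub>j - \<partial>\<^sub>j\<close> is the
  creation operator, and \<open>[\<partial>\<^sub>i, \<partial>\<^sub>j\<^sup>*] = 4 \<delta>\<^sub>i\<^sub>j\<close>. The coefficient vectors of the fields \<open>Z\<^sub>A\<^bsup>A'\<^esup>\<close> are
  pairwise orthogonal of squared length 2, hence the fields satisfy the canonical commutation
  relations with constant 8 (\<open>Z_fock_Z_fock_adj\<close>). Consequently \<open>D\<^sub>0\<close> and \<open>D\<^sub>1\<close> lower the Hermite degree by
  one, their adjoints raise it by one, and the box operator preserves it: the box operator is block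
  diagonal, with one finite-dimensional block for each degree. All of the operator theory then
  happens inside a block, where there are no questions of domains.

  The coercivity of a block is an algebraic identity (\<open>energy_identity\<close>). Put
  \<open>C\<^sub>A\<^sub>B = \<Sum>\<^bsub>A'\<^esub> Z\<^sub>A\<^bsup>A'\<^esup> f\<^bsub>BA'\<dots>\<^esub>\<close>, so that \<open>D\<^sub>1 f\<close> has the components \<open>C\<^sub>A\<^sub>B - C\<^sub>B\<^sub>A\<close>. The adjoint \<open>D\<^sub>0\<^sup>* f\<close> is a
  symmetrization over \<open>k\<close> primed indices. In \<open>k |D\<^sub>0\<^sup>* f|\<^sup>2\<close> one of the \<open>k\<close> positions gives a square, and each
  of the other \<open>k - 1\<close> gives a sum of mixed terms in which a commutator can be taken: it equals
  \<open>\<Sum> \<langle>C\<^sub>B\<^sub>A, C\<^sub>A\<^sub>B\<rangle> + 8 |f|\<^sup>2 = |C|\<^sup>2 - |D\<^sub>1 f|\<^sup>2 / 2 + 8 |f|\<^sup>2\<close>. Since \<open>(k - 1) / k \<ge> 1/2\<close>, this yields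
  \<open>4 |f|\<^sup>2 \<le> |D\<^sub>0\<^sup>* f|\<^sup>2 + |D\<^sub>1 f|\<^sup>2\<close> (\<open>energy_estimate\<close>), and a block, being injective on a space of finite
  dimension, is bijective (\<open>Box_fock_surj\<close>, \<open>Box_fock_inj\<close>). The norm bounds for \<open>u = N f\<close> follow from
  \<open>4 |u|\<^sup>2 \<le> |D\<^sub>0\<^sup>* u|\<^sup>2 + |D\<^sub>1 u|\<^sup>2 = \<langle>f, u\<rangle>\<close>. Because \<open>D\<^sub>1 D\<^sub>0 = 0\<close>, the two parts of \<open>f = D\<^sub>0 D\<^sub>0\<^sup>* u + D\<^sub>1\<^sup>* D\<^sub>1 u\<close>
  are orthogonal; this shows that both are square integrable, and that the second one vanishes when
  \<open>D\<^sub>1 f = 0\<close>.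

  What remains is the dictionary between fields and their Hermite coefficients. Every
  square-summable family of coefficients comes from a field, unique up to null sets: this is the
  Riesz-Fischer theorem together with the completeness of the Hermite functions
  (\<open>perp_polynomials_eq_0\<close>). A first-order equation in the sense of distributions is equivalent to
  the equation between coefficients (\<open>weak_divergence_iff\<close>), and the Hilbert space adjoints are the
  formal adjoints of the coefficient operators (\<open>adjoint_iff\<close>). With it \<open>Box_iff\<close> identifies the graph
  of the box operator with the block diagonal operator on square-summable coefficients.
\<close>

section \<open>Orthonormal expansions in \<open>L\<^sup>2\<close> of a finite measure\<close>

definition sqint :: "'a measure \<Rightarrow> ('a \<Rightarrow> complex) \<Rightarrow> bool" where
  "sqint M f \<longleftrightarrow> f \<in> borel_measurable M \<and> integrable M (\<lambda>x. (cmod (f x))\<^sup>2)"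

definition l2ip :: "'a measure \<Rightarrow> ('a \<Rightarrow> complex) \<Rightarrow> ('a \<Rightarrow> complex) \<Rightarrow> complex" where
  "l2ip M f g = (\<integral>x. f x * cnj (g x) \<partial>M)"

lemma sqintD: "sqint M f \<Longrightarrow> f \<in> borel_measurable M"
  by (simp add: sqint_def)

lemma borel_measurable_cnj [measurable]:
  "f \<in> borel_measurable M \<Longrightarrow> (\<lambda>x. cnj (f x)) \<in> borel_measurable M"
  by (rule borel_measurable_continuous_on[of cnj]) (auto intro: continuous_intros)

lemma sum_squares_bound_mult: "a * b \<le> a\<^sup>2 + (b::real)\<^sup>2"
proof -
  have "0 \<le> (a - b)\<^sup>2" "0 \<le> a\<^sup>2" "0 \<le> b\<^sup>2" by simp_all
  then show ?thesis unfolding power2_diff by linarith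
qed

lemma sqint_integrable_mult:
  assumes "sqint M f" "sqint M g"
  shows "integrable M (\<lambda>x. f x * cnj (g x))"
proof (rule Bochner_Integration.integrable_bound)
  note [measurable] = assms[THEN sqintD]
  show "(\<lambda>x. f x * cnj (g x)) \<in> borel_measurable M" by measurable
  show "integrable M (\<lambda>x. (cmod (f x))\<^sup>2 + (cmod (g x))\<^sup>2)"
    using assms by (simp add: sqint_def)
qed (auto simp: norm_mult sum_squares_bound_mult)

lemma sqint_cnj: "sqint M f \<Longrightarrow> sqint M (\<lambda>x. cnj (f x))"
  by (simp add: sqint_def borel_measurable_cnj)

lemma sqint_integrable_mult': "sqint M f \<Longrightarrow> sqint M g \<Longrightarrow> integrable M (\<lambda>x. f x * g x)"
  using sqint_integrable_mult[OF _ sqint_cnj] by fastforce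

lemma sqint_cmult: "sqint M f \<Longrightarrow> sqint M (\<lambda>x. c * f x)"
  by (auto simp: sqint_def norm_mult power_mult_distrib)

lemma sqint_bounded_mult:
  assumes f: "sqint M f" and g [measurable]: "g \<in> borel_measurable M" and B: "\<And>x. cmod (g x) \<le> B"
  shows "sqint M (\<lambda>x. g x * f x)"
proof -
  note [measurable] = sqintD[OF f]
  have "integrable M (\<lambda>x. (cmod (g x * f x))\<^sup>2)"
  proof (rule Bochner_Integration.integrable_bound)
    show "integrable M (\<lambda>x. B\<^sup>2 * (cmod (f x))\<^sup>2)"
      using f by (simp add: sqint_def)
    show "AE x in M. norm ((cmod (g x * f x))\<^sup>2) \<le> norm (B\<^sup>2 * (cmod (f x))\<^sup>2)"
      using B by (auto simp: norm_mult power_mult_distrib intro!: mult_right_mono power_mono)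
  qed auto
  then show ?thesis by (simp add: sqint_def)
qed

lemma sqint_add:
  assumes "sqint M f" "sqint M g"
  shows "sqint M (\<lambda>x. f x + g x)"
proof -
  note [measurable] = assms[THEN sqintD]
  have "integrable M (\<lambda>x. (cmod (f x + g x))\<^sup>2)"
  proof (rule Bochner_Integration.integrable_bound)
    show "integrable M (\<lambda>x. 2 * (cmod (f x))\<^sup>2 + 2 * (cmod (g x))\<^sup>2)"
      using assms by (simp add: sqint_def)
    have "(cmod (f x + g x))\<^sup>2 \<le> 2 * (cmod (f x))\<^sup>2 + 2 * (cmod (g x))\<^sup>2" for x
    proof -
      have "(cmod (f x + g x))\<^sup>2 \<le> (cmod (f x) + cmod (g x))\<^sup>2"
        by (intro power_mono norm_triangle_ineq) auto
      moreover have "0 \<le> (cmod (f x) - cmod (g x))\<^sup>2" by simp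
      ultimately show ?thesis unfolding power2_sum power2_diff by linarith
    qed
    then show "AE x in M. norm ((cmod (f x + g x))\<^sup>2) \<le> norm (2 * (cmod (f x))\<^sup>2 + 2 * (cmod (g x))\<^sup>2)"
      by auto
  qed auto
  then show ?thesis by (simp add: sqint_def)
qed

lemma sqint_diff: "sqint M f \<Longrightarrow> sqint M g \<Longrightarrow> sqint M (\<lambda>x. f x - g x)"
  using sqint_add[of M f "\<lambda>x. - 1 * g x"] sqint_cmult[of M g "- 1"] by simp

lemma sqint_zero: "sqint M (\<lambda>x. 0)"
  by (simp add: sqint_def)

lemma sqint_sum: "(\<And>i. i \<in> I \<Longrightarrow> sqint M (f i)) \<Longrightarrow> sqint M (\<lambda>x. \<Sum>i\<in>I. f i x)"
  by (induction I rule: infinite_finite_induct) (auto intro: sqint_add sqint_zero)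

lemma l2ip_add: "sqint M f \<Longrightarrow> sqint M g \<Longrightarrow> sqint M h \<Longrightarrow> l2ip M (\<lambda>x. f x + g x) h = l2ip M f h + l2ip M g h"
  by (simp add: l2ip_def ring_distribs sqint_integrable_mult)

lemma l2ip_diff: "sqint M f \<Longrightarrow> sqint M g \<Longrightarrow> sqint M h \<Longrightarrow> l2ip M (\<lambda>x. f x - g x) h = l2ip M f h - l2ip M g h"
  by (simp add: l2ip_def left_diff_distrib sqint_integrable_mult)

lemma l2ip_cmult: "l2ip M (\<lambda>x. c * f x) h = c * l2ip M f h"
  by (simp add: l2ip_def mult.assoc)

lemma l2ip_sum:
  "(\<And>i. i \<in> I \<Longrightarrow> sqint M (f i)) \<Longrightarrow> sqint M h \<Longrightarrow>
    l2ip M (\<lambda>x. \<Sum>i\<in>I. f i x) h = (\<Sum>i\<in>I. l2ip M (f i) h)"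
  by (simp add: l2ip_def sum_distrib_right sqint_integrable_mult Bochner_Integration.integral_sum)

lemma l2ip_cnj: "cnj (l2ip M f g) = l2ip M g f"
  using Bochner_Integration.integral_cnj[of M "\<lambda>x. f x * cnj (g x)"] by (simp add: l2ip_def mult.commute)

lemma l2ip_diff_right: "sqint M f \<Longrightarrow> sqint M g \<Longrightarrow> sqint M h \<Longrightarrow> l2ip M h (\<lambda>x. f x - g x) = l2ip M h f - l2ip M h g"
  by (subst (1 2 3) l2ip_cnj[symmetric]) (simp add: l2ip_diff)

lemma l2ip_cmult_right: "l2ip M h (\<lambda>x. c * f x) = cnj c * l2ip M h f"
  by (subst (1 2) l2ip_cnj[symmetric]) (simp add: l2ip_cmult)

lemma l2ip_self: "l2ip M f f = of_real (\<integral>x. (cmod (f x))\<^sup>2 \<partial>M)"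
  unfolding l2ip_def by (simp add: complex_norm_square[symmetric] del: of_real_power)

lemma l2ip_self_nonneg: "0 \<le> Re (l2ip M f f)"
  by (simp add: l2ip_self)

lemma l2ip_cong_AE:
  assumes "sqint M f" "sqint M f'" "sqint M g" "AE x in M. f x = f' x"
  shows "l2ip M f g = l2ip M f' g"
proof -
  note [measurable] = assms(1-3)[THEN sqintD]
  show ?thesis unfolding l2ip_def by (rule integral_cong_AE) (use assms(4) in auto)
qed

lemma l2ip_Cauchy_Schwarz:
  assumes f: "sqint M f" and g: "sqint M g"
  shows "(cmod (l2ip M f g))\<^sup>2 \<le> Re (l2ip M f f) * Re (l2ip M g g)"
proof -
  define a where "a = Re (l2ip M f f)"
  define b where "b = Re (l2ip M g g)"
  define c where "c = l2ip M f g"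
  have a: "l2ip M f f = of_real a" and b: "l2ip M g g = of_real b"
    by (simp_all add: a_def b_def l2ip_self)
  have c': "l2ip M g f = cnj c" unfolding c_def l2ip_cnj ..
  have key: "0 \<le> s\<^sup>2 * a - 2 * s * (cmod c)\<^sup>2 + (cmod c)\<^sup>2 * b" for s :: real
  proof -
    have "l2ip M (\<lambda>x. of_real s * f x - c * g x) (\<lambda>x. of_real s * f x - c * g x)
        = of_real (s\<^sup>2 * a) - of_real s * (2 * (c * cnj c)) + c * cnj c * of_real b"
      using f g by (simp add: l2ip_diff l2ip_diff_right l2ip_cmult l2ip_cmult_right sqint_cmult sqint_diff
          a b c' c_def[symmetric]) (simp add: algebra_simps power2_eq_square)
    also have "\<dots> = of_real (s\<^sup>2 * a - 2 * s * (cmod c)\<^sup>2 + (cmod c)\<^sup>2 * b)"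
      by (simp add: complex_norm_square[symmetric] algebra_simps del: of_real_power)
    finally show ?thesis using l2ip_self_nonneg[of M "\<lambda>x. of_real s * f x - c * g x"] by simp
  qed
  have ab: "0 \<le> a" "0 \<le> b" by (auto simp: a_def b_def l2ip_self_nonneg)
  have "(cmod c)\<^sup>2 \<le> a * b"
  proof (cases "b = 0")
    case False
    with key[of b] ab have "b * (cmod c)\<^sup>2 \<le> b * (a * b)" by (simp add: power2_eq_square algebra_simps)
    with False ab show ?thesis by simp
  next
    case True
    show ?thesis
    proof (cases "a = 0")
      case True
      with key[of 1] \<open>b = 0\<close> show ?thesis by simp
    next
      case False
      with ab have "a > 0" by simp
      with key[of "(cmod c)\<^sup>2 / a"] \<open>b = 0\<close> have "(cmod c)\<^sup>2 * (cmod c)\<^sup>2 / a \<le> 0"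
        by (simp add: power2_eq_square field_simps)
      with \<open>a > 0\<close> have "(cmod c)\<^sup>2 * (cmod c)\<^sup>2 \<le> 0" by (simp add: field_simps)
      then have "c = 0" by (metis mult_le_0_iff norm_eq_zero power2_eq_square zero_le_power2 antisym zero_eq_power2)
      then show ?thesis using ab by simp
    qed
  qed
  then show ?thesis by (simp add: a_def b_def c_def)
qed

lemma l2ip_tendsto_0:
  assumes "\<And>n. sqint M (h n)" "sqint M g" "(\<lambda>n. Re (l2ip M (h n) (h n))) \<longlonglongrightarrow> 0"
  shows "(\<lambda>n. l2ip M (h n) g) \<longlonglongrightarrow> 0"
proof -
  have "(\<lambda>n. sqrt (Re (l2ip M (h n) (h n)) * Re (l2ip M g g))) \<longlonglongrightarrow> sqrt (0 * Re (l2ip M g g))"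
    by (intro tendsto_intros assms)
  then have "(\<lambda>n. sqrt (Re (l2ip M (h n) (h n)) * Re (l2ip M g g))) \<longlonglongrightarrow> 0" by simp
  then show ?thesis
    by (rule tendsto_0_le[where K = 1])
       (auto intro!: always_eventually real_le_rsqrt l2ip_Cauchy_Schwarz assms simp: l2ip_self_nonneg abs_mult)
qed

text \<open>
  The basis is exhausted by finite levels of constant degree, so that sums over the basis become
  ordinary series over the degree. This matches operators that shift the degree: they are summed level
  by level, and no single term of a level needs to be summable by itself.
\<close>

locale graded_onb = finite_measure M for M :: "'a measure" +
  fixes e :: "'i \<Rightarrow> 'a \<Rightarrow> complex" and deg :: "'i \<Rightarrow> nat"
  assumes sqint_e: "sqint M (e i)"
    and orthonormal: "l2ip M (e i) (e j) = (if i = j then 1 else 0)"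
    and finite_deg: "finite {i. deg i = d}"
    and complete: "sqint M f \<Longrightarrow> (\<And>i. l2ip M f (e i) = 0) \<Longrightarrow> AE x in M. f x = 0"
begin

definition partial_expansion :: "('i \<Rightarrow> complex) \<Rightarrow> nat \<Rightarrow> 'a \<Rightarrow> complex" where
  "partial_expansion c D x = (\<Sum>i | deg i < D. c i * e i x)"

lemma finite_deg_less: "finite {i. deg i < D}"
proof -
  have "{i. deg i < D} = (\<Union>d<D. {i. deg i = d})" by auto
  then show ?thesis by (simp add: finite_deg)
qed

lemma sum_deg_less: "(\<Sum>i | deg i < D. g i) = (\<Sum>d<D. \<Sum>i | deg i = d. (g i :: 'b::comm_monoid_add))"
proof -
  have "{i. deg i < D} = (\<Union>d\<in>{..<D}. {i. deg i = d})" by auto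
  then show ?thesis by (simp only:) (subst sum.UNION_disjoint, auto simp: finite_deg)
qed

lemma sqint_partial_expansion: "sqint M (partial_expansion c D)"
  unfolding partial_expansion_def by (intro sqint_sum sqint_cmult sqint_e)

lemma l2ip_partial_expansion:
  "sqint M g \<Longrightarrow> l2ip M (partial_expansion c D) g = (\<Sum>i | deg i < D. c i * l2ip M (e i) g)"
  unfolding partial_expansion_def by (simp add: l2ip_sum sqint_cmult sqint_e l2ip_cmult)

lemma coeff_partial_expansion:
  "l2ip M (partial_expansion c D) (e j) = (if deg j < D then c j else 0)"
  by (simp add: l2ip_partial_expansion sqint_e orthonormal finite_deg_less if_distrib[where f = "\<lambda>x. _ * x"] cong: if_cong)

lemma l2ip_partial_expansion_diff:
  assumes "D \<le> D'"
  shows "l2ip M (\<lambda>x. partial_expansion c D' x - partial_expansion c D x) (\<lambda>x. partial_expansion c D' x - partial_expansion c D x)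
     = of_real (\<Sum>d\<in>{D..<D'}. \<Sum>i | deg i = d. (cmod (c i))\<^sup>2)"
proof -
  let ?u = "\<lambda>x. partial_expansion c D' x - partial_expansion c D x"
  have u: "sqint M ?u" by (intro sqint_diff sqint_partial_expansion)
  have co: "l2ip M (e i) ?u = (if deg i \<in> {D..<D'} then cnj (c i) else 0)" for i
    using assms by (subst l2ip_cnj[symmetric])
      (auto simp: l2ip_diff sqint_partial_expansion sqint_e coeff_partial_expansion)
  have "l2ip M (partial_expansion c E) ?u = (\<Sum>d<E. \<Sum>i | deg i = d. if d \<in> {D..<D'} then of_real ((cmod (c i))\<^sup>2) else 0)" for E
    unfolding l2ip_partial_expansion[OF u] sum_deg_less co complex_norm_square
    by (intro sum.cong refl) auto
  then have E: "l2ip M (partial_expansion c E) ?u = (\<Sum>d\<in>{..<E} \<inter> {D..<D'}. \<Sum>i | deg i = d. of_real ((cmod (c i))\<^sup>2))" for E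
    by (simp add: sum.inter_restrict) (intro sum.cong refl, auto)
  have i: "{..<D} \<inter> {D..<D'} = {}" "{..<D'} \<inter> {D..<D'} = {D..<D'}" by auto
  have "l2ip M ?u ?u = (\<Sum>d\<in>{..<D'} \<inter> {D..<D'}. \<Sum>i | deg i = d. of_real ((cmod (c i))\<^sup>2))
      - (\<Sum>d\<in>{..<D} \<inter> {D..<D'}. \<Sum>i | deg i = d. of_real ((cmod (c i))\<^sup>2))"
    unfolding E[symmetric] by (rule l2ip_diff) (intro sqint_partial_expansion u)+
  then show ?thesis by (simp only: i sum.empty diff_zero of_real_sum)
qed

lemma Bessel:
  assumes f: "sqint M f"
  shows "(\<Sum>d<D. \<Sum>i | deg i = d. (cmod (l2ip M f (e i)))\<^sup>2) \<le> Re (l2ip M f f)"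
proof -
  define c where "c = (\<lambda>i. l2ip M f (e i))"
  let ?S = "partial_expansion c D"
  define B where "B = (\<Sum>i | deg i < D. (cmod (c i))\<^sup>2)"
  have 1: "l2ip M ?S f = of_real B"
    by (simp add: l2ip_partial_expansion[OF f] B_def complex_norm_square c_def l2ip_cnj del: of_real_power)
  then have 2: "l2ip M f ?S = of_real B" by (metis l2ip_cnj complex_cnj_complex_of_real)
  have 3: "l2ip M ?S ?S = of_real B"
    unfolding l2ip_partial_expansion[OF sqint_partial_expansion] B_def of_real_sum complex_norm_square
    by (intro sum.cong refl) (subst l2ip_cnj[symmetric], simp add: coeff_partial_expansion)
  have "l2ip M (\<lambda>x. f x - ?S x) (\<lambda>x. f x - ?S x) = l2ip M f f - of_real B"
    using f sqint_partial_expansion by (simp add: l2ip_diff l2ip_diff_right sqint_diff 1 2 3)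
  then have "0 \<le> Re (l2ip M f f) - B"
    using l2ip_self_nonneg[of M "\<lambda>x. f x - ?S x"] by simp
  then show ?thesis by (simp add: B_def c_def sum_deg_less)
qed

text \<open>
  Along a fast subsequence the increments of the partial sums are summable in \<open>L\<^sup>1\<close>, because the measure is
  finite; hence the subsequence converges almost everywhere. Fatou's lemma bounds the \<open>L\<^sup>2\<close> distance of
  the limit to every partial sum by the tail of the series.
\<close>

lemma Riesz_Fischer:
  assumes sm: "summable (\<lambda>d. \<Sum>i | deg i = d. (cmod (c i))\<^sup>2)"
  obtains f where "sqint M f" "\<And>i. l2ip M f (e i) = c i"
    "(\<lambda>D. Re (l2ip M (\<lambda>x. f x - partial_expansion c D x) (\<lambda>x. f x - partial_expansion c D x))) \<longlonglongrightarrow> 0"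
proof -
  let ?S = "partial_expansion c"
  define s where "s = (\<lambda>d. \<Sum>i | deg i = d. (cmod (c i))\<^sup>2)"
  define T where "T = (\<lambda>D. suminf s - sum s {..<D})"
  have s0: "0 \<le> s d" for d by (simp add: s_def sum_nonneg)
  have T0: "T \<longlonglongrightarrow> 0"
    using tendsto_diff[OF tendsto_const[of "suminf s"] summable_LIMSEQ[OF sm[folded s_def]]] by (simp add: T_def)
  have inc: "(\<integral>x. (cmod (?S D' x - ?S D x))\<^sup>2 \<partial>M) \<le> T D" if "D \<le> D'" for D D'
  proof -
    have "complex_of_real (\<integral>x. (cmod (?S D' x - ?S D x))\<^sup>2 \<partial>M) = of_real (sum s {D..<D'})"
      unfolding l2ip_self[symmetric] l2ip_partial_expansion_diff[OF that] s_def ..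
    then have "(\<integral>x. (cmod (?S D' x - ?S D x))\<^sup>2 \<partial>M) = sum s {D..<D'}" by (simp only: of_real_eq_iff)
    also have "\<dots> = sum s {..<D'} - sum s {..<D}"
      using that by (simp add: sum_diff[symmetric] ivl_disj_un_one(2)[symmetric]) (intro sum.cong, auto)
    also have "\<dots> \<le> T D" using sum_le_suminf[OF sm[folded s_def], of "{..<D'}"] s0 by (simp add: T_def)
    finally show ?thesis .
  qed
  have "\<exists>N. \<forall>n\<ge>N. T n \<le> (1/4) ^ i" for i
    using order_tendstoD(2)[OF T0, of "(1/4)^i"] by (auto simp: eventually_sequentially intro: less_imp_le)
  then obtain N where N: "\<And>i n. n \<ge> N i \<Longrightarrow> T n \<le> (1/4) ^ i" by metis
  (* r is monotone with r i \<ge> N i, so the increments along r have squared norm at most (1/4)^i. *)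
  define r where "r = (\<lambda>i. i + (\<Sum>j\<le>i. N j))"
  have rN: "r i \<ge> N i" "r i \<le> r (Suc i)" "r i \<ge> i" for i
    using member_le_sum[of i "{..i}" N] by (auto simp: r_def)
  define u where "u = (\<lambda>i x. ?S (r (Suc i)) x - ?S (r i) x)"
  have u: "sqint M (u i)" for i unfolding u_def by (intro sqint_diff sqint_partial_expansion)
  note [measurable] = sqintD[OF sqint_partial_expansion] sqintD[OF u]
  have u2: "(\<integral>x. (cmod (u i x))\<^sup>2 \<partial>M) \<le> (1/4) ^ i" for i
    using inc[OF rN(2), of i] N[OF rN(1), of i] by (simp add: u_def)
  define m where "m = measure M (space M)"
  have nn: "(\<integral>\<^sup>+ x. ennreal (cmod (u i x)) \<partial>M) \<le> ennreal ((m + 1) * (1/2) ^ i)" for i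
  proof -
    (* t \<le> \<delta> + t^2/\<delta> with \<delta> = (1/2)^i turns the bound in L^2 into one in L^1. *)
    have "cmod (u i x) \<le> (1/2)^i + 2^i * (cmod (u i x))\<^sup>2" for x
    proof -
      have "2^i * cmod (u i x) \<le> 1 + (2^i * cmod (u i x))\<^sup>2"
        using sum_squares_bound_mult[of "2^i * cmod (u i x)" 1] by (simp only: mult_1_right one_power2 add.commute)
      then have "(1/2)^i * (2^i * cmod (u i x)) \<le> (1/2)^i * (1 + (2^i * cmod (u i x))\<^sup>2)"
        by (intro mult_left_mono) auto
      moreover have "(1/2)^i * (2^i * a) = a" for a :: real
        by (simp add: power_one_over)
      moreover have "(1/2)^i * (1 + (2^i * a)\<^sup>2) = (1/2)^i + 2^i * a\<^sup>2" for a :: real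
        by (simp add: power_one_over field_simps power2_eq_square)
      ultimately show ?thesis by metis
    qed
    then have "(\<integral>\<^sup>+ x. ennreal (cmod (u i x)) \<partial>M) \<le> (\<integral>\<^sup>+ x. ennreal ((1/2)^i + 2^i * (cmod (u i x))\<^sup>2) \<partial>M)"
      by (intro nn_integral_mono ennreal_leI)
    also have "\<dots> = ennreal (\<integral>x. (1/2)^i + 2^i * (cmod (u i x))\<^sup>2 \<partial>M)"
      using u[of i] by (intro nn_integral_eq_integral) (auto simp: sqint_def)
    also have "(\<integral>x. (1/2)^i + 2^i * (cmod (u i x))\<^sup>2 \<partial>M) = (1/2)^i * m + 2^i * (\<integral>x. (cmod (u i x))\<^sup>2 \<partial>M)"
      using u[of i] by (subst Bochner_Integration.integral_add) (auto simp: sqint_def m_def)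
    also have "\<dots> \<le> (1/2)^i * m + 2^i * (1/4)^i"
      using u2[of i] by (intro add_left_mono mult_left_mono) auto
    also have "\<dots> = (m + 1) * (1/2)^i"
      by (simp add: power_mult_distrib[symmetric] algebra_simps)
    finally show ?thesis by (simp add: ennreal_leI)
  qed
  have "(\<integral>\<^sup>+ x. (\<Sum>i. ennreal (cmod (u i x))) \<partial>M) = (\<Sum>i. \<integral>\<^sup>+ x. ennreal (cmod (u i x)) \<partial>M)"
    by (rule nn_integral_suminf) measurable
  also have "\<dots> \<le> (\<Sum>i. ennreal ((m + 1) * (1/2) ^ i))"
    by (intro suminf_le nn) auto
  also have "\<dots> = ennreal (\<Sum>i. (m + 1) * (1/2) ^ i)"
    by (rule suminf_ennreal2) (auto simp: m_def intro!: mult_nonneg_nonneg add_nonneg_nonneg summable_mult summable_geometric)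
  also have "\<dots> < \<infinity>" by simp
  finally have "(\<integral>\<^sup>+ x. (\<Sum>i. ennreal (cmod (u i x))) \<partial>M) \<noteq> \<infinity>" by simp
  then have "AE x in M. (\<Sum>i. ennreal (cmod (u i x))) \<noteq> \<infinity>"
    by (intro nn_integral_PInf_AE) auto
  then have conv: "AE x in M. convergent (\<lambda>i. ?S (r i) x)"
  proof eventually_elim
    case (elim x)
    then have "summable (\<lambda>i. cmod (u i x))"
      by (intro summable_suminf_not_top) auto
    then have "summable (\<lambda>i. u i x)" by (rule summable_norm_cancel)
    then have "convergent (\<lambda>n. \<Sum>i<n. u i x)" by (simp add: summable_iff_convergent)
    moreover have "(\<Sum>i<n. u i x) = ?S (r n) x - ?S (r 0) x" for n
      unfolding u_def by (rule sum_lessThan_telescope)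
    ultimately have "convergent (\<lambda>n. ?S (r n) x - ?S (r 0) x)" by simp
    then show ?case using convergent_add[OF _ convergent_const[of "?S (r 0) x"]] by fastforce
  qed
  define f where "f = (\<lambda>x. lim (\<lambda>i. ?S (r i) x))"
  have [measurable]: "f \<in> borel_measurable M"
    unfolding f_def by (rule borel_measurable_lim_metric) measurable
  have lim: "AE x in M. (\<lambda>i. ?S (r i) x) \<longlonglongrightarrow> f x"
    using conv by eventually_elim (simp add: f_def convergent_LIMSEQ_iff)
  have T00: "0 \<le> T D" for D
    using sum_le_suminf[OF sm[folded s_def], of "{..<D}"] s0 by (simp add: T_def)
  have Fatou: "(\<integral>\<^sup>+ x. ennreal ((cmod (f x - ?S D x))\<^sup>2) \<partial>M) \<le> ennreal (T D)" for D
  proof -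
    have "(\<integral>\<^sup>+ x. ennreal ((cmod (f x - ?S D x))\<^sup>2) \<partial>M)
        = (\<integral>\<^sup>+ x. liminf (\<lambda>i. ennreal ((cmod (?S (r i) x - ?S D x))\<^sup>2)) \<partial>M)"
    proof (rule nn_integral_cong_AE, use lim in eventually_elim)
      case (elim x)
      then have "(\<lambda>i. ennreal ((cmod (?S (r i) x - ?S D x))\<^sup>2)) \<longlonglongrightarrow> ennreal ((cmod (f x - ?S D x))\<^sup>2)"
        by (intro tendsto_intros)
      then show ?case by (rule lim_imp_Liminf[OF sequentially_bot, symmetric])
    qed
    also have "\<dots> \<le> liminf (\<lambda>i. \<integral>\<^sup>+ x. ennreal ((cmod (?S (r i) x - ?S D x))\<^sup>2) \<partial>M)"
      by (rule nn_integral_liminf) measurable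
    also have "\<dots> \<le> liminf (\<lambda>i. ennreal (T D))"
    proof (rule Liminf_mono)
      show "\<forall>\<^sub>F i in sequentially. (\<integral>\<^sup>+ x. ennreal ((cmod (?S (r i) x - ?S D x))\<^sup>2) \<partial>M) \<le> ennreal (T D)"
        using eventually_ge_at_top[of D]
      proof eventually_elim
        case (elim i)
        have "(\<integral>\<^sup>+ x. ennreal ((cmod (?S (r i) x - ?S D x))\<^sup>2) \<partial>M) = ennreal (\<integral>x. (cmod (?S (r i) x - ?S D x))\<^sup>2 \<partial>M)"
          using sqint_diff[OF sqint_partial_expansion sqint_partial_expansion, of c "r i" c D]
          by (intro nn_integral_eq_integral) (auto simp: sqint_def)
        also have "\<dots> \<le> ennreal (T D)"
          using inc[of D "r i"] elim rN(3)[of i] by (intro ennreal_leI) auto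
        finally show ?case .
      qed
    qed
    also have "\<dots> = ennreal (T D)" by (simp add: Liminf_const)
    finally show ?thesis .
  qed
  have fS: "sqint M (\<lambda>x. f x - ?S D x)" for D
  proof -
    have "integrable M (\<lambda>x. (cmod (f x - ?S D x))\<^sup>2)"
      using le_less_trans[OF Fatou[of D] ennreal_less_top] by (intro integrableI_nonneg) auto
    then show ?thesis by (simp add: sqint_def)
  qed
  have fST: "Re (l2ip M (\<lambda>x. f x - ?S D x) (\<lambda>x. f x - ?S D x)) \<le> T D" for D
  proof -
    have "ennreal (\<integral>x. (cmod (f x - ?S D x))\<^sup>2 \<partial>M) \<le> ennreal (T D)"
      using fS[of D] Fatou[of D] by (subst nn_integral_eq_integral[symmetric]) (auto simp: sqint_def)
    then show ?thesis using T00 by (simp add: l2ip_self)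
  qed
  have f: "sqint M f"
    using fS[of 0] by (simp add: partial_expansion_def)
  have L: "(\<lambda>D. Re (l2ip M (\<lambda>x. f x - ?S D x) (\<lambda>x. f x - ?S D x))) \<longlonglongrightarrow> 0"
    by (rule tendsto_sandwich[OF _ _ tendsto_const T0]) (simp_all add: l2ip_self_nonneg fST)
  have "l2ip M f (e i) = c i" for i
  proof -
    have "(\<lambda>D. l2ip M (\<lambda>x. f x - ?S D x) (e i)) \<longlonglongrightarrow> 0"
      by (rule l2ip_tendsto_0[OF fS sqint_e L])
    moreover have "\<forall>\<^sub>F D in sequentially. l2ip M (\<lambda>x. f x - ?S D x) (e i) = l2ip M f (e i) - c i"
      using eventually_gt_at_top[of "deg i"]
      by eventually_elim (simp add: l2ip_diff f sqint_partial_expansion sqint_e coeff_partial_expansion)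
    ultimately have "(\<lambda>D. l2ip M f (e i) - c i) \<longlonglongrightarrow> 0" by (rule Lim_transform_eventually)
    then show ?thesis by (simp add: LIMSEQ_const_iff)
  qed
  from f this L show thesis by (rule that)
qed

lemma summable_coeff:
  assumes "sqint M f"
  shows "summable (\<lambda>d. \<Sum>i | deg i = d. (cmod (l2ip M f (e i)))\<^sup>2)"
  by (rule summableI_nonneg_bounded[OF _ Bessel[OF assms]]) (simp add: sum_nonneg)

lemma coeff_unique:
  assumes "sqint M f" "sqint M g" "\<And>i. l2ip M f (e i) = l2ip M g (e i)"
  shows "AE x in M. f x = g x"
  using complete[OF sqint_diff[OF assms(1,2)]] assms by (simp add: l2ip_diff sqint_e)

text \<open>
  The function that Riesz-Fischer attaches to the coefficients of \<open>f\<close> is \<open>f\<close> itself, by completeness; thus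
  the partial sums of \<open>f\<close> converge to \<open>f\<close> in \<open>L\<^sup>2\<close>, and the inner product with \<open>g\<close> is continuous.
\<close>

lemma Parseval:
  assumes f: "sqint M f" and g: "sqint M g"
  shows "(\<lambda>d. \<Sum>i | deg i = d. l2ip M f (e i) * cnj (l2ip M g (e i))) sums l2ip M f g"
proof -
  define c where "c = (\<lambda>i. l2ip M f (e i))"
  let ?S = "partial_expansion c"
  have sm: "summable (\<lambda>d. \<Sum>i | deg i = d. (cmod (c i))\<^sup>2)"
    unfolding c_def by (rule summable_coeff[OF f])
  obtain h where h: "sqint M h" "\<And>i. l2ip M h (e i) = c i"
    "(\<lambda>D. Re (l2ip M (\<lambda>x. h x - ?S D x) (\<lambda>x. h x - ?S D x))) \<longlonglongrightarrow> 0"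
    by (rule Riesz_Fischer[OF sm]) (rule that)
  have "(\<lambda>D. l2ip M (\<lambda>x. h x - ?S D x) g) \<longlonglongrightarrow> 0"
    by (intro l2ip_tendsto_0 h g sqint_diff sqint_partial_expansion)
  then have "(\<lambda>D. l2ip M h g - l2ip M (?S D) g) \<longlonglongrightarrow> 0"
    by (simp add: l2ip_diff h g sqint_partial_expansion)
  then have "(\<lambda>D. l2ip M (?S D) g) \<longlonglongrightarrow> l2ip M h g"
    using tendsto_diff[OF tendsto_const[of "l2ip M h g"]] by fastforce
  moreover have "l2ip M (?S D) g = (\<Sum>d<D. \<Sum>i | deg i = d. c i * cnj (l2ip M g (e i)))" for D
    by (simp add: l2ip_partial_expansion[OF g] sum_deg_less l2ip_cnj)
  moreover have "AE x in M. h x = f x"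
    by (rule coeff_unique[OF h(1) f]) (simp add: h(2) c_def)
  then have "l2ip M h g = l2ip M f g" by (rule l2ip_cong_AE[OF h(1) f g])
  ultimately show ?thesis by (simp add: sums_def c_def)
qed

end

section \<open>Integration by parts and Gaussian integrals\<close>

lemma integral_lborel_shift:
  fixes f :: "'a::euclidean_space \<Rightarrow> 'b::{banach, second_countable_topology}"
  assumes "integrable lborel f"
  shows "integrable lborel (\<lambda>x. f (x + a))" "(\<integral>x. f (x + a) \<partial>lborel) = (\<integral>x. f x \<partial>lborel)"
proof -
  have f: "f \<in> borel_measurable borel" using assms by auto
  have "integrable (distr lborel borel ((+) a)) f" using assms by (simp add: lborel_distr_plus)
  then show "integrable lborel (\<lambda>x. f (x + a))"
    using f by (subst (asm) integrable_distr_eq) (auto simp: add.commute)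
  have "(\<integral>x. f x \<partial>distr lborel borel ((+) a)) = (\<integral>x. f (a + x) \<partial>lborel)"
    using f by (intro integral_distr) auto
  then show "(\<integral>x. f (x + a) \<partial>lborel) = (\<integral>x. f x \<partial>lborel)"
    by (simp add: lborel_distr_plus add.commute)
qed

text \<open>
  The integral of \<open>F'\<close> over the segment from \<open>x\<close> to \<open>x + v\<close> is \<open>F (x + v) - F x\<close>. Integrate over \<open>x\<close> and use
  Fubini and translation invariance. As only integrability is assumed, the lemma covers compactly
  supported functions and polynomials times Gaussians alike.
\<close>

lemma integral_directional_derivative_eq_0:
  fixes F F' :: "'a::euclidean_space \<Rightarrow> 'b::euclidean_space"
  assumes der: "\<And>x. ((\<lambda>t. F (x + t *\<^sub>R v)) has_vector_derivative F' x) (at 0)"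
    and cont: "continuous_on UNIV F'"
    and F: "integrable lborel F" and F': "integrable lborel F'"
  shows "(\<integral>x. F' x \<partial>lborel) = 0"
proof -
  define J where "J = (\<lambda>(s::real) (x::'a). indicator {0..1} s *\<^sub>R F' (x + s *\<^sub>R v))"
  have F'm [measurable]: "F' \<in> borel_measurable borel" using F' by auto
  have Jm: "case_prod J \<in> borel_measurable (lborel \<Otimes>\<^sub>M lborel)"
    unfolding J_def by measurable
  have nJ: "(\<integral>x. norm (J s x) \<partial>lborel) = indicator {0..1} s * (\<integral>x. norm (F' x) \<partial>lborel)" for s
    using integral_lborel_shift(2)[of "\<lambda>x. norm (F' x)" "s *\<^sub>R v"] F' by (simp add: J_def)
  have J: "integrable (lborel \<Otimes>\<^sub>M lborel) (case_prod J)"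
  proof (rule lborel_pair.Fubini_integrable[OF Jm])
    show "integrable lborel (\<lambda>s. \<integral>x. norm (case_prod J (s, x)) \<partial>lborel)"
      by (simp add: nJ)
    show "AE s in lborel. integrable lborel (\<lambda>x. case_prod J (s, x))"
      using integral_lborel_shift(1)[OF F'] by (auto simp: J_def)
  qed
  have "((\<lambda>t. F (x + t *\<^sub>R v)) has_vector_derivative F' (x + s *\<^sub>R v)) (at s)" for x s
  proof -
    have "((\<lambda>t. F ((x + s *\<^sub>R v) + t *\<^sub>R v)) has_vector_derivative F' (x + s *\<^sub>R v)) (at (s - s))"
      using der[of "x + s *\<^sub>R v"] by simp
    then have "(((\<lambda>t. F ((x + s *\<^sub>R v) + t *\<^sub>R v)) \<circ> (\<lambda>t. t - s)) has_vector_derivative 1 *\<^sub>R F' (x + s *\<^sub>R v)) (at s)"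
      by (intro vector_diff_chain_at) (auto intro!: derivative_eq_intros)
    then show ?thesis by (simp add: o_def algebra_simps)
  qed
  then have ftc: "(\<integral>s. J s x \<partial>lborel) = F (x + 1 *\<^sub>R v) - F (x + 0 *\<^sub>R v)" for x
    unfolding J_def by (intro integral_FTC_atLeastAtMost[where F = "\<lambda>t. F (x + t *\<^sub>R v)"])
      (auto intro: has_vector_derivative_at_within intro!: continuous_on_compose2[OF cont] continuous_intros)
  have "(\<integral>x. F' x \<partial>lborel) = (\<integral>s. indicator {0..1} s *\<^sub>R (\<integral>x. F' x \<partial>lborel) \<partial>(lborel::real measure))"
    by simp
  also have "\<dots> = (\<integral>s. (\<integral>x. J s x \<partial>lborel) \<partial>lborel)"
    by (simp add: J_def integral_lborel_shift(2)[OF F'])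
  also have "\<dots> = (\<integral>x. (\<integral>s. J s x \<partial>lborel) \<partial>lborel)"
    by (rule lborel_pair.Fubini_integral[OF J, symmetric])
  also have "\<dots> = (\<integral>x. F (x + v) \<partial>lborel) - (\<integral>x. F x \<partial>lborel)"
    unfolding ftc using integral_lborel_shift(1)[OF F, of v] F by simp
  also have "\<dots> = 0" by (simp add: integral_lborel_shift(2)[OF F])
  finally show ?thesis .
qed

text \<open>
  On the cube \<open>[-m-1, m+1]\<^sup>d\<close> the function is compared with \<open>exp (-c m\<^sup>2)\<close>, where \<open>m\<close> is the integer part of
  the norm; the resulting series converges by the ratio test.
\<close>

lemma integrable_gaussian:
  assumes c: "c > 0"
  shows "integrable lborel (\<lambda>x::'a::euclidean_space. exp (- c * (norm x)\<^sup>2))"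
proof -
  define d where "d = DIM('a)"
  define a where "a = (\<lambda>m. exp (- c * real m ^ 2) * (2 * (real m + 1)) ^ d)"
  have sm: "summable a"
  proof -
    obtain N :: nat where N: "2 ^ d * exp (- c * (2 * real n + 1)) \<le> 1/2" if "n \<ge> N" for n
    proof -
      have "((\<lambda>n. 2 ^ d * exp (- c * (2 * real n + 1))) \<longlongrightarrow> 0) sequentially"
        using c by real_asymp
      then have "eventually (\<lambda>n. 2 ^ d * exp (- c * (2 * real n + 1)) < 1/2) sequentially"
        by (rule order_tendstoD) simp
      then show ?thesis using that by (auto simp: eventually_sequentially intro: less_imp_le)
    qed
    show ?thesis
    proof (rule summable_ratio_test[where c = "1/2" and N = N])
      fix n assume n: "n \<ge> N"
      have "a (Suc n) = exp (- c * real n ^ 2) * exp (- c * (2 * real n + 1)) * (2 * (real n + 2)) ^ d"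
        unfolding a_def exp_add[symmetric] by (simp add: power2_eq_square algebra_simps)
      also have "\<dots> \<le> exp (- c * real n ^ 2) * exp (- c * (2 * real n + 1)) * (2 * (2 * (real n + 1))) ^ d"
        by (intro mult_left_mono power_mono) auto
      also have "\<dots> = (2 ^ d * exp (- c * (2 * real n + 1))) * a n"
        unfolding a_def power_mult_distrib[of 2 "2 * (real n + 1)"] by (simp only: mult_ac)
      also have "\<dots> \<le> 1/2 * a n" using N[OF n] by (intro mult_right_mono) (auto simp: a_def)
      finally show "norm (a (Suc n)) \<le> 1/2 * norm (a n)" by (simp add: a_def)
    qed simp
  qed
  have "(\<integral>\<^sup>+ x. ennreal (exp (- c * (norm (x::'a))\<^sup>2)) \<partial>lborel)
     \<le> (\<integral>\<^sup>+ x. (\<Sum>m. ennreal (exp (- c * real m ^ 2)) * indicator (cbox (- (real m + 1) *\<^sub>R One) ((real m + 1) *\<^sub>R One)) (x::'a)) \<partial>lborel)"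
  proof (rule nn_integral_mono)
    fix x :: 'a
    have single: "g m \<le> (\<Sum>m. g m)" for g :: "nat \<Rightarrow> ennreal" and m
      using sum_le_suminf[of g "{m}"] by simp
    define m where "m = nat \<lfloor>norm x\<rfloor>"
    have m: "real m \<le> norm x" "norm x \<le> real m + 1" by (auto simp: m_def)
    have "x \<in> cbox (- (real m + 1) *\<^sub>R One) ((real m + 1) *\<^sub>R One)"
      using Basis_le_norm[of _ x] m(2) by (auto simp: mem_box inner_sum_left_Basis) (smt (verit))+
    then have "ennreal (exp (- c * (norm x)\<^sup>2)) \<le>
        ennreal (exp (- c * real m ^ 2)) * indicator (cbox (- (real m + 1) *\<^sub>R One) ((real m + 1) *\<^sub>R One)) x"
      using m(1) c by (auto intro!: ennreal_leI mult_left_mono power_mono)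
    also have "\<dots> \<le> (\<Sum>m. ennreal (exp (- c * real m ^ 2)) * indicator (cbox (- (real m + 1) *\<^sub>R One) ((real m + 1) *\<^sub>R One)) x)"
      by (rule single)
    finally show "ennreal (exp (- c * (norm x)\<^sup>2)) \<le> (\<Sum>m. ennreal (exp (- c * real m ^ 2)) * indicator (cbox (- (real m + 1) *\<^sub>R One) ((real m + 1) *\<^sub>R One)) x)" .
  qed
  also have "\<dots> = (\<Sum>m. ennreal (exp (- c * real m ^ 2)) * emeasure lborel (cbox (- (real m + 1) *\<^sub>R One :: 'a) ((real m + 1) *\<^sub>R One)))"
    by (subst nn_integral_suminf) (simp_all add: nn_integral_cmult_indicator)
  also have "\<dots> = (\<Sum>m. ennreal (a m))"
  proof (rule suminf_cong)
    fix m
    have "emeasure lborel (cbox (- (real m + 1) *\<^sub>R One :: 'a) ((real m + 1) *\<^sub>R One)) = ennreal ((2 * (real m + 1)) ^ d)"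
      by (subst emeasure_lborel_cbox) (auto simp: d_def inner_diff_left algebra_simps)
    then show "ennreal (exp (- c * real m ^ 2)) * emeasure lborel (cbox (- (real m + 1) *\<^sub>R One :: 'a) ((real m + 1) *\<^sub>R One)) = ennreal (a m)"
      by (simp add: a_def ennreal_mult)
  qed
  also have "\<dots> = ennreal (\<Sum>m. a m)" using sm by (intro suminf_ennreal2) (auto simp: a_def)
  also have "\<dots> < \<infinity>" by simp
  finally show ?thesis by (intro integrableI_nonneg) auto
qed

text \<open>
  In a product each factor receives half of the exponent, so the induction has to treat all \<open>c\<close> at once.
\<close>

lemma real_polynomial_growth:
  fixes p :: "'a::real_normed_vector \<Rightarrow> real"
  assumes "real_polynomial_function p" "c > 0"
  shows "\<exists>C\<ge>0. \<forall>x. \<bar>p x\<bar> \<le> C * exp (c * (norm x)\<^sup>2)"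
  using assms
proof (induction arbitrary: c rule: real_polynomial_function.induct)
  case (linear f)
  then obtain K where K: "K > 0" "\<And>x. \<bar>f x\<bar> \<le> norm x * K"
    using bounded_linear.pos_bounded[OF linear(1)] by auto
  have "\<bar>f x\<bar> \<le> (K * (1 + 1 / c)) * exp (c * (norm x)\<^sup>2)" for x
  proof -
    have "norm x \<le> 1 + (norm x)\<^sup>2" using sum_squares_bound_mult[of "norm x" 1] by simp
    also have "\<dots> \<le> (1 + 1 / c) * (1 + c * (norm x)\<^sup>2)"
      using linear(2) by (simp add: field_simps)
    also have "\<dots> \<le> (1 + 1 / c) * exp (c * (norm x)\<^sup>2)"
      using linear(2) by (intro mult_left_mono exp_ge_add_one_self) auto
    finally have "norm x * K \<le> ((1 + 1 / c) * exp (c * (norm x)\<^sup>2)) * K"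
      using K(1) by (intro mult_right_mono) auto
    with K(2)[of x] show ?thesis by (simp add: mult_ac)
  qed
  moreover have "0 \<le> K * (1 + 1 / c)" using K linear(2) by simp
  ultimately show ?case by blast
next
  case (const a)
  have "\<bar>a\<bar> \<le> \<bar>a\<bar> * exp (c * (norm x)\<^sup>2)" for x :: 'a
    using const by (simp add: mult_le_cancel_left1)
  then show ?case by (intro exI[of _ "\<bar>a\<bar>"]) auto
next
  case (add f g)
  obtain C D where "C \<ge> 0" "D \<ge> 0" "\<And>x. \<bar>f x\<bar> \<le> C * exp (c * (norm x)\<^sup>2)" "\<And>x. \<bar>g x\<bar> \<le> D * exp (c * (norm x)\<^sup>2)"
    using add.IH(1)[OF add.prems] add.IH(2)[OF add.prems] by metis
  then have "\<bar>f x + g x\<bar> \<le> (C + D) * exp (c * (norm x)\<^sup>2)" for x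
    using abs_triangle_ineq[of "f x" "g x"] by (simp add: distrib_right) (smt (verit))
  with \<open>C \<ge> 0\<close> \<open>D \<ge> 0\<close> show ?case by (intro exI[of _ "C + D"]) auto
next
  case (mult f g)
  have c2: "c / 2 > 0" using mult.prems by simp
  obtain C D where CD: "C \<ge> 0" "D \<ge> 0" "\<And>x. \<bar>f x\<bar> \<le> C * exp (c / 2 * (norm x)\<^sup>2)" "\<And>x. \<bar>g x\<bar> \<le> D * exp (c / 2 * (norm x)\<^sup>2)"
    using mult.IH(1)[OF c2] mult.IH(2)[OF c2] by metis
  have "\<bar>f x * g x\<bar> \<le> (C * D) * exp (c * (norm x)\<^sup>2)" for x
  proof -
    have "\<bar>f x * g x\<bar> \<le> (C * exp (c / 2 * (norm x)\<^sup>2)) * (D * exp (c / 2 * (norm x)\<^sup>2))"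
      unfolding abs_mult using CD by (intro mult_mono) auto
    also have "\<dots> = (C * D) * exp (c / 2 * (norm x)\<^sup>2 + c / 2 * (norm x)\<^sup>2)"
      by (simp only: exp_add mult_ac)
    finally show ?thesis by simp
  qed
  with CD show ?case by (intro exI[of _ "C * D"]) auto
qed

lemma real_polynomial_measurable:
  fixes p :: "'a::euclidean_space \<Rightarrow> real"
  shows "real_polynomial_function p \<Longrightarrow> p \<in> borel_measurable borel"
  by (intro borel_measurable_continuous_onI continuous_on_polymonial_function) (simp add: real_polynomial_function_eq)

lemma integrable_polynomial_gaussian:
  fixes p :: "'a::euclidean_space \<Rightarrow> real"
  assumes p: "real_polynomial_function p" and c: "c > 0"
  shows "integrable lborel (\<lambda>x. p x * exp (- c * (norm x)\<^sup>2))"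
proof -
  obtain C where C: "C \<ge> 0" "\<And>x. \<bar>p x\<bar> \<le> C * exp (c / 2 * (norm x)\<^sup>2)"
    using real_polynomial_growth[OF p, of "c / 2"] c by auto
  have [measurable]: "p \<in> borel_measurable borel" by (rule real_polynomial_measurable[OF p])
  show ?thesis
  proof (rule Bochner_Integration.integrable_bound)
    show "integrable lborel (\<lambda>x::'a. C * exp (- (c / 2) * (norm x)\<^sup>2))"
      by (intro integrable_mult_right integrable_gaussian) (use c in auto)
    have "\<bar>p x * exp (- c * (norm x)\<^sup>2)\<bar> \<le> C * exp (- (c / 2) * (norm x)\<^sup>2)" for x
    proof -
      have "\<bar>p x * exp (- c * (norm x)\<^sup>2)\<bar> \<le> C * exp (c / 2 * (norm x)\<^sup>2) * exp (- c * (norm x)\<^sup>2)"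
        unfolding abs_mult using C by (intro mult_mono) auto
      also have "\<dots> = C * exp (- (c / 2) * (norm x)\<^sup>2)"
        by (simp add: mult.assoc exp_add[symmetric] field_simps)
      finally show ?thesis .
    qed
    then show "AE x in lborel. norm (p x * exp (- c * (norm x)\<^sup>2)) \<le> norm (C * exp (- (c / 2) * (norm x)\<^sup>2))"
      using C(1) by auto
  qed auto
qed

section \<open>Hermite functions\<close>

text \<open>
  Normalized such that differentiation maps \<open>hermite m\<close> to \<open>2 \<surd>m hermite (m - 1)\<close> and its adjoint for the
  weight \<open>exp (-2 t\<^sup>2)\<close> maps it to \<open>2 \<surd>(m + 1) hermite (m + 1)\<close>. The junk index \<open>0 - 1 = 0\<close> always occurs with
  the factor \<open>\<surd>0\<close>.
\<close>

fun hermite :: "nat \<Rightarrow> real \<Rightarrow> real" where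
  "hermite 0 t = 1"
| "hermite (Suc m) t = (4 * t * hermite m t - 2 * sqrt (real m) * hermite (m - 1) t) / (2 * sqrt (real (Suc m)))"

lemma hermite_rec: "4 * t * hermite m t = 2 * sqrt (real (Suc m)) * hermite (Suc m) t + 2 * sqrt (real m) * hermite (m - 1) t"
  by simp

lemma hermite_deriv: "(hermite m has_real_derivative 2 * sqrt (real m) * hermite (m - 1) t) (at t)"
proof (induction m rule: less_induct)
  case (less m)
  show ?case
  proof (cases m)
    case 0
    then show ?thesis by (simp add: fun_eq_iff)
  next
    case (Suc k)
    (* This is the recurrence for hermite k itself, multiplied by 2 \<surd>k. *)
    have ck: "4 * t * (2 * sqrt (real k) * hermite (k - 1) t) - 2 * sqrt (real k) * (2 * sqrt (real (k - 1)) * hermite (k - 1 - 1) t)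
        = 4 * real k * hermite k t"
    proof (cases k)
      case (Suc l)
      have "2 * sqrt (real (Suc l)) * hermite (Suc l) t = 4 * t * hermite l t - 2 * sqrt (real l) * hermite (l - 1) t"
        by simp
      then have "2 * sqrt (real (Suc l)) * (4 * t * hermite l t - 2 * sqrt (real l) * hermite (l - 1) t)
         = 2 * sqrt (real (Suc l)) * (2 * sqrt (real (Suc l)) * hermite (Suc l) t)" by (simp only:)
      also have "\<dots> = 4 * (sqrt (real (Suc l)) * sqrt (real (Suc l))) * hermite (Suc l) t" by (simp add: mult_ac del: real_sqrt_mult_self of_nat_Suc)
      also have "\<dots> = 4 * real (Suc l) * hermite (Suc l) t" by (simp only: real_sqrt_mult_self abs_of_nat)
      finally show ?thesis unfolding Suc by (simp only: diff_Suc_1 right_diff_distrib mult_ac)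
    qed simp
    have "((\<lambda>t. (4 * t * hermite k t - 2 * sqrt (real k) * hermite (k - 1) t) / (2 * sqrt (real (Suc k)))) has_real_derivative
        (4 * hermite k t + 4 * t * (2 * sqrt (real k) * hermite (k - 1) t)
          - 2 * sqrt (real k) * (2 * sqrt (real (k - 1)) * hermite (k - 1 - 1) t)) / (2 * sqrt (real (Suc k)))) (at t)"
      by (rule DERIV_cdivide) (rule derivative_eq_intros less.IH refl | simp add: Suc)+
    also have "4 * hermite k t + 4 * t * (2 * sqrt (real k) * hermite (k - 1) t)
          - 2 * sqrt (real k) * (2 * sqrt (real (k - 1)) * hermite (k - 1 - 1) t) = 4 * real (Suc k) * hermite k t"
      using ck by (simp add: algebra_simps)
    also have "4 * real (Suc k) * hermite k t / (2 * sqrt (real (Suc k))) = 2 * sqrt (real (Suc k)) * hermite k t"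
    proof -
      have s: "sqrt (real (Suc k)) \<noteq> 0" by simp
      have "4 * real (Suc k) * hermite k t = (2 * sqrt (real (Suc k)) * hermite k t) * (2 * sqrt (real (Suc k)))"
        using real_sqrt_mult_self[of "real (Suc k)"] by (simp only: mult_ac abs_of_nat)
      with s show ?thesis by (simp only: nonzero_mult_div_cancel_right mult_eq_0_iff) simp
    qed
    finally show ?thesis by (simp add: Suc fun_eq_iff[symmetric] del: of_nat_Suc)
  qed
qed

definition coord :: "'n \<times> 4 \<Rightarrow> 'n::finite pt \<Rightarrow> real" where
  "coord j x = x $ fst j $ snd j"

definition basis_vec :: "'n \<times> 4 \<Rightarrow> 'n::finite pt" where
  "basis_vec j = axis (fst j) (axis (snd j) 1)"

lemma coord_basis_vec: "coord i (basis_vec j) = (if i = j then 1 else 0)"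
  by (auto simp: coord_def basis_vec_def axis_def prod_eq_iff)

lemma coord_add: "coord i (x + y) = coord i x + coord i y"
  and coord_scale: "coord i (r *\<^sub>R x) = r * coord i x"
  by (simp_all add: coord_def)

lemma coord_shift: "coord i (x + t *\<^sub>R basis_vec j) = coord i x + (if i = j then t else 0)"
  by (simp add: coord_add coord_scale coord_basis_vec)

lemma bounded_linear_coord: "bounded_linear (coord j)"
  unfolding coord_def
  using bounded_linear_compose[OF bounded_linear_vec_nth[of "snd j"] bounded_linear_vec_nth[of "fst j"]] .

lemma inner_coord: "x \<bullet> y = (\<Sum>j\<in>UNIV. coord j x * coord j y)"
  unfolding UNIV_Times_UNIV[symmetric]
  by (simp add: coord_def inner_vec_def sum.cartesian_product case_prod_beta del: UNIV_Times_UNIV)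

lemma norm_coord: "(norm x)\<^sup>2 = (\<Sum>j\<in>UNIV. (coord j x)\<^sup>2)"
  unfolding power2_norm_eq_inner inner_coord by (simp add: power2_eq_square)

lemma coord_expansion: "x = (\<Sum>j\<in>UNIV. coord j x *\<^sub>R basis_vec j)"
proof -
  have "coord i (\<Sum>j\<in>UNIV. coord j x *\<^sub>R basis_vec j) = coord i x" for i
    by (simp add: linear_sum[OF bounded_linear.linear[OF bounded_linear_coord]] coord_scale coord_basis_vec if_distrib[where f = "(*) _"] cong: if_cong)
  from this[of "(_, _)"] show ?thesis by (simp only: coord_def[of "(_, _)"] fst_conv snd_conv vec_eq_iff) simp
qed

lemma norm_shift: "(norm (x + t *\<^sub>R basis_vec j))\<^sup>2 = (norm x)\<^sup>2 + 2 * t * coord j x + t\<^sup>2"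
proof -
  have "(coord i x + (if i = j then t else 0))\<^sup>2 = (coord i x)\<^sup>2 + (if i = j then 2 * t * coord j x + t\<^sup>2 else 0)" for i
    by (auto simp: power2_sum)
  then show ?thesis unfolding norm_coord coord_shift by (simp add: sum.distrib)
qed

definition gauss_norm :: "'n::finite itself \<Rightarrow> real" where
  "gauss_norm _ = (\<integral>x. exp (- 2 * (norm x)\<^sup>2) \<partial>(lborel :: 'n pt measure))"

lemma gauss_norm_pos: "gauss_norm TYPE('n::finite) > 0"
proof -
  have i: "integrable lborel (\<lambda>x::'n pt. exp (- 2 * (norm x)\<^sup>2))"
    by (rule integrable_gaussian) simp
  have "gauss_norm TYPE('n) \<noteq> 0"
  proof
    assume "gauss_norm TYPE('n) = 0"
    then have "AE x in (lborel :: 'n pt measure). exp (- 2 * (norm x)\<^sup>2) = 0"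
      using integral_nonneg_eq_0_iff_AE[OF i] by (simp add: gauss_norm_def)
    then have "AE x in (lborel :: 'n pt measure). False" by simp
    then have "emeasure (lborel :: 'n pt measure) UNIV = 0"
      by (subst (asm) AE_iff_measurable[of UNIV]) auto
    then show False by simp
  qed
  moreover have "gauss_norm TYPE('n) \<ge> 0" by (simp add: gauss_norm_def)
  ultimately show ?thesis by simp
qed

definition herm :: "('n::finite \<times> 4 \<Rightarrow> nat) \<Rightarrow> 'n pt \<Rightarrow> real" where
  "herm \<alpha> x = (\<Prod>j\<in>UNIV. hermite (\<alpha> j) (coord j x)) / sqrt (gauss_norm TYPE('n))"

lemma herm_split:
  "herm \<alpha> (x :: 'n::finite pt) = hermite (\<alpha> j) (coord j x) * ((\<Prod>i\<in>UNIV - {j}. hermite (\<alpha> i) (coord i x)) / sqrt (gauss_norm TYPE('n)))"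
  unfolding herm_def by (subst prod.remove[of UNIV j]) auto

lemma herm_upd:
  "herm (\<alpha>(j := m)) (x :: 'n::finite pt) = hermite m (coord j x) * ((\<Prod>i\<in>UNIV - {j}. hermite (\<alpha> i) (coord i x)) / sqrt (gauss_norm TYPE('n)))"
  unfolding herm_split[of _ x j] by simp

lemma herm_rec:
  "4 * coord j x * herm \<alpha> x = 2 * sqrt (real (Suc (\<alpha> j))) * herm (\<alpha>(j := Suc (\<alpha> j))) x
     + 2 * sqrt (real (\<alpha> j)) * herm (\<alpha>(j := \<alpha> j - 1)) x"
proof -
  define P where "P = (\<Prod>i\<in>UNIV - {j}. hermite (\<alpha> i) (coord i x)) / sqrt (gauss_norm TYPE('a))"
  have "(4 * coord j x * hermite (\<alpha> j) (coord j x)) * P = (2 * sqrt (real (Suc (\<alpha> j))) * hermite (Suc (\<alpha> j)) (coord j x)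
     + 2 * sqrt (real (\<alpha> j)) * hermite (\<alpha> j - 1) (coord j x)) * P"
    by (subst hermite_rec) (rule refl)
  then show ?thesis
    unfolding herm_upd herm_split[of \<alpha> x j] P_def[symmetric] by (simp only: ring_distribs mult_ac)
qed

lemma herm_deriv:
  "((\<lambda>t. herm \<alpha> (x + t *\<^sub>R basis_vec j)) has_real_derivative
     2 * sqrt (real (\<alpha> j)) * herm (\<alpha>(j := \<alpha> j - 1)) x) (at 0)"
proof -
  define P where "P = (\<Prod>i\<in>UNIV - {j}. hermite (\<alpha> i) (coord i x)) / sqrt (gauss_norm TYPE('a))"
  have eq: "herm \<alpha> (x + t *\<^sub>R basis_vec j) = hermite (\<alpha> j) (coord j x + t) * P" for t
    unfolding herm_split[of \<alpha> _ j] P_def by (simp add: coord_shift cong: prod.cong_simp)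
  have "((\<lambda>t. hermite (\<alpha> j) (coord j x + t)) has_real_derivative
      (2 * sqrt (real (\<alpha> j)) * hermite (\<alpha> j - 1) (coord j x + 0)) * (0 + 1)) (at 0)"
    by (rule DERIV_chain2[OF hermite_deriv]) (auto intro!: derivative_eq_intros)
  then have "((\<lambda>t. hermite (\<alpha> j) (coord j x + t) * P) has_real_derivative
      (2 * sqrt (real (\<alpha> j)) * hermite (\<alpha> j - 1) (coord j x)) * P) (at 0)"
    by (intro DERIV_cmult_right) simp
  then show ?thesis unfolding eq herm_upd P_def[symmetric] by (simp only: mult_ac)
qed

lemma gauss_deriv:
  "((\<lambda>t. exp (- 2 * (norm (x + t *\<^sub>R basis_vec j))\<^sup>2)) has_real_derivative
     - 4 * coord j x * exp (- 2 * (norm x)\<^sup>2)) (at 0)"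
  unfolding norm_shift by (auto intro!: derivative_eq_intros)

lemma real_polynomial_function_hermite: "real_polynomial_function (\<lambda>x. hermite m (coord j x))"
proof (induction m rule: less_induct)
  case (less m)
  show ?case
  proof (cases m)
    case (Suc k)
    have "real_polynomial_function (\<lambda>x. (4 * coord j x * hermite k (coord j x) - 2 * sqrt (real k) * hermite (k - 1) (coord j x)) / (2 * sqrt (real (Suc k))))"
      by (intro real_polynomial_function_divide real_polynomial_function_diff real_polynomial_function.intros(4)
         real_polynomial_function.intros(2) real_polynomial_function.intros(1) bounded_linear_coord less.IH) (auto simp: Suc)
    then show ?thesis by (simp add: Suc del: of_nat_Suc)
  qed (simp add: real_polynomial_function.intros(2))
qed

lemma real_polynomial_function_prod':
  assumes "\<And>i. i \<in> I \<Longrightarrow> real_polynomial_function (f i)"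
  shows "real_polynomial_function (\<lambda>x. \<Prod>i\<in>I. f i x)"
  using assms by (induction I rule: infinite_finite_induct) auto

lemma real_polynomial_function_herm: "real_polynomial_function (herm \<alpha>)"
  unfolding herm_def[abs_def]
  by (intro real_polynomial_function_divide real_polynomial_function_prod' real_polynomial_function_hermite)

definition gauss :: "'n::finite pt measure" where
  "gauss = density lborel (\<lambda>x. ennreal (exp (- 2 * (norm x)\<^sup>2)))"

lemma sets_gauss [simp, measurable_cong]: "sets gauss = sets borel"
  and space_gauss [simp]: "space gauss = UNIV"
  by (simp_all add: gauss_def)

lemma AE_gauss: "(AE x in gauss. P x) \<longleftrightarrow> (AE x in lborel. P x)"
  unfolding gauss_def by (subst AE_density) auto

lemma integrable_gauss:
  fixes f :: "'n::finite pt \<Rightarrow> 'b::{banach, second_countable_topology}"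
  shows "f \<in> borel_measurable borel \<Longrightarrow> integrable gauss f \<longleftrightarrow> integrable lborel (\<lambda>x. exp (- 2 * (norm x)\<^sup>2) *\<^sub>R f x)"
  unfolding gauss_def by (rule integrable_density) auto

lemma integral_gauss:
  fixes f :: "'n::finite pt \<Rightarrow> 'b::{banach, second_countable_topology}"
  shows "f \<in> borel_measurable borel \<Longrightarrow> integral\<^sup>L gauss f = (\<integral>x. exp (- 2 * (norm x)\<^sup>2) *\<^sub>R f x \<partial>lborel)"
  unfolding gauss_def by (rule integral_density) auto

lemma integrable_gauss_polynomial: "real_polynomial_function p \<Longrightarrow> integrable gauss p"
  using integrable_polynomial_gaussian[of p 2]
  by (simp add: integrable_gauss real_polynomial_measurable mult.commute)

lemma finite_measure_gauss: "finite_measure (gauss :: 'n::finite pt measure)"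
proof -
  have "integrable gauss (\<lambda>x::'n pt. 1 :: real)"
    by (rule integrable_gauss_polynomial) (rule real_polynomial_function.intros(2))
  then show ?thesis
    by (intro finite_measureI) (auto simp: integrable_iff_bounded top.not_eq_extremum)
qed

text \<open>
  The operator \<open>4 x\<^sub>j - \<partial>\<^sub>j\<close>, which raises the \<open>j\<close>-th index, is the adjoint of \<open>\<partial>\<^sub>j\<close>, which lowers it:
  integrate the derivative of \<open>herm \<alpha> * herm \<beta> * exp (-2 |x|\<^sup>2)\<close>.
\<close>

lemma herm_integral_shift:
  "sqrt (real (Suc (\<alpha> j))) * (\<integral>x. herm (\<alpha>(j := Suc (\<alpha> j))) x * herm \<beta> x \<partial>gauss)
     = sqrt (real (\<beta> j)) * (\<integral>x. herm \<alpha> x * herm (\<beta>(j := \<beta> j - 1)) x \<partial>gauss)"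
proof -
  let ?g = "\<lambda>x. exp (- 2 * (norm x)\<^sup>2)"
  let ?p = "\<lambda>x. herm (\<alpha>(j := Suc (\<alpha> j))) x * herm \<beta> x"
  let ?q = "\<lambda>x. herm \<alpha> x * herm (\<beta>(j := \<beta> j - 1)) x"
  define P where "P = (\<lambda>x. 2 * sqrt (real (\<beta> j)) * ?q x - 2 * sqrt (real (Suc (\<alpha> j))) * ?p x)"
  note poly = real_polynomial_function_herm real_polynomial_function.intros(4) real_polynomial_function.intros(2)
    real_polynomial_function_diff
  have P: "real_polynomial_function P" unfolding P_def by (intro poly)
  have pq: "real_polynomial_function ?p" "real_polynomial_function ?q" by (intro poly)+
  have "(\<integral>x. P x * ?g x \<partial>lborel) = 0"
  proof (rule integral_directional_derivative_eq_0[where v = "basis_vec j" and F = "\<lambda>x. (herm \<alpha> x * herm \<beta> x) * ?g x"])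
    fix x
    have "((\<lambda>t. (herm \<alpha> (x + t *\<^sub>R basis_vec j) * herm \<beta> (x + t *\<^sub>R basis_vec j)) * ?g (x + t *\<^sub>R basis_vec j)) has_real_derivative
       ((2 * sqrt (real (\<alpha> j)) * herm (\<alpha>(j := \<alpha> j - 1)) x) * herm \<beta> (x + 0 *\<^sub>R basis_vec j)
         + (2 * sqrt (real (\<beta> j)) * herm (\<beta>(j := \<beta> j - 1)) x) * herm \<alpha> (x + 0 *\<^sub>R basis_vec j)) * ?g (x + 0 *\<^sub>R basis_vec j)
       + (- 4 * coord j x * ?g x) * (herm \<alpha> (x + 0 *\<^sub>R basis_vec j) * herm \<beta> (x + 0 *\<^sub>R basis_vec j))) (at 0)"
      by (intro DERIV_mult herm_deriv gauss_deriv)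
    also have "((2 * sqrt (real (\<alpha> j)) * herm (\<alpha>(j := \<alpha> j - 1)) x) * herm \<beta> (x + 0 *\<^sub>R basis_vec j)
         + (2 * sqrt (real (\<beta> j)) * herm (\<beta>(j := \<beta> j - 1)) x) * herm \<alpha> (x + 0 *\<^sub>R basis_vec j)) * ?g (x + 0 *\<^sub>R basis_vec j)
       + (- 4 * coord j x * ?g x) * (herm \<alpha> (x + 0 *\<^sub>R basis_vec j) * herm \<beta> (x + 0 *\<^sub>R basis_vec j))
      = (2 * sqrt (real (\<alpha> j)) * herm (\<alpha>(j := \<alpha> j - 1)) x * herm \<beta> x + 2 * sqrt (real (\<beta> j)) * ?q x
         - (4 * coord j x * herm \<alpha> x) * herm \<beta> x) * ?g x"
      by (simp add: algebra_simps)
    also have "\<dots> = P x * ?g x"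
      unfolding herm_rec P_def by (simp add: algebra_simps del: of_nat_Suc)
    finally show "((\<lambda>t. (herm \<alpha> (x + t *\<^sub>R basis_vec j) * herm \<beta> (x + t *\<^sub>R basis_vec j)) * ?g (x + t *\<^sub>R basis_vec j)) has_vector_derivative P x * ?g x) (at 0)"
      by (simp add: has_real_derivative_iff_has_vector_derivative)
  next
    have "continuous_on UNIV P"
      using P by (simp add: continuous_on_polymonial_function real_polynomial_function_eq)
    then show "continuous_on UNIV (\<lambda>x. P x * ?g x)" by (intro continuous_intros)
  next
    show "integrable lborel (\<lambda>x. (herm \<alpha> x * herm \<beta> x) * ?g x)"
      by (intro integrable_polynomial_gaussian poly) simp
    show "integrable lborel (\<lambda>x. P x * ?g x)"
      by (intro integrable_polynomial_gaussian P) simp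
  qed
  then have "(\<integral>x. P x \<partial>gauss) = 0"
    by (simp add: integral_gauss real_polynomial_measurable[OF P] mult.commute)
  also have "(\<integral>x. P x \<partial>gauss) = 2 * sqrt (real (\<beta> j)) * (\<integral>x. ?q x \<partial>gauss) - 2 * sqrt (real (Suc (\<alpha> j))) * (\<integral>x. ?p x \<partial>gauss)"
    unfolding P_def using integrable_gauss_polynomial[OF pq(1)] integrable_gauss_polynomial[OF pq(2)]
    by (simp del: of_nat_Suc)
  finally show ?thesis by simp
qed

text \<open>
  Raising an index on one side amounts to lowering it on the other, which reduces everything to the
  constant function, where the normalization was chosen.
\<close>

lemma herm_orthonormal:
  "(\<integral>x. herm \<alpha> x * herm \<beta> x \<partial>gauss) = (if \<alpha> = \<beta> then 1 else 0)"
proof (induction "\<Sum>j\<in>UNIV. \<alpha> j" arbitrary: \<alpha> \<beta> rule: less_induct)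
  case (less \<alpha>)
  have up: "(\<integral>x. herm \<gamma> x * herm \<beta> x \<partial>gauss) = sqrt (real (\<beta> j)) / sqrt (real (\<gamma> j)) *
      (\<integral>x. herm (\<gamma>(j := \<gamma> j - 1)) x * herm (\<beta>(j := \<beta> j - 1)) x \<partial>gauss)" if "\<gamma> j > 0" for \<gamma> \<beta> :: "'a \<times> 4 \<Rightarrow> nat" and j
    using herm_integral_shift[of "\<gamma>(j := \<gamma> j - 1)" j \<beta>] that
    by (simp add: fun_upd_idem field_simps)
  show ?case
  proof (cases "\<exists>j. \<alpha> j > 0")
    case True
    then obtain j where j: "\<alpha> j > 0" by blast
    have "(\<Sum>i\<in>UNIV. (\<alpha>(j := \<alpha> j - 1)) i) < (\<Sum>i\<in>UNIV. \<alpha> i)"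
      using j by (intro sum_strict_mono_ex1 ballI bexI[of _ j]) simp_all
    then have IH: "(\<integral>x. herm (\<alpha>(j := \<alpha> j - 1)) x * herm (\<beta>(j := \<beta> j - 1)) x \<partial>gauss)
        = (if \<alpha>(j := \<alpha> j - 1) = \<beta>(j := \<beta> j - 1) then 1 else 0)" by (rule less)
    show ?thesis
    proof (cases "\<beta> j > 0")
      case True
      have "\<alpha>(j := \<alpha> j - 1) = \<beta>(j := \<beta> j - 1) \<longleftrightarrow> \<alpha> = \<beta>"
        using j True by (auto simp: fun_eq_iff split: if_splits) (metis Suc_pred)
      then show ?thesis using up[where \<gamma> = \<alpha> and j = j and \<beta> = \<beta>, OF j] IH j by auto
    next
      case False
      with j have "\<alpha> \<noteq> \<beta>" by auto
      with False show ?thesis using up[where \<gamma> = \<alpha> and j = j and \<beta> = \<beta>, OF j] by simp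
    qed
  next
    case False
    then have \<alpha>: "\<alpha> = (\<lambda>_. 0)" by auto
    show ?thesis
    proof (cases "\<exists>j. \<beta> j > 0")
      case True
      then obtain j where j: "\<beta> j > 0" by blast
      then have "\<alpha> \<noteq> \<beta>" using \<alpha> by auto
      with up[where \<gamma> = \<beta> and j = j and \<beta> = \<alpha>, OF j] show ?thesis by (simp add: \<alpha> mult.commute)
    next
      case False
      then have \<beta>: "\<beta> = \<alpha>" using \<alpha> by auto
      have "herm \<alpha> x * herm \<alpha> x = 1 / gauss_norm TYPE('a)" for x :: "'a pt"
        using gauss_norm_pos[where 'n = 'a] by (simp add: herm_def \<alpha>)
      then have "(\<integral>x. herm \<alpha> x * herm \<alpha> x \<partial>gauss) = (\<integral>x. exp (- 2 * (norm x)\<^sup>2) * (1 / gauss_norm TYPE('a)) \<partial>(lborel :: 'a pt measure))"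
        by (simp only:) (subst integral_gauss, auto)
      also have "\<dots> = 1" using gauss_norm_pos[where 'n = 'a] by (simp add: gauss_norm_def)
      finally show ?thesis by (simp add: \<beta>)
    qed
  qed
qed

section \<open>Completeness of the Hermite functions\<close>

text \<open>
  By the recurrence this span is closed under multiplication by the coordinates; hence it
  consists of all polynomials.
\<close>

inductive hermite_span :: "('n::finite pt \<Rightarrow> real) \<Rightarrow> bool" where
  herm: "hermite_span (herm \<alpha>)"
| add: "hermite_span p \<Longrightarrow> hermite_span q \<Longrightarrow> hermite_span (\<lambda>x. p x + q x)"
| scale: "hermite_span p \<Longrightarrow> hermite_span (\<lambda>x. c * p x)"

lemma hermite_span_sum: "(\<And>i. i \<in> I \<Longrightarrow> hermite_span (f i)) \<Longrightarrow> hermite_span (\<lambda>x. \<Sum>i\<in>I. f i x)"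
proof (induction I rule: infinite_finite_induct)
  case (infinite A)
  then show ?case using hermite_span.scale[OF hermite_span.herm, of 0] by simp
next
  case empty
  then show ?case using hermite_span.scale[OF hermite_span.herm, of 0] by simp
qed (auto intro: hermite_span.add)

lemma hermite_span_coord: "hermite_span q \<Longrightarrow> hermite_span (\<lambda>x. coord j x * q x)"
proof (induction rule: hermite_span.induct)
  case (herm \<alpha>)
  have "coord j x * herm \<alpha> x = (sqrt (real (Suc (\<alpha> j))) / 2) * herm (\<alpha>(j := Suc (\<alpha> j))) x
     + (sqrt (real (\<alpha> j)) / 2) * herm (\<alpha>(j := \<alpha> j - 1)) x" for x
    using herm_rec[of j x \<alpha>] by (simp add: field_simps)
  then show ?case by (simp only:) (intro hermite_span.intros)
next
  case (add p q)
  then show ?case using hermite_span.add[of "\<lambda>x. coord j x * p x" "\<lambda>x. coord j x * q x"] by (simp add: distrib_left)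
next
  case (scale p c)
  then show ?case using hermite_span.scale[of "\<lambda>x. coord j x * p x" c] by (simp add: mult.left_commute)
qed

lemma hermite_span_mult: "real_polynomial_function p \<Longrightarrow> hermite_span q \<Longrightarrow> hermite_span (\<lambda>x. p x * q x)"
proof (induction arbitrary: q rule: real_polynomial_function.induct)
  case (linear f)
  have lin: "linear f" by (rule bounded_linear.linear[OF linear(1)])
  have fx: "f x = (\<Sum>j\<in>UNIV. f (basis_vec j) * coord j x)" for x
  proof -
    have "f x = f (\<Sum>j\<in>UNIV. coord j x *\<^sub>R basis_vec j)"
      by (rule arg_cong[where f = f, OF coord_expansion])
    also have "\<dots> = (\<Sum>j\<in>UNIV. f (basis_vec j) * coord j x)"
      by (simp only: linear_sum[OF lin] linear_scale[OF lin] real_scaleR_def mult.commute)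
    finally show ?thesis .
  qed
  have "f x * q x = (\<Sum>j\<in>UNIV. f (basis_vec j) * (coord j x * q x))" for x
    by (simp only: fx[of x] sum_distrib_right mult.assoc)
  moreover have "hermite_span (\<lambda>x. \<Sum>j\<in>UNIV. f (basis_vec j) * (coord j x * q x))"
    by (intro hermite_span_sum hermite_span.scale hermite_span_coord linear)
  ultimately show ?case by (simp only:)
next
  case (const c)
  then show ?case by (rule hermite_span.scale)
next
  case (add f g)
  then show ?case using hermite_span.add[of "\<lambda>x. f x * q x" "\<lambda>x. g x * q x"] by (simp add: distrib_right)
next
  case (mult f g)
  then show ?case using mult.IH(1)[OF mult.IH(2)[OF mult.prems]] by (simp add: mult.assoc)
qed

lemma hermite_span_polynomial: "real_polynomial_function p \<Longrightarrow> hermite_span (p :: 'n::finite pt \<Rightarrow> real)"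
proof -
  assume p: "real_polynomial_function p"
  have "herm (\<lambda>_. 0) (x :: 'n pt) = 1 / sqrt (gauss_norm TYPE('n))" for x by (simp add: herm_def)
  then have eq: "(\<lambda>x. p x * (sqrt (gauss_norm TYPE('n)) * herm (\<lambda>_. 0) x)) = p"
    using gauss_norm_pos[where 'n = 'n] by (simp add: fun_eq_iff)
  have "hermite_span (\<lambda>x. p x * (sqrt (gauss_norm TYPE('n)) * herm (\<lambda>_. 0) x))"
    by (intro hermite_span_mult[OF p] hermite_span.intros)
  then show ?thesis unfolding eq .
qed

lemma sqint_gauss_iff:
  "sqint gauss f \<longleftrightarrow> f \<in> borel_measurable borel \<and> integrable lborel (\<lambda>x. (cmod (f x))\<^sup>2 * exp (- 2 * (norm x)\<^sup>2))"
  by (auto simp: sqint_def integrable_gauss mult.commute cong: measurable_cong_sets)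

lemma sqint_polynomial: "real_polynomial_function p \<Longrightarrow> sqint gauss (\<lambda>x. complex_of_real (p x))"
  using integrable_gauss_polynomial[of "\<lambda>x. p x * p x"] real_polynomial_measurable[of p]
  by (auto simp: sqint_def power2_eq_square real_polynomial_function.intros(4))

definition perp_polynomials :: "('n::finite pt \<Rightarrow> complex) \<Rightarrow> bool" where
  "perp_polynomials f \<longleftrightarrow> sqint gauss f \<and>
     (\<forall>p. real_polynomial_function p \<longrightarrow> (\<integral>x. f x * of_real (p x) \<partial>gauss) = 0)"

lemma perp_polynomialsI:
  fixes f :: "'n::finite pt \<Rightarrow> complex"
  assumes f: "sqint gauss f" and h: "\<And>\<alpha>. (\<integral>x. f x * of_real (herm \<alpha> x) \<partial>gauss) = 0"
  shows "perp_polynomials f"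
proof -
  have "real_polynomial_function q \<and> (\<integral>x. f x * of_real (q x) \<partial>gauss) = 0" if "hermite_span q" for q
    using that
  proof induction
    case (herm \<alpha>)
    then show ?case using h real_polynomial_function_herm by auto
  next
    case (add p q)
    then show ?case
      using sqint_integrable_mult'[OF f sqint_polynomial[of p]] sqint_integrable_mult'[OF f sqint_polynomial[of q]]
      by (auto simp: distrib_left intro: real_polynomial_function.intros(3))
  next
    case (scale p c)
    then show ?case
      by (auto simp: mult.left_commute[of _ "complex_of_real c"] intro: real_polynomial_function.intros)
  qed
  then show ?thesis using f hermite_span_polynomial by (auto simp: perp_polynomials_def)
qed

lemma abs_exp_partial_sum_le: "\<bar>\<Sum>m<M. y ^ m / fact m\<bar> \<le> exp \<bar>y :: real\<bar>"
proof -
  have s: "summable (\<lambda>m. \<bar>y\<bar> ^ m / fact m)"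
    using summable_exp[of "\<bar>y\<bar>"] by (simp add: field_simps)
  have "\<bar>\<Sum>m<M. y ^ m / fact m\<bar> \<le> (\<Sum>m<M. \<bar>y\<bar> ^ m / fact m)"
    by (rule order_trans[OF sum_abs]) (simp add: power_abs)
  also have "\<dots> \<le> (\<Sum>m. \<bar>y\<bar> ^ m / fact m)"
    by (rule sum_le_suminf[OF s]) auto
  also have "\<dots> = exp \<bar>y\<bar>" by (simp add: exp_def scaleR_conv_of_real field_simps)
  finally show ?thesis .
qed

lemma exp_partial_sums: "(\<lambda>M. \<Sum>m<M. y ^ m / fact m) \<longlonglongrightarrow> exp (y :: real)"
  using exp_converges[of y] by (simp add: sums_def scaleR_conv_of_real field_simps)

lemma real_polynomial_norm2: "real_polynomial_function (\<lambda>x::'n::finite pt. (norm x)\<^sup>2)"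
  unfolding norm_coord unfolding power2_eq_square
  by (intro real_polynomial_function_sum real_polynomial_function.intros bounded_linear_coord) auto

lemma real_polynomial_function_power':
  "real_polynomial_function f \<Longrightarrow> real_polynomial_function (\<lambda>x. f x ^ m)"
  by (induction m) (auto intro: real_polynomial_function.intros)

text \<open>
  Expand the exponential into its power series. The partial sums are polynomials and are dominated by
  \<open>exp (|x|\<^sup>2 / 2)\<close>, which is still square integrable with respect to the weight \<open>exp (-2 |x|\<^sup>2)\<close>. The rate 1/2 is
  small enough for this domination, and the lemma can be iterated.
\<close>

lemma perp_polynomials_exp:
  fixes f :: "'n::finite pt \<Rightarrow> complex"
  assumes f: "perp_polynomials f"
  shows "perp_polynomials (\<lambda>x. of_real (exp (- (norm x)\<^sup>2 / 2)) * f x)"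
  unfolding perp_polynomials_def
proof (intro conjI allI impI)
  have sf: "sqint gauss f" using f by (simp add: perp_polynomials_def)
  note [measurable] = sqintD[OF sf]
  have [measurable]: "(\<lambda>x::'n pt. exp (- (norm x)\<^sup>2 / 2)) \<in> borel_measurable borel" by measurable
  show "sqint gauss (\<lambda>x. of_real (exp (- (norm x)\<^sup>2 / 2)) * f x)"
    by (rule sqint_bounded_mult[OF sf, where B = 1]) auto
  fix p :: "'n pt \<Rightarrow> real" assume p: "real_polynomial_function p"
  note [measurable] = real_polynomial_measurable[OF p]
  define y where "y = (\<lambda>x::'n pt. - (norm x)\<^sup>2 / 2)"
  have [measurable]: "y \<in> borel_measurable borel" unfolding y_def by measurable
  have y: "real_polynomial_function y"
    unfolding y_def by (intro real_polynomial_function_divide real_polynomial_function_minus real_polynomial_norm2)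
  have h: "sqint gauss (\<lambda>x. complex_of_real (p x * exp (\<bar>y x\<bar>)))"
  proof -
    have "(cmod (complex_of_real (p x * exp (\<bar>y x\<bar>))))\<^sup>2 * exp (- 2 * (norm x)\<^sup>2) = p x * p x * exp (- 1 * (norm x)\<^sup>2)" for x
    proof -
      have "(exp \<bar>y x\<bar>)\<^sup>2 * exp (- 2 * (norm x)\<^sup>2) = exp (- 1 * (norm x)\<^sup>2)"
        unfolding power2_eq_square exp_add[symmetric] by (simp add: y_def power2_eq_square)
      moreover have "(cmod (complex_of_real (p x * exp (\<bar>y x\<bar>))))\<^sup>2 = p x * p x * (exp \<bar>y x\<bar>)\<^sup>2"
        unfolding norm_of_real power2_abs power_mult_distrib power2_eq_square[of "p x"] ..
      ultimately show ?thesis by (simp only: mult.assoc)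
    qed
    moreover have "integrable lborel (\<lambda>x. p x * p x * exp (- 1 * (norm x)\<^sup>2))"
      by (intro integrable_polynomial_gaussian real_polynomial_function.intros p) simp
    moreover have "(\<lambda>x. complex_of_real (p x * exp (\<bar>y x\<bar>))) \<in> borel_measurable borel" by measurable
    ultimately show ?thesis unfolding sqint_gauss_iff by (simp only:)
  qed
  have "(\<lambda>M. \<integral>x. f x * of_real (p x * (\<Sum>m<M. y x ^ m / fact m)) \<partial>gauss)
      \<longlonglongrightarrow> (\<integral>x. of_real (exp (- (norm x)\<^sup>2 / 2)) * f x * of_real (p x) \<partial>gauss)"
  proof (rule integral_dominated_convergence)
    show "integrable gauss (\<lambda>x. norm (f x * complex_of_real (p x * exp (\<bar>y x\<bar>))))"
      by (intro integrable_norm sqint_integrable_mult'[OF sf h])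
    show "AE x in gauss. (\<lambda>M. f x * of_real (p x * (\<Sum>m<M. y x ^ m / fact m)))
        \<longlonglongrightarrow> of_real (exp (- (norm x)\<^sup>2 / 2)) * f x * of_real (p x)"
    proof (rule AE_I2)
      fix x
      have "(\<lambda>M. f x * of_real (p x * (\<Sum>m<M. y x ^ m / fact m))) \<longlonglongrightarrow> f x * of_real (p x * exp (y x))"
        by (intro tendsto_intros exp_partial_sums)
      then show "(\<lambda>M. f x * of_real (p x * (\<Sum>m<M. y x ^ m / fact m)))
        \<longlonglongrightarrow> of_real (exp (- (norm x)\<^sup>2 / 2)) * f x * of_real (p x)"
        by (simp add: y_def mult_ac)
    qed
    show "AE x in gauss. norm (f x * of_real (p x * (\<Sum>m<M. y x ^ m / fact m))) \<le> norm (f x * complex_of_real (p x * exp (\<bar>y x\<bar>)))" for M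
      using abs_exp_partial_sum_le by (auto simp: norm_mult simp del: of_real_sum intro!: mult_left_mono)
  qed measurable
  moreover have "(\<integral>x. f x * of_real (p x * (\<Sum>m<M. y x ^ m / fact m)) \<partial>gauss) = 0" for M
  proof -
    have "real_polynomial_function (\<lambda>x. p x * (\<Sum>m<M. y x ^ m / fact m))"
      by (intro real_polynomial_function.intros(4) p real_polynomial_function_sum real_polynomial_function_divide
          real_polynomial_function_power' y) auto
    then show ?thesis using f by (simp only: perp_polynomials_def)
  qed
  ultimately show "(\<integral>x. of_real (exp (- (norm x)\<^sup>2 / 2)) * f x * of_real (p x) \<partial>gauss) = 0"
    by (simp add: LIMSEQ_const_iff)
qed

text \<open>
  An injective map with bounded image which tends to 0 at infinity: its components separate the points
  of the one-point compactification, so the Stone-Weierstrass theorem applies to polynomials in them.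
\<close>

definition compactify :: "'n::finite pt \<Rightarrow> real \<times> 'n pt" where
  "compactify x = (exp (- (norm x)\<^sup>2 / 2), exp (- (norm x)\<^sup>2 / 2) *\<^sub>R x)"

lemma exp_growth: "exp (- (norm x)\<^sup>2 / 2) * norm (x :: 'a::real_normed_vector) \<le> 1"
proof -
  have "norm x \<le> 1 + (norm x)\<^sup>2 / 2"
    using zero_le_power2[of "norm x - 1"] unfolding power2_diff by simp
  also have "\<dots> \<le> exp ((norm x)\<^sup>2 / 2)" by (rule exp_ge_add_one_self)
  finally have "exp (- (norm x)\<^sup>2 / 2) * norm x \<le> exp (- (norm x)\<^sup>2 / 2) * exp ((norm x)\<^sup>2 / 2)"
    by (intro mult_left_mono) auto
  then show ?thesis by (simp add: exp_add[symmetric])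
qed

text \<open>
  A linear form of \<open>compactify x\<close> is \<open>exp (-|x|\<^sup>2 / 2)\<close> times a polynomial, and multiplication by either factor
  preserves orthogonality to the polynomials. Products are handled by iteration, which is
  why \<open>f\<close> is arbitrary in the induction.
\<close>

lemma perp_polynomials_compactify:
  fixes f :: "'n::finite pt \<Rightarrow> complex" and q :: "real \<times> 'n pt \<Rightarrow> real"
  assumes "real_polynomial_function q" "perp_polynomials f"
  shows "perp_polynomials (\<lambda>x. of_real (q (compactify x)) * f x)"
  using assms
proof (induction arbitrary: f rule: real_polynomial_function.induct)
  case (linear l)
  have sf: "sqint gauss f" using linear(2) by (simp add: perp_polynomials_def)
  have [measurable]: "l \<in> borel_measurable borel"
    by (rule real_polynomial_measurable[OF real_polynomial_function.intros(1)[OF linear(1)]])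
  obtain K where K: "\<And>z. norm (l z) \<le> norm z * K" "K > 0"
    using bounded_linear.pos_bounded[OF linear(1)] by auto
  have cm: "(\<lambda>x. l (compactify x)) \<in> borel_measurable borel"
    unfolding compactify_def by measurable
  have bd: "\<bar>l (compactify x)\<bar> \<le> 2 * K" for x
  proof -
    have "norm (compactify x) \<le> \<bar>exp (- (norm x)\<^sup>2 / 2)\<bar> + norm (exp (- (norm x)\<^sup>2 / 2) *\<^sub>R x)"
      unfolding compactify_def using norm_Pair_le[of "exp (- (norm x)\<^sup>2 / 2)" "exp (- (norm x)\<^sup>2 / 2) *\<^sub>R x"] by simp
    also have "\<dots> \<le> 1 + 1" using exp_growth[of x] by (intro add_mono) auto
    finally have "norm (compactify x) * K \<le> 2 * K" using K(2) by (intro mult_right_mono) auto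
    with K(1)[of "compactify x"] show ?thesis by simp
  qed
  show ?case unfolding perp_polynomials_def
  proof (intro conjI allI impI)
    show "sqint gauss (\<lambda>x. of_real (l (compactify x)) * f x)"
      using bd cm by (intro sqint_bounded_mult[OF sf, where B = "2 * K"]) auto
    fix p :: "'n pt \<Rightarrow> real" assume p: "real_polynomial_function p"
    define r where "r = (\<lambda>x. l (1, 0) + l (0, x))"
    have lin: "linear l" by (rule bounded_linear.linear[OF linear(1)])
    have "l (compactify x) = exp (- (norm x)\<^sup>2 / 2) * r x" for x
    proof -
      have "compactify x = exp (- (norm x)\<^sup>2 / 2) *\<^sub>R ((1, 0) + (0, x))" by (simp add: compactify_def)
      then show ?thesis by (simp add: linear_add[OF lin] linear_scale[OF lin] r_def del: add_Pair)
    qed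
    moreover have "real_polynomial_function r"
      unfolding r_def
      by (intro real_polynomial_function.intros(2,3) real_polynomial_function.intros(1) bounded_linear_compose[OF linear(1)]
          bounded_linear_Pair bounded_linear_zero bounded_linear_ident)
    then have "real_polynomial_function (\<lambda>x. r x * p x)" by (intro real_polynomial_function.intros(4) p)
    then have "(\<integral>x. of_real (exp (- (norm x)\<^sup>2 / 2)) * f x * of_real (r x * p x) \<partial>gauss) = 0"
      using perp_polynomials_exp[OF linear(2)] unfolding perp_polynomials_def by blast
    ultimately show "(\<integral>x. of_real (l (compactify x)) * f x * of_real (p x) \<partial>gauss) = 0"
      by (simp add: mult_ac)
  qed
next
  case (const c)
  then show ?case
    by (auto simp: perp_polynomials_def sqint_cmult mult.assoc)
next
  case (add g h)
  have gh: "perp_polynomials (\<lambda>x. of_real (g (compactify x)) * f x)" "perp_polynomials (\<lambda>x. of_real (h (compactify x)) * f x)"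
    by (intro add)+
  then have s: "sqint gauss (\<lambda>x. of_real (g (compactify x)) * f x)" "sqint gauss (\<lambda>x. of_real (h (compactify x)) * f x)"
    by (simp_all add: perp_polynomials_def)
  show ?case unfolding perp_polynomials_def
  proof (intro conjI allI impI)
    show "sqint gauss (\<lambda>x. of_real (g (compactify x) + h (compactify x)) * f x)"
      using sqint_add[OF s] by (simp add: distrib_right)
    fix p :: "'n pt \<Rightarrow> real" assume p: "real_polynomial_function p"
    show "(\<integral>x. of_real (g (compactify x) + h (compactify x)) * f x * of_real (p x) \<partial>gauss) = 0"
      using gh p sqint_integrable_mult'[OF s(1) sqint_polynomial[OF p]] sqint_integrable_mult'[OF s(2) sqint_polynomial[OF p]]
      by (simp add: perp_polynomials_def distrib_right)
  qed
next
  case (mult g h)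
  have "perp_polynomials (\<lambda>x. of_real (g (compactify x)) * (of_real (h (compactify x)) * f x))"
    by (intro mult)
  then show ?case by (simp add: mult.assoc)
qed

text \<open>
  The function \<open>\<psi>\<close> factors through \<open>compactify\<close> as \<open>G \<circ> compactify\<close> with a continuous \<open>G\<close>, and \<open>G\<close> is a uniform limit
  of polynomials on the ball that contains the image.
\<close>

lemma perp_polynomials_test:
  fixes f :: "'n::finite pt \<Rightarrow> complex" and \<psi> :: "'n pt \<Rightarrow> real"
  assumes f: "perp_polynomials f" and cont: "continuous_on UNIV \<psi>" and R: "\<And>x. norm x > R \<Longrightarrow> \<psi> x = 0"
  shows "(\<integral>x. of_real (\<psi> x) * f x \<partial>gauss) = 0"
proof -
  interpret finite_measure "gauss :: 'n pt measure" by (rule finite_measure_gauss)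
  have sf: "sqint gauss f" using f by (simp add: perp_polynomials_def)
  have "sqint gauss (\<lambda>x. 1)" using sqint_polynomial[of "\<lambda>x. 1"] real_polynomial_function.intros(2)[of 1] by simp
  from sqint_integrable_mult'[OF this sf] have fi: "integrable gauss f" by simp
  have [measurable]: "\<psi> \<in> borel_measurable borel" using cont by (rule borel_measurable_continuous_onI)
  have [measurable]: "f \<in> borel_measurable borel" using sqintD[OF sf] by simp
  define a0 where "a0 = exp (- (max R 0)\<^sup>2 / 2) / 2"
  have a0: "a0 > 0" by (simp add: a0_def)
  (* On the image v / a recovers x. The last factor vanishes for a \<le> a0, and it is 1 for a \<ge> 2 a0, that is, on the ball of radius R. *)
  define G :: "real \<times> 'n pt \<Rightarrow> real" where
    "G = (\<lambda>(a, v). \<psi> ((1 / max a a0) *\<^sub>R v) * min 1 (max 0 ((a - a0) / a0)))"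
  have "continuous_on UNIV G"
    unfolding G_def case_prod_beta using a0
    by (intro continuous_intros continuous_on_compose2[OF cont]) auto
  then have Gc: "continuous_on (cball 0 2) G" by (rule continuous_on_subset) simp
  have G: "G (compactify x) = \<psi> x" for x
  proof (cases "norm x > R")
    case True
    show ?thesis
    proof (cases "exp (- (norm x)\<^sup>2 / 2) \<ge> a0")
      case True
      then show ?thesis using R[OF \<open>norm x > R\<close>] by (simp add: G_def compactify_def)
    next
      case False
      then have "(exp (- (norm x)\<^sup>2 / 2) - a0) / a0 \<le> 0"
        using a0 by (simp add: divide_le_0_iff)
      then have "min 1 (max 0 ((exp (- (norm x)\<^sup>2 / 2) - a0) / a0)) = 0" by simp
      then show ?thesis using R[OF \<open>norm x > R\<close>] by (simp add: G_def compactify_def)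
    qed
  next
    case False
    then have "(norm x)\<^sup>2 \<le> (max R 0)\<^sup>2" by (intro power_mono) auto
    then have "exp (- (max R 0)\<^sup>2 / 2) \<le> exp (- (norm x)\<^sup>2 / 2)" by simp
    then have e: "2 * a0 \<le> exp (- (norm x)\<^sup>2 / 2)" by (simp add: a0_def)
    then have "min 1 (max 0 ((exp (- (norm x)\<^sup>2 / 2) - a0) / a0)) = 1"
      using a0 by (simp add: field_simps)
    moreover have "max (exp (- (norm x)\<^sup>2 / 2)) a0 = exp (- (norm x)\<^sup>2 / 2)" using e a0 by simp
    ultimately show ?thesis by (simp add: G_def compactify_def)
  qed
  have bd: "compactify x \<in> cball 0 2" for x :: "'n pt"
  proof -
    have "norm (compactify x) \<le> \<bar>exp (- (norm x)\<^sup>2 / 2)\<bar> + norm (exp (- (norm x)\<^sup>2 / 2) *\<^sub>R x)"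
      unfolding compactify_def using norm_Pair_le[of "exp (- (norm x)\<^sup>2 / 2)" "exp (- (norm x)\<^sup>2 / 2) *\<^sub>R x"] by simp
    also have "\<dots> \<le> 1 + 1" using exp_growth[of x] by (intro add_mono) auto
    finally show ?thesis by simp
  qed
  have le: "cmod (\<integral>x. of_real (\<psi> x) * f x \<partial>gauss) \<le> e * (\<integral>x. cmod (f x) \<partial>gauss)" if e: "e > 0" for e
  proof -
    obtain q where q: "real_polynomial_function q" "\<And>z. z \<in> cball 0 2 \<Longrightarrow> \<bar>G z - q z\<bar> < e"
      using Stone_Weierstrass_real_polynomial_function[OF compact_cball Gc e] by blast
    have pq: "perp_polynomials (\<lambda>x. of_real (q (compactify x)) * f x)"
      by (rule perp_polynomials_compactify[OF q(1) f])
    then have "(\<integral>x. of_real (q (compactify x)) * f x * of_real 1 \<partial>gauss) = 0"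
      using real_polynomial_function.intros(2)[of 1] unfolding perp_polynomials_def by blast
    then have q0: "(\<integral>x. of_real (q (compactify x)) * f x \<partial>gauss) = 0" by simp
    have qi: "integrable gauss (\<lambda>x. of_real (q (compactify x)) * f x)"
      using sqint_integrable_mult'[OF \<open>sqint gauss (\<lambda>x. 1)\<close>, of "\<lambda>x. of_real (q (compactify x)) * f x"] pq
      by (simp add: perp_polynomials_def)
    have di: "cmod (of_real (\<psi> x) * f x - of_real (q (compactify x)) * f x) \<le> e * cmod (f x)" for x
    proof -
      have "cmod (of_real (\<psi> x) * f x - of_real (q (compactify x)) * f x) = \<bar>\<psi> x - q (compactify x)\<bar> * cmod (f x)"
        by (simp add: left_diff_distrib[symmetric] norm_mult flip: of_real_diff)
      also have "\<dots> \<le> e * cmod (f x)"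
        using q(2)[OF bd[of x]] unfolding G by (intro mult_right_mono) auto
      finally show ?thesis .
    qed
    have i2: "integrable gauss (\<lambda>x. of_real (\<psi> x) * f x - of_real (q (compactify x)) * f x)"
    proof (rule Bochner_Integration.integrable_bound)
      show "integrable gauss (\<lambda>x. e * cmod (f x))" using fi by simp
      show "(\<lambda>x. of_real (\<psi> x) * f x - of_real (q (compactify x)) * f x) \<in> borel_measurable gauss"
        using borel_measurable_integrable[OF qi] by measurable
      show "AE x in gauss. norm (of_real (\<psi> x) * f x - of_real (q (compactify x)) * f x) \<le> norm (e * cmod (f x))"
        using di e by auto
    qed
    have "(\<integral>x. of_real (\<psi> x) * f x \<partial>gauss) = (\<integral>x. (of_real (\<psi> x) * f x - of_real (q (compactify x)) * f x) + of_real (q (compactify x)) * f x \<partial>gauss)"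
      by simp
    also have "\<dots> = (\<integral>x. of_real (\<psi> x) * f x - of_real (q (compactify x)) * f x \<partial>gauss)"
      by (subst Bochner_Integration.integral_add[OF i2 qi]) (simp add: q0)
    finally have "cmod (\<integral>x. of_real (\<psi> x) * f x \<partial>gauss) \<le> (\<integral>x. cmod (of_real (\<psi> x) * f x - of_real (q (compactify x)) * f x) \<partial>gauss)"
      using integral_norm_bound by simp
    also have "\<dots> \<le> (\<integral>x. e * cmod (f x) \<partial>gauss)"
      by (intro integral_mono integrable_norm i2 di) (use fi in auto)
    finally show ?thesis by simp
  qed
  have "cmod (\<integral>x. of_real (\<psi> x) * f x \<partial>gauss) \<le> 0"
  proof (rule field_le_epsilon)
    fix e :: real assume e: "e > 0"
    define I where "I = (\<integral>x. cmod (f x) \<partial>gauss)"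
    have I: "I \<ge> 0" by (simp add: I_def)
    have "cmod (\<integral>x. of_real (\<psi> x) * f x \<partial>gauss) \<le> e / (I + 1) * I"
      using le[of "e / (I + 1)"] e I by (simp add: I_def[symmetric] add_nonneg_pos)
    also have "\<dots> \<le> e" using e I by (simp add: field_simps)
    finally show "cmod (\<integral>x. of_real (\<psi> x) * f x \<partial>gauss) \<le> 0 + e" by simp
  qed
  then show ?thesis by simp
qed

text \<open>
  The indicator of a box is a bounded pointwise limit of continuous functions supported in it; so the
  integrals of \<open>f\<close> over boxes vanish, and boxes generate the Borel sets.
\<close>

lemma perp_polynomials_eq_0:
  fixes f :: "'n::finite pt \<Rightarrow> complex"
  assumes f: "perp_polynomials f"
  shows "AE x in gauss. f x = 0"
proof -
  interpret finite_measure "gauss :: 'n pt measure" by (rule finite_measure_gauss)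
  have sf: "sqint gauss f" using f by (simp add: perp_polynomials_def)
  have "sqint gauss (\<lambda>x. 1)" using sqint_polynomial[of "\<lambda>x. 1"] real_polynomial_function.intros(2)[of 1] by simp
  from sqint_integrable_mult'[OF this sf] have fi: "integrable gauss f" by simp
  have [measurable]: "f \<in> borel_measurable borel" using sqintD[OF sf] by simp
  have ind: "integrable gauss (\<lambda>x. indicator A x *\<^sub>R f x)" if "A \<in> sets borel" for A
    using integrable_mult_indicator[of A gauss f] that fi by simp
  have tot: "(\<integral>x. f x \<partial>gauss) = 0"
    using f real_polynomial_function.intros(2)[of 1] unfolding perp_polynomials_def by force
  have box: "(\<integral>x. indicator (box a b) x *\<^sub>R f x \<partial>gauss) = 0" for a b :: "'n pt"
  proof -
    have ne: "- box a b \<noteq> {}" by (metis Compl_empty_eq bounded_box double_complement not_bounded_UNIV)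
    define \<psi> where "\<psi> = (\<lambda>m x. min 1 (real m * infdist x (- box a b)))"
    obtain R where R: "\<And>x. x \<in> box a b \<Longrightarrow> norm x \<le> R"
      using bounded_box[of a b] unfolding bounded_iff by blast
    have z: "\<psi> m x = 0" if "x \<notin> box a b" for m x using that by (simp add: \<psi>_def)
    have "(\<lambda>m. \<integral>x. of_real (\<psi> m x) * f x \<partial>gauss) \<longlonglongrightarrow> (\<integral>x. indicator (box a b) x *\<^sub>R f x \<partial>gauss)"
    proof (rule integral_dominated_convergence)
      show "integrable gauss (\<lambda>x. cmod (f x))" using fi by simp
      show "AE x in gauss. (\<lambda>m. of_real (\<psi> m x) * f x) \<longlonglongrightarrow> indicator (box a b) x *\<^sub>R f x"
      proof (rule AE_I2)
        fix x
        show "(\<lambda>m. of_real (\<psi> m x) * f x) \<longlonglongrightarrow> indicator (box a b) x *\<^sub>R f x"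
        proof (cases "x \<in> box a b")
          case True
          have "closed (- box a b)" by (simp add: open_box closed_Compl)
          then have d: "infdist x (- box a b) > 0"
            using True ne in_closed_iff_infdist_zero[of "- box a b" x] infdist_nonneg[of x "- box a b"] by force
          have "\<forall>\<^sub>F m in sequentially. real m \<ge> 1 / infdist x (- box a b)"
            by real_asymp
          then have "\<forall>\<^sub>F m in sequentially. of_real (\<psi> m x) * f x = indicator (box a b) x *\<^sub>R f x"
            by eventually_elim (use d True in \<open>simp add: \<psi>_def field_simps\<close>)
          then show ?thesis by (rule tendsto_eventually)
        qed (simp add: z)
      qed
      show "AE x in gauss. norm (of_real (\<psi> m x) * f x) \<le> cmod (f x)" for m
        using infdist_nonneg[of _ "- box a b"]
        by (auto simp: norm_mult \<psi>_def intro!: mult_left_le_one_le)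
      show "(\<lambda>x. of_real (\<psi> m x) * f x) \<in> borel_measurable gauss" for m
      proof -
        have [measurable]: "(\<lambda>x. infdist x (- box a b)) \<in> borel_measurable borel"
          by (intro borel_measurable_continuous_onI continuous_intros)
        show ?thesis unfolding \<psi>_def by measurable
      qed
    qed auto
    moreover have "(\<integral>x. of_real (\<psi> m x) * f x \<partial>gauss) = 0" for m
    proof (rule perp_polynomials_test[OF f, where R = R])
      show "continuous_on UNIV (\<psi> m)" unfolding \<psi>_def by (intro continuous_intros)
      show "\<psi> m x = 0" if "norm x > R" for x using R[of x] that by (intro z) auto
    qed
    ultimately show ?thesis by (simp add: LIMSEQ_const_iff)
  qed
  have all: "(\<integral>x. indicator A x *\<^sub>R f x \<partial>gauss) = 0" if A: "A \<in> sets borel" for A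
  proof -
    have "Int_stable (range (\<lambda>(a, b). box a b :: 'n pt set))"
      by (auto simp: Int_stable_def box_Int_box)
    moreover have "range (\<lambda>(a, b). box a b :: 'n pt set) \<subseteq> Pow UNIV" by simp
    moreover have "A \<in> sigma_sets UNIV (range (\<lambda>(a, b). box a b :: 'n pt set))"
      using A unfolding borel_eq_box by simp
    ultimately show ?thesis
    proof (induction rule: sigma_sets_induct_disjoint)
      case (basic A)
      then show ?case using box by auto
    next
      case empty
      then show ?case by simp
    next
      case (compl A)
      then have A: "A \<in> sets borel" by (simp add: borel_eq_box)
      have "(\<integral>x. indicator (UNIV - A) x *\<^sub>R f x \<partial>gauss) = (\<integral>x. f x - indicator A x *\<^sub>R f x \<partial>gauss)"
        by (intro Bochner_Integration.integral_cong) (auto simp: indicator_def)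
      then show ?case using compl fi ind[OF A] tot by simp
    next
      case (union A)
      then have A: "A i \<in> sets borel" for i by (auto simp: borel_eq_box)
      have "(\<lambda>N. \<integral>x. (\<Sum>i<N. indicator (A i) x *\<^sub>R f x) \<partial>gauss) \<longlonglongrightarrow> (\<integral>x. indicator (\<Union>i. A i) x *\<^sub>R f x \<partial>gauss)"
      proof (rule integral_dominated_convergence)
        have s: "(\<Sum>i<N. indicator (A i) x *\<^sub>R f x) = indicator (\<Union>i<N. A i) x *\<^sub>R f x" for N x
          using union(1) by (simp add: scaleR_sum_left[symmetric] indicator_UN_disjoint[symmetric] disjoint_family_on_def)
        show "integrable gauss (\<lambda>x. cmod (f x))" using fi by simp
        show "AE x in gauss. (\<lambda>N. \<Sum>i<N. indicator (A i) x *\<^sub>R f x) \<longlonglongrightarrow> indicator (\<Union>i. A i) x *\<^sub>R f x"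
          unfolding s by (intro AE_I2 tendsto_intros LIMSEQ_indicator_UN)
        show "AE x in gauss. norm (\<Sum>i<N. indicator (A i) x *\<^sub>R f x) \<le> cmod (f x)" for N
          unfolding s by (auto simp: indicator_def)
        show "(\<lambda>x. indicator (\<Union>i. A i) x *\<^sub>R f x) \<in> borel_measurable gauss"
          "(\<lambda>x. \<Sum>i<N. indicator (A i) x *\<^sub>R f x) \<in> borel_measurable gauss" for N
          using A by measurable
      qed
      moreover have "(\<integral>x. (\<Sum>i<N. indicator (A i) x *\<^sub>R f x) \<partial>gauss) = 0" for N
        using union ind[OF A] by (subst Bochner_Integration.integral_sum) auto
      ultimately show ?case by (simp add: LIMSEQ_const_iff)
    qed
  qed
  have re: "AE x in gauss. Re (f x) = 0"
  proof (rule density_unique_real)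
    show "integrable gauss (\<lambda>x. Re (f x))" using fi by simp
    fix A assume "A \<in> sets (gauss :: 'n pt measure)"
    then have A: "A \<in> sets borel" by simp
    have "(LINT x:A|gauss. Re (f x)) = Re (\<integral>x. indicator A x *\<^sub>R f x \<partial>gauss)"
      unfolding set_lebesgue_integral_def using ind[OF A] by (subst integral_Re[symmetric]) auto
    then show "(LINT x:A|gauss. Re (f x)) = (LINT x:A|gauss. 0)" using all[OF A] by (simp add: set_lebesgue_integral_def)
  qed simp
  have im: "AE x in gauss. Im (f x) = 0"
  proof (rule density_unique_real)
    show "integrable gauss (\<lambda>x. Im (f x))" using fi by simp
    fix A assume "A \<in> sets (gauss :: 'n pt measure)"
    then have A: "A \<in> sets borel" by simp
    have "(LINT x:A|gauss. Im (f x)) = Im (\<integral>x. indicator A x *\<^sub>R f x \<partial>gauss)"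
      unfolding set_lebesgue_integral_def using ind[OF A] by (subst integral_Im[symmetric]) auto
    then show "(LINT x:A|gauss. Im (f x)) = (LINT x:A|gauss. 0)" using all[OF A] by (simp add: set_lebesgue_integral_def)
  qed simp
  from re im show ?thesis by eventually_elim (simp add: complex_eq_iff)
qed

section \<open>Smooth cut-off functions\<close>

abbreviation dirderiv :: "'a::real_normed_vector \<Rightarrow> ('a \<Rightarrow> complex) \<Rightarrow> 'a \<Rightarrow> complex" where
  "dirderiv v f \<equiv> (\<lambda>x. frechet_derivative f (at x) v)"

lemma smooth_coinduct:
  assumes S: "f \<in> S" and d: "\<And>f x. f \<in> S \<Longrightarrow> f differentiable (at x)" and D: "\<And>f v. f \<in> S \<Longrightarrow> dirderiv v f \<in> S"
  shows "smooth f"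
proof -
  have "foldr (\<lambda>v h x. frechet_derivative h (at x) v) vs f \<in> S" for vs
    by (induction vs) (simp_all add: S D)
  then show ?thesis
    unfolding smooth_def differentiable_on_def by (auto intro: d)
qed

lemma smooth_dirderiv: "smooth f \<Longrightarrow> smooth (dirderiv v f)"
  unfolding smooth_def
proof
  fix vs assume "\<forall>vs. foldr (\<lambda>v h x. frechet_derivative h (at x) v) vs f differentiable_on UNIV"
  from this[rule_format, of "vs @ [v]"]
  show "foldr (\<lambda>v h x. frechet_derivative h (at x) v) vs (dirderiv v f) differentiable_on UNIV" by simp
qed

lemma smooth_differentiable: "smooth f \<Longrightarrow> f differentiable (at x)"
  using smooth_def[of f] by (auto dest: spec[of _ "[]"] simp: differentiable_on_def)

text \<open>
  A derivative of a product is a sum of products. Smoothness of products and compositions is therefore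
  proved for the whole algebra generated by a family: it suffices that the derivatives of the
  generators lie in that algebra again.
\<close>

inductive generated :: "(('a::real_normed_vector \<Rightarrow> complex) \<Rightarrow> bool) \<Rightarrow> ('a \<Rightarrow> complex) \<Rightarrow> bool" for Q where
  base: "Q f \<Longrightarrow> generated Q f"
| add: "generated Q f \<Longrightarrow> generated Q g \<Longrightarrow> generated Q (\<lambda>x. f x + g x)"
| mult: "generated Q f \<Longrightarrow> generated Q g \<Longrightarrow> generated Q (\<lambda>x. f x * g x)"

lemma smooth_generated:
  assumes f: "generated Q f"
    and d: "\<And>f x. Q f \<Longrightarrow> f differentiable (at x)" and D: "\<And>f v. Q f \<Longrightarrow> generated Q (dirderiv v f)"
  shows "smooth f"
proof (rule smooth_coinduct[of f "{f. generated Q f}"])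
  have *: "(\<forall>x. f differentiable (at x)) \<and> (\<forall>v. generated Q (dirderiv v f))" if "generated Q f" for f
    using that
  proof induction
    case (base f)
    then show ?case using d D by blast
  next
    case (add f g)
    then have "frechet_derivative (\<lambda>x. f x + g x) (at x) = (\<lambda>v. frechet_derivative f (at x) v + frechet_derivative g (at x) v)" for x
      by (intro frechet_derivative_at[symmetric] has_derivative_add) (auto simp: frechet_derivative_works[symmetric])
    with add show ?case by (auto intro: generated.add)
  next
    case (mult f g)
    then have "frechet_derivative (\<lambda>x. f x * g x) (at x) = (\<lambda>v. f x * frechet_derivative g (at x) v + frechet_derivative f (at x) v * g x)" for x
      by (intro frechet_derivative_at[symmetric] has_derivative_mult) (auto simp: frechet_derivative_works[symmetric])
    moreover have "generated Q (\<lambda>x. f x * frechet_derivative g (at x) v + frechet_derivative f (at x) v * g x)" for v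
      using mult by (intro generated.add generated.mult) auto
    ultimately show ?case using mult by (auto intro: differentiable_mult)
  qed
  show "f \<in> {f. generated Q f}" using f by simp
  show "f differentiable (at x)" "dirderiv v f \<in> {f. generated Q f}" if "f \<in> {f. generated Q f}" for f x v
    using that * by auto
qed

lemma smooth_mult: "smooth f \<Longrightarrow> smooth g \<Longrightarrow> smooth (\<lambda>x. f x * g x)"
  by (rule smooth_generated[of smooth])
     (auto intro: generated.intros smooth_differentiable smooth_dirderiv)

lemma smooth_polynomial:
  assumes "real_polynomial_function p"
  shows "smooth (\<lambda>x. complex_of_real (p x))"
proof -
  define Q where "Q = (\<lambda>f :: 'a \<Rightarrow> complex. (\<exists>l. bounded_linear l \<and> f = (\<lambda>x. of_real (l x))) \<or> (\<exists>c. f = (\<lambda>x. c)))"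
  have "generated Q (\<lambda>x. complex_of_real (p x))"
    using assms
  proof induction
    case (linear f)
    then show ?case by (intro generated.base) (auto simp: Q_def)
  next
    case (const c)
    then show ?case by (intro generated.base) (auto simp: Q_def)
  next
    case (add f g)
    then show ?case using generated.add by fastforce
  next
    case (mult f g)
    then show ?case using generated.mult by fastforce
  qed
  then show ?thesis
  proof (rule smooth_generated)
    fix f :: "'a \<Rightarrow> complex" assume "Q f"
    then consider l where "bounded_linear l" "f = (\<lambda>x. of_real (l x))" | c where "f = (\<lambda>x. c)" by (auto simp: Q_def)
    then have "(\<forall>x. f differentiable (at x)) \<and> (\<forall>v. \<exists>c. dirderiv v f = (\<lambda>x. c))"
    proof cases
      case 1
      have "(f has_derivative f) (at x)" for x
        unfolding 1 by (intro bounded_linear_imp_has_derivative bounded_linear_compose[OF bounded_linear_of_real 1(1)])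
      then show ?thesis
        by (metis differentiableI frechet_derivative_at)
    next
      case 2
      then show ?thesis by auto
    qed
    then show "f differentiable (at x)" "generated Q (dirderiv v f)" for x v
      by (auto intro!: generated.base simp: Q_def)
  qed
qed

text \<open>
  Here \<open>h n\<close> is the \<open>n\<close>-th derivative of \<open>h 0\<close>. The generators are the smooth functions together with all the
  functions \<open>h n (a + b |x|\<^sup>2)\<close>; a derivative of the latter is \<open>h (n + 1) (a + b |x|\<^sup>2)\<close> times a linear function.
\<close>

lemma smooth_radial:
  fixes h :: "nat \<Rightarrow> real \<Rightarrow> real"
  assumes h: "\<And>n t. (h n has_real_derivative h (Suc n) t) (at t)"
  shows "smooth (\<lambda>x::'a::euclidean_space. complex_of_real (h n (a + b * (norm x)\<^sup>2)))"
    "((\<lambda>x::'a. complex_of_real (h n (a + b * (norm x)\<^sup>2))) has_derivative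
       (\<lambda>v. complex_of_real (h (Suc n) (a + b * (norm x)\<^sup>2)) * of_real (2 * b * (x \<bullet> v)))) (at x)"
proof -
  define q where "q = (\<lambda>x::'a. a + b * (norm x)\<^sup>2)"
  define Q where "Q = (\<lambda>f :: 'a \<Rightarrow> complex. smooth f \<or> (\<exists>n. f = (\<lambda>x. of_real (h n (q x)))))"
  have der: "((\<lambda>x. complex_of_real (h n (q x))) has_derivative (\<lambda>v. complex_of_real (h (Suc n) (q x)) * of_real (2 * b * (x \<bullet> v)))) (at x)" for n x
  proof -
    have "(q has_derivative (\<lambda>v. 2 * b * (x \<bullet> v))) (at x)"
      unfolding q_def power2_norm_eq_inner
      by (auto intro!: derivative_eq_intros simp: inner_commute)
    then have "((\<lambda>x. h n (q x)) has_derivative (\<lambda>v. (2 * b * (x \<bullet> v)) * h (Suc n) (q x))) (at x)"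
      using h by (rule has_derivative_compose[OF _ has_field_derivative_imp_has_derivative, THEN has_derivative_eq_rhs]) (simp add: mult.commute)
    then have "((\<lambda>x. complex_of_real (h n (q x))) has_derivative (\<lambda>v. of_real ((2 * b * (x \<bullet> v)) * h (Suc n) (q x)))) (at x)"
      by (rule bounded_linear.has_derivative[OF bounded_linear_of_real])
    then show ?thesis by (simp add: mult.commute)
  qed
  then show "((\<lambda>x::'a. complex_of_real (h n (a + b * (norm x)\<^sup>2))) has_derivative
       (\<lambda>v. complex_of_real (h (Suc n) (a + b * (norm x)\<^sup>2)) * of_real (2 * b * (x \<bullet> v)))) (at x)"
    by (simp add: q_def)
  have "smooth (\<lambda>x. complex_of_real (h n (q x)))"
  proof (rule smooth_generated[of Q])
    show "generated Q (\<lambda>x. complex_of_real (h n (q x)))" by (intro generated.base) (auto simp: Q_def)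
  next
    fix f :: "'a \<Rightarrow> complex" and x assume "Q f"
    then show "f differentiable (at x)" using smooth_differentiable differentiableI[OF der] unfolding Q_def by auto
  next
    fix f :: "'a \<Rightarrow> complex" and v assume "Q f"
    then show "generated Q (dirderiv v f)" unfolding Q_def
    proof (elim disjE exE)
      assume "smooth f"
      then show "generated (\<lambda>f. smooth f \<or> (\<exists>n. f = (\<lambda>x. complex_of_real (h n (q x))))) (dirderiv v f)"
        by (intro generated.base disjI1 smooth_dirderiv)
    next
      fix n assume f: "f = (\<lambda>x. complex_of_real (h n (q x)))"
      have "real_polynomial_function (\<lambda>x. 2 * b * (x \<bullet> v))"
        by (intro real_polynomial_function.intros(1) bounded_linear_mult_right[THEN bounded_linear_compose] bounded_linear_inner_left)
      then have "smooth (\<lambda>x. complex_of_real (2 * b * (x \<bullet> v)))" by (rule smooth_polynomial)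
      moreover have "dirderiv v f = (\<lambda>x. complex_of_real (h (Suc n) (q x)) * of_real (2 * b * (x \<bullet> v)))"
        unfolding f frechet_derivative_at[OF der, symmetric] ..
      ultimately show "generated (\<lambda>f. smooth f \<or> (\<exists>n. f = (\<lambda>x. complex_of_real (h n (q x))))) (dirderiv v f)"
        by (simp only:) (rule generated.mult; rule generated.base; blast)
    qed
  qed
  then show "smooth (\<lambda>x::'a. complex_of_real (h n (a + b * (norm x)\<^sup>2)))" by (simp add: q_def)
qed

text \<open>
  The function \<open>exp (- 1/t)\<close> on \<open>t > 0\<close>, extended by zero, and its derivatives: by the chain rule,
  differentiating \<open>p (1/t) exp (-1/t)\<close> replaces \<open>p\<close> by \<open>s\<^sup>2 (p - p')\<close>.
\<close>

primrec bump_poly :: "nat \<Rightarrow> real poly" where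
  "bump_poly 0 = 1"
| "bump_poly (Suc n) = [:0, 0, 1:] * (bump_poly n - pderiv (bump_poly n))"

definition bump :: "nat \<Rightarrow> real \<Rightarrow> real" where
  "bump n t = (if t > 0 then poly (bump_poly n) (1 / t) * exp (- (1 / t)) else 0)"

lemma poly_exp_tendsto_0: "((\<lambda>s::real. poly p s * exp (- s)) \<longlongrightarrow> 0) at_top"
proof -
  have "((\<lambda>s::real. \<Sum>i\<le>degree p. coeff p i * (s ^ i / exp s)) \<longlongrightarrow> (\<Sum>i\<le>degree p. coeff p i * 0)) at_top"
    by (intro tendsto_intros tendsto_power_div_exp_0)
  then show ?thesis by (simp add: poly_altdef sum_distrib_right exp_minus field_simps sum_divide_distrib)
qed

lemma bump_deriv: "(bump n has_real_derivative bump (Suc n) t) (at t)"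
proof -
  consider "t > 0" | "t < 0" | "t = 0" by linarith
  then show ?thesis
  proof cases
    case 1
    have "((\<lambda>t. poly (bump_poly n) (1 / t) * exp (- (1 / t))) has_real_derivative bump (Suc n) t) (at t)"
      using 1 by (auto intro!: derivative_eq_intros poly_DERIV[THEN DERIV_chain2] simp: bump_def field_simps power2_eq_square)
    then show ?thesis
      by (rule DERIV_cong_ev[OF refl _ refl, THEN iffD1, rotated])
         (use 1 in \<open>auto simp: bump_def intro: eventually_mono[OF eventually_nhds_in_open[of "{0<..}"]]\<close>)
  next
    case 2
    have "((\<lambda>t. 0) has_real_derivative bump (Suc n) t) (at t)" using 2 by (simp add: bump_def)
    then show ?thesis
      by (rule DERIV_cong_ev[OF refl _ refl, THEN iffD1, rotated])
         (use 2 in \<open>auto simp: bump_def intro: eventually_mono[OF eventually_nhds_in_open[of "{..<0}"]]\<close>)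
  next
    case 3
    have "((\<lambda>y. bump n y / y) \<longlongrightarrow> 0) (at 0)"
    proof (rule filterlim_split_at)
      show "((\<lambda>y. bump n y / y) \<longlongrightarrow> 0) (at_left 0)"
        by (rule tendsto_eventually) (auto simp: bump_def eventually_at_filter)
      have "((\<lambda>y. poly ([:0, 1:] * bump_poly n) (inverse y) * exp (- inverse y)) \<longlongrightarrow> 0) (at_right 0)"
        by (rule filterlim_compose[OF poly_exp_tendsto_0 filterlim_inverse_at_top_right])
      then show "((\<lambda>y. bump n y / y) \<longlongrightarrow> 0) (at_right 0)"
        by (rule Lim_transform_eventually) (auto simp: bump_def eventually_at_filter field_simps)
    qed
    then show ?thesis by (simp add: 3 has_field_derivative_iff bump_def)
  qed
qed

lemma bump_0: "0 \<le> bump 0 t" "bump 0 t \<le> 1" "t \<le> 0 \<Longrightarrow> bump 0 t = 0" "t > 0 \<Longrightarrow> bump 0 t > 0"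
  by (auto simp: bump_def)

lemma bump_1_bound: "\<bar>bump (Suc 0) t\<bar> \<le> 2"
proof (cases "t > 0")
  case True
  define s where "s = 1 / t"
  have s: "s > 0" using True by (simp add: s_def)
  have "s\<^sup>2 / 2 \<le> exp s" using exp_lower_Taylor_quadratic[of s] s by simp
  then have "s\<^sup>2 * exp (- s) \<le> (2 * exp s) * exp (- s)" by (intro mult_right_mono) auto
  also have "\<dots> = 2" by (simp add: exp_minus)
  finally show ?thesis using True by (simp add: bump_def s_def power2_eq_square)
qed (simp add: bump_def)

text \<open>
  Supported in the ball of radius \<open>m + 1\<close>. These functions are not equal to 1 near the origin; they
  converge pointwise to the constant \<open>bump 0 1 > 0\<close>, which can be cancelled in the limit of a linear
  equation.
\<close>

definition cutoff :: "nat \<Rightarrow> 'a::euclidean_space \<Rightarrow> real" where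
  "cutoff m x = bump 0 (1 + (- 1 / (real (Suc m))\<^sup>2) * (norm x)\<^sup>2)"

lemma cutoff_bound: "\<bar>cutoff m x\<bar> \<le> 1"
  using bump_0(1,2) by (simp add: cutoff_def)

lemma cutoff_outside: "norm x > real (Suc m) \<Longrightarrow> cutoff m x = 0"
proof -
  assume "norm x > real (Suc m)"
  then have "(real (Suc m))\<^sup>2 \<le> (norm x)\<^sup>2" by (intro power_mono) auto
  then show ?thesis unfolding cutoff_def by (intro bump_0(3)) (simp add: field_simps del: of_nat_Suc)
qed

lemma smooth_cutoff: "smooth (\<lambda>x::'a::euclidean_space. complex_of_real (cutoff m x))"
  unfolding cutoff_def by (rule smooth_radial(1)[where h = bump, OF bump_deriv])

definition cutoff_deriv :: "nat \<Rightarrow> 'a::euclidean_space \<Rightarrow> real" where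
  "cutoff_deriv m x = bump (Suc 0) (1 + (- 1 / (real (Suc m))\<^sup>2) * (norm x)\<^sup>2) * (- 2 / (real (Suc m))\<^sup>2)"

lemma cutoff_has_derivative:
  "((\<lambda>x::'a::euclidean_space. complex_of_real (cutoff m x)) has_derivative (\<lambda>v. of_real (cutoff_deriv m x * (x \<bullet> v)))) (at x)"
  using smooth_radial(2)[where h = bump, OF bump_deriv, of 0 1 "- 1 / (real (Suc m))\<^sup>2" x]
  by (simp add: cutoff_def cutoff_deriv_def mult.assoc)

lemma cutoff_deriv_bound: "\<bar>cutoff_deriv m x\<bar> \<le> 4 / (real (Suc m))\<^sup>2"
proof -
  have "\<bar>cutoff_deriv m x\<bar> = \<bar>bump (Suc 0) (1 + (- 1 / (real (Suc m))\<^sup>2) * (norm x)\<^sup>2)\<bar> * (2 / (real (Suc m))\<^sup>2)"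
    by (simp add: cutoff_deriv_def abs_mult del: of_nat_Suc)
  also have "\<dots> \<le> 2 * (2 / (real (Suc m))\<^sup>2)" by (intro mult_right_mono bump_1_bound) auto
  finally show ?thesis by simp
qed

lemma cutoff_tendsto: "(\<lambda>m. cutoff m x) \<longlonglongrightarrow> bump 0 1"
proof -
  have "isCont (bump 0) 1" using bump_deriv by (rule DERIV_isCont)
  moreover have "(\<lambda>m. 1 + (- 1 / (real (Suc m))\<^sup>2) * (norm x)\<^sup>2) \<longlonglongrightarrow> 1" by real_asymp
  ultimately show ?thesis unfolding cutoff_def by (rule isCont_tendsto_compose)
qed

section \<open>Ladder operators on Hermite coefficients\<close>

type_synonym 'j multi = "'j \<Rightarrow> nat"

text \<open>
  The degree is an integer: lowering the degree from level 0 leads to the empty level -1, and the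
  adjointness relations hold without exceptions.
\<close>

definition level :: "int \<Rightarrow> ('j::finite) multi set" where
  "level d = {\<alpha>. int (\<Sum>j\<in>UNIV. \<alpha> j) = d}"

lemma finite_level [simp]: "finite (level d)"
proof -
  have "level d \<subseteq> {\<alpha>. \<forall>j. (j \<in> UNIV \<longrightarrow> \<alpha> j \<in> {..nat d}) \<and> (j \<notin> UNIV \<longrightarrow> \<alpha> j = 0)}"
    by (auto simp: level_def simp del: of_nat_sum intro!: member_le_sum)
  then show ?thesis
    by (rule finite_subset) (intro finite_set_of_finite_funs; simp)
qed

lemma sum_fun_upd_Suc: "(\<Sum>i\<in>UNIV. (\<alpha>(j := Suc (\<alpha> j))) i) = Suc (\<Sum>i\<in>UNIV. \<alpha> (i::'j::finite))"
proof -
  have "(\<Sum>i\<in>UNIV. (\<alpha>(j := Suc (\<alpha> j))) i) = (\<Sum>i\<in>UNIV. \<alpha> i + (if i = j then 1 else 0))"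
    by (intro sum.cong) auto
  then show ?thesis by (simp add: sum.distrib)
qed

lemma upd_Suc_in_level: "\<alpha>(j := Suc (\<alpha> j)) \<in> level d \<longleftrightarrow> \<alpha> \<in> level (d - 1)"
  by (auto simp: level_def sum_fun_upd_Suc simp del: fun_upd_apply of_nat_sum)

text \<open>
  The action of \<open>\<partial>\<^sub>j\<close> on the coefficients with respect to the orthonormal Hermite functions, and its adjoint
  with respect to \<open>exp (-2 |x|\<^sup>2)\<close>. They are defined on arbitrary families of coefficients, since each value is
  determined by a single other one.
\<close>

definition annihilate :: "'j \<Rightarrow> ('j multi \<Rightarrow> complex) \<Rightarrow> 'j multi \<Rightarrow> complex" where
  "annihilate j c \<alpha> = of_real (2 * sqrt (real (Suc (\<alpha> j)))) * c (\<alpha>(j := Suc (\<alpha> j)))"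

definition create :: "'j \<Rightarrow> ('j multi \<Rightarrow> complex) \<Rightarrow> 'j multi \<Rightarrow> complex" where
  "create j c \<alpha> = of_real (2 * sqrt (real (\<alpha> j))) * c (\<alpha>(j := \<alpha> j - 1))"

lemma annihilate_commute: "annihilate i (annihilate j c) = annihilate j (annihilate i c)"
  by (cases "i = j") (auto simp: annihilate_def fun_eq_iff fun_upd_twist)

text \<open>
  The canonical commutation relation; the constant 4 is the second derivative of \<open>2 t\<^sup>2\<close>.
\<close>

lemma annihilate_create: "annihilate i (create j c) \<alpha> = create j (annihilate i c) \<alpha> + (if i = j then 4 * c \<alpha> else 0)"
proof (cases "i = j")
  case True
  have "complex_of_real (sqrt x) * (complex_of_real (sqrt x) * z) = of_real x * z" if "x \<ge> 0" for x z
    using that by (simp flip: of_real_mult mult.assoc)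
  from this[of "1 + real (\<alpha> j)"] this[of "real (\<alpha> j)"] True show ?thesis
    by (cases "\<alpha> j") (auto simp: annihilate_def create_def algebra_simps fun_upd_idem)
next
  case False
  then show ?thesis by (simp add: annihilate_def create_def fun_upd_twist algebra_simps)
qed

definition level_ip :: "int \<Rightarrow> (('j::finite) multi \<Rightarrow> complex) \<Rightarrow> ('j multi \<Rightarrow> complex) \<Rightarrow> complex" where
  "level_ip d c c' = (\<Sum>\<alpha>\<in>level d. c \<alpha> * cnj (c' \<alpha>))"

lemma level_ip_annihilate: "level_ip (d - 1) (annihilate j c) c' = level_ip d c (create j c')"
proof -
  have "level_ip d c (create j c') = (\<Sum>\<alpha>\<in>{\<alpha>\<in>level d. \<alpha> j > 0}. c \<alpha> * cnj (create j c' \<alpha>))"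
    unfolding level_ip_def by (rule sum.mono_neutral_right) (auto simp: create_def)
  also have "\<dots> = (\<Sum>\<alpha>\<in>level (d - 1). c (\<alpha>(j := Suc (\<alpha> j))) * cnj (create j c' (\<alpha>(j := Suc (\<alpha> j)))))"
  proof (rule sum.reindex_bij_witness[where i = "\<lambda>\<alpha>. \<alpha>(j := Suc (\<alpha> j))" and j = "\<lambda>\<alpha>. \<alpha>(j := \<alpha> j - 1)"])
    fix \<alpha> :: "'a multi" assume a: "\<alpha> \<in> {\<alpha>\<in>level d. \<alpha> j > 0}"
    then show "\<alpha>(j := \<alpha> j - 1) \<in> level (d - 1)"
      using upd_Suc_in_level[of "\<alpha>(j := \<alpha> j - 1)" j d] by (simp add: fun_upd_idem)
  qed (auto simp: upd_Suc_in_level fun_upd_idem)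
  also have "\<dots> = level_ip (d - 1) (annihilate j c) c'"
    by (simp add: level_ip_def annihilate_def create_def algebra_simps)
  finally show ?thesis by simp
qed

definition cscale :: "complex \<Rightarrow> ('a \<Rightarrow> complex) \<Rightarrow> 'a \<Rightarrow> complex" where
  "cscale s c = (\<lambda>\<alpha>. s * c \<alpha>)"

lemma sum_fun_apply: "(\<Sum>x\<in>X. c x) \<alpha> = (\<Sum>x\<in>X. c x \<alpha>)"
  for c :: "'x \<Rightarrow> 'a \<Rightarrow> 'b::comm_monoid_add"
  by (induction X rule: infinite_finite_induct) auto

lemma minus_fun_apply' [simp]: "(f - g) x = f x - (g x :: 'b::ab_group_add)"
  by (simp add: fun_diff_def)

lemma cscale_add: "cscale s (c + c') = cscale s c + cscale s c'" and cscale_zero [simp]: "cscale s 0 = 0"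
  and cscale_cscale [simp]: "cscale s (cscale t c) = cscale (s * t) c" and cscale_0 [simp]: "cscale 0 c = 0" and cscale_1 [simp]: "cscale 1 c = c"
  by (auto simp: cscale_def fun_eq_iff algebra_simps)

lemma cscale_sum: "cscale s (\<Sum>x\<in>X. c x) = (\<Sum>x\<in>X. cscale s (c x))"
  by (auto simp: cscale_def fun_eq_iff sum_fun_apply sum_distrib_left)

lemma level_ip_sum_left: "level_ip d (\<Sum>x\<in>X. c x) c' = (\<Sum>x\<in>X. level_ip d (c x) c')"
  unfolding level_ip_def sum_fun_apply sum_distrib_right by (rule sum.swap)

lemma level_ip_sum_right: "level_ip d c' (\<Sum>x\<in>X. c x) = (\<Sum>x\<in>X. level_ip d c' (c x))"
  unfolding level_ip_def sum_fun_apply sum_distrib_left cnj_sum by (rule sum.swap)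

lemma level_ip_zero [simp]: "level_ip d 0 c = 0" "level_ip d c 0 = 0"
  by (simp_all add: level_ip_def)

lemma level_ip_add: "level_ip d (a + b) c = level_ip d a c + level_ip d b c" "level_ip d c (a + b) = level_ip d c a + level_ip d c b"
  by (simp_all add: level_ip_def sum.distrib algebra_simps)

lemma level_ip_diff: "level_ip d (a - b) c = level_ip d a c - level_ip d b c" "level_ip d c (a - b) = level_ip d c a - level_ip d c b"
  by (simp_all add: level_ip_def sum_subtractf algebra_simps)

lemma level_ip_cscale: "level_ip d (cscale s a) c = s * level_ip d a c" "level_ip d a (cscale s c) = cnj s * level_ip d a c"
  by (simp_all add: level_ip_def cscale_def sum_distrib_left algebra_simps)

lemma level_ip_cnj: "cnj (level_ip d a b) = level_ip d b a"
  by (simp add: level_ip_def algebra_simps)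

lemma level_ip_self: "level_ip d c c = of_real (\<Sum>\<alpha>\<in>level d. (cmod (c \<alpha>))\<^sup>2)"
  by (simp add: level_ip_def complex_norm_square del: of_real_power)

lemma level_ip_self_nonneg: "0 \<le> Re (level_ip d c c)"
  by (simp add: level_ip_self sum_nonneg del: of_real_sum)

text \<open>
  The coefficients of \<open>Z\<^sub>A\<^bsup>A'\<^esup>\<close> (raised primed index) in terms of the coordinate derivatives. As in the type \<open>4\<close>,
  the fourth coordinate has the index \<open>4 = 0\<close>.
\<close>

definition \<zeta> :: "'n unprimed \<Rightarrow> primed \<Rightarrow> 'n \<times> 4 \<Rightarrow> complex" where
  "\<zeta> A A' j = (if fst j \<noteq> fst A then 0
     else if snd A = 0 then
       (if A' = 0 then (if snd j = 3 then - 1 else if snd j = 4 then - \<i> else 0)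
        else (if snd j = 1 then - 1 else if snd j = 2 then - \<i> else 0))
     else
       (if A' = 0 then (if snd j = 1 then 1 else if snd j = 2 then - \<i> else 0)
        else (if snd j = 3 then - 1 else if snd j = 4 then \<i> else 0)))"

lemma sum_prod_4: "(\<Sum>j\<in>(UNIV :: ('n::finite \<times> 4) set). f j) = (\<Sum>l\<in>UNIV. f (l,1) + f (l,2) + f (l,3) + f (l,4))"
proof -
  have "(\<Sum>j\<in>(UNIV :: ('n \<times> 4) set). f j) = (\<Sum>l\<in>UNIV. \<Sum>m\<in>UNIV. f (l,m))"
    unfolding UNIV_Times_UNIV[symmetric] by (simp add: sum.cartesian_product)
  then show ?thesis by (simp add: sum_4)
qed

lemma two_cases: "(x::2) = 0 \<or> x = 1"
  using UNIV_2 by (metis UNIV_I insert_iff singletonD zero_neq_one exhaust_2 )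

text \<open>
  For fixed \<open>l\<close> the four vectors form an orthogonal basis of \<open>\<complex>\<^sup>4\<close>, and different \<open>l\<close> involve different
  coordinates. This orthogonality turns the fields into independent annihilation operators.
\<close>

lemma \<zeta>_orthogonal:
  fixes A B :: "'n::finite unprimed"
  shows "(\<Sum>j\<in>UNIV. \<zeta> A A' j * cnj (\<zeta> B B' j)) = (if A = B \<and> A' = B' then 2 else 0)"
proof -
  have *: "(1::4) \<noteq> 2" "(1::4) \<noteq> 3" "(1::4) \<noteq> 4" "(2::4) \<noteq> 3" "(2::4) \<noteq> 4" "(3::4) \<noteq> 4" 
    "(2::4) \<noteq> 1" "(3::4) \<noteq> 1" "(4::4) \<noteq> 1" "(3::4) \<noteq> 2" "(4::4) \<noteq> 2" "(4::4) \<noteq> 3" 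
    by simp_all
  obtain l p m q where A: "A = (l, p)" "B = (m, q)" by fastforce
  have "(\<Sum>j\<in>UNIV. \<zeta> A A' j * cnj (\<zeta> B B' j)) =
      (\<Sum>x\<in>UNIV. if x = l then (if l = m then (if A = B \<and> A' = B' then 2 else 0) else 0) else 0)"
    unfolding sum_prod_4
    using two_cases[of p] two_cases[of q] two_cases[of A'] two_cases[of B']
    by (intro sum.cong refl) (auto simp: A \<zeta>_def *)
  also have "\<dots> = (if A = B \<and> A' = B' then 2 else 0)" by (auto simp: A)
  finally show ?thesis .
qed

definition Z_fock :: "'n::finite unprimed \<Rightarrow> primed \<Rightarrow> (('n \<times> 4) multi \<Rightarrow> complex) \<Rightarrow> ('n \<times> 4) multi \<Rightarrow> complex" where
  "Z_fock A A' c = (\<Sum>j\<in>UNIV. cscale (\<zeta> A A' j) (annihilate j c))"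

definition Z_fock_adj :: "'n::finite unprimed \<Rightarrow> primed \<Rightarrow> (('n \<times> 4) multi \<Rightarrow> complex) \<Rightarrow> ('n \<times> 4) multi \<Rightarrow> complex" where
  "Z_fock_adj A A' c = (\<Sum>j\<in>UNIV. cscale (cnj (\<zeta> A A' j)) (create j c))"

lemma Z_fock_apply: "Z_fock A A' c \<alpha> = (\<Sum>j\<in>UNIV. \<zeta> A A' j * annihilate j c \<alpha>)"
  by (simp add: Z_fock_def sum_fun_apply cscale_def)

lemma Z_fock_adj_apply: "Z_fock_adj A A' c \<alpha> = (\<Sum>j\<in>UNIV. cnj (\<zeta> A A' j) * create j c \<alpha>)"
  by (simp add: Z_fock_adj_def sum_fun_apply cscale_def)

lemma Z_fock_add: "Z_fock A A' (c + c') = Z_fock A A' c + Z_fock A A' c'"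
  by (simp add: fun_eq_iff Z_fock_apply annihilate_def algebra_simps sum.distrib)

lemma Z_fock_0 [simp]: "Z_fock A A' 0 = 0"
  by (simp add: fun_eq_iff Z_fock_apply annihilate_def)

lemma Z_fock_cscale: "Z_fock A A' (cscale s c) = cscale s (Z_fock A A' c)"
  by (simp add: fun_eq_iff Z_fock_apply annihilate_def cscale_def sum_distrib_left algebra_simps)

lemma Z_fock_sum: "Z_fock A A' (\<Sum>x\<in>X. c x) = (\<Sum>x\<in>X. Z_fock A A' (c x))"
proof
  fix \<alpha>
  have "Z_fock A A' (\<Sum>x\<in>X. c x) \<alpha> = (\<Sum>j\<in>UNIV. \<Sum>x\<in>X. \<zeta> A A' j * annihilate j (c x) \<alpha>)"
    by (simp add: Z_fock_apply annihilate_def sum_fun_apply sum_distrib_left)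
  then show "Z_fock A A' (\<Sum>x\<in>X. c x) \<alpha> = (\<Sum>x\<in>X. Z_fock A A' (c x)) \<alpha>"
    by (subst (asm) sum.swap) (simp add: Z_fock_apply sum_fun_apply)
qed

lemma Z_fock_adj_add: "Z_fock_adj A A' (c + c') = Z_fock_adj A A' c + Z_fock_adj A A' c'"
  by (simp add: fun_eq_iff Z_fock_adj_apply create_def algebra_simps sum.distrib)

lemma Z_fock_adj_0 [simp]: "Z_fock_adj A A' 0 = 0"
  by (simp add: fun_eq_iff Z_fock_adj_apply create_def)

lemma Z_fock_adj_cscale: "Z_fock_adj A A' (cscale s c) = cscale s (Z_fock_adj A A' c)"
  by (simp add: fun_eq_iff Z_fock_adj_apply create_def cscale_def sum_distrib_left algebra_simps)

lemma level_ip_Z_fock: "level_ip (d - 1) (Z_fock A A' c) c' = level_ip d c (Z_fock_adj A A' c')"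
  by (simp add: Z_fock_def Z_fock_adj_def level_ip_sum_left level_ip_sum_right level_ip_cscale level_ip_annihilate)

lemma Z_fock_commute:
  fixes A B :: "'n::finite unprimed"
  shows "Z_fock A A' (Z_fock B B' c) = Z_fock B B' (Z_fock A A' c)"
proof
  fix \<alpha> :: "('n \<times> 4) multi"
  have l: "annihilate i (Z_fock C C' c) \<alpha> = (\<Sum>j\<in>UNIV. \<zeta> C C' j * annihilate i (annihilate j c) \<alpha>)" for C :: "'n unprimed" and C' i c
    by (simp add: annihilate_def[of i] Z_fock_apply sum_distrib_left algebra_simps)
  have "Z_fock A A' (Z_fock B B' c) \<alpha> = (\<Sum>i\<in>UNIV. \<Sum>j\<in>UNIV. \<zeta> A A' i * \<zeta> B B' j * annihilate i (annihilate j c) \<alpha>)"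
    unfolding Z_fock_apply[of A] l by (simp add: sum_distrib_left algebra_simps)
  also have "\<dots> = (\<Sum>j\<in>UNIV. \<Sum>i\<in>UNIV. \<zeta> B B' j * \<zeta> A A' i * annihilate j (annihilate i c) \<alpha>)"
    by (subst sum.swap) (simp add: annihilate_commute mult.commute)
  also have "\<dots> = Z_fock B B' (Z_fock A A' c) \<alpha>"
    unfolding Z_fock_apply[of B] l by (simp add: sum_distrib_left algebra_simps)
  finally show "Z_fock A A' (Z_fock B B' c) \<alpha> = Z_fock B B' (Z_fock A A' c) \<alpha>" .
qed

text \<open>
  The constant is 4 from the ladder operators times the squared length 2 of the vectors \<open>\<zeta>\<close>.
\<close>

lemma Z_fock_Z_fock_adj:
  fixes A B :: "'n::finite unprimed"
  shows "Z_fock A A' (Z_fock_adj B B' c) = Z_fock_adj B B' (Z_fock A A' c) + (if A = B \<and> A' = B' then cscale 8 c else 0)"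
proof
  fix \<alpha> :: "('n \<times> 4) multi"
  have l: "annihilate i (Z_fock_adj C C' c) \<alpha> = (\<Sum>j\<in>UNIV. cnj (\<zeta> C C' j) * annihilate i (create j c) \<alpha>)" for C :: "'n unprimed" and C' i c
    by (simp add: annihilate_def[of i] Z_fock_adj_apply sum_distrib_left algebra_simps)
  have l': "create i (Z_fock C C' c) \<alpha> = (\<Sum>j\<in>UNIV. \<zeta> C C' j * create i (annihilate j c) \<alpha>)" for C :: "'n unprimed" and C' i c
    by (simp add: create_def[of i] Z_fock_apply sum_distrib_left algebra_simps)
  have "Z_fock A A' (Z_fock_adj B B' c) \<alpha> = (\<Sum>i\<in>UNIV. \<Sum>j\<in>UNIV. \<zeta> A A' i * cnj (\<zeta> B B' j) * create j (annihilate i c) \<alpha>)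
     + (\<Sum>i\<in>UNIV. \<Sum>j\<in>UNIV. if j = i then \<zeta> A A' i * cnj (\<zeta> B B' j) * (4 * c \<alpha>) else 0)"
    unfolding Z_fock_apply[of A] l
    by (simp add: sum_distrib_left annihilate_create ring_distribs sum.distrib mult.assoc if_distrib[where f = "(*) _"] eq_commute cong: if_cong)
  also have "(\<Sum>i\<in>UNIV. \<Sum>j\<in>UNIV. if j = i then \<zeta> A A' i * cnj (\<zeta> B B' j) * (4 * c \<alpha>) else 0)
     = (\<Sum>i\<in>UNIV. \<zeta> A A' i * cnj (\<zeta> B B' i)) * (4 * c \<alpha>)"
    by (simp add: sum_distrib_right)
  also have "(\<Sum>i\<in>UNIV. \<Sum>j\<in>UNIV. \<zeta> A A' i * cnj (\<zeta> B B' j) * create j (annihilate i c) \<alpha>) = Z_fock_adj B B' (Z_fock A A' c) \<alpha>"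
    unfolding Z_fock_adj_apply[of B] l' by (subst sum.swap) (simp add: sum_distrib_left algebra_simps)
  finally show "Z_fock A A' (Z_fock_adj B B' c) \<alpha> = (Z_fock_adj B B' (Z_fock A A' c) + (if A = B \<and> A' = B' then cscale 8 c else 0)) \<alpha>"
    by (simp add: \<zeta>_orthogonal cscale_def)
qed

section \<open>The complex on formal Hermite coefficients\<close>

lemma finite_I0 [simp]: "finite (I0 k)"
  using finite_lists_length_eq[of "UNIV :: primed set" k] by (simp add: I0_def)

lemma I1_eq: "I1 k = UNIV \<times> I0 (k - 1)"
  by (auto simp: I1_def I0_def)

lemma I2_eq: "I2 k = UNIV \<times> UNIV \<times> I0 (k - 2)"
  by (auto simp: I2_def I0_def)

lemma finite_I1 [simp]: "finite (I1 k :: 'n::finite idx1 set)"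
  by (simp add: I1_eq)

lemma finite_I2 [simp]: "finite (I2 k :: 'n::finite idx2 set)"
  by (simp add: I2_eq)

lemma sum_I0_Suc: "(\<Sum>As\<in>I0 (Suc m). g As) = (\<Sum>x\<in>UNIV. \<Sum>Bs\<in>I0 m. g (x # Bs))"
  unfolding sum.cartesian_product
  by (rule sum.reindex_bij_witness[where i = "\<lambda>(x, Bs). x # Bs" and j = "\<lambda>As. (hd As, tl As)"])
     (auto simp: I0_def length_Suc_conv)

text \<open>
  The symmetrization of the tensor \<open>(x, As) \<mapsto> w x As\<close> over all of its indices: averaging over the position
  from which \<open>x\<close> is taken, positions with the same letter contribute equally. Written with letter counts
  it depends only on the multiset of the string.
\<close>

definition sym_cons :: "(primed \<Rightarrow> primed list \<Rightarrow> 'm \<Rightarrow> complex) \<Rightarrow> primed list \<Rightarrow> 'm \<Rightarrow> complex" where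
  "sym_cons w As = cscale (1 / of_nat (length As)) (\<Sum>x\<in>UNIV. cscale (of_nat (count_list As x)) (w x (remove1 x As)))"

lemma sym_cons_apply:
  "sym_cons w As \<alpha> = (\<Sum>x\<in>UNIV. of_nat (count_list As x) * w x (remove1 x As) \<alpha>) / of_nat (length As)"
  by (simp add: sym_cons_def cscale_def sum_fun_apply)

lemma sym_cons_cong:
  assumes w: "\<And>x As Bs. mset As = mset Bs \<Longrightarrow> w x As = w x Bs" and "mset As = mset Bs"
  shows "sym_cons w As = sym_cons w Bs"
proof -
  have "count_list As x = count_list Bs x" "w x (remove1 x As) = w x (remove1 x Bs)" for x
    using assms(2) by (simp_all flip: count_mset) (auto intro: w)
  with assms(2) show ?thesis by (simp add: sym_cons_def size_mset[symmetric] del: size_mset)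
qed

text \<open>
  Either the first letter is extracted, or a letter of the tail.
\<close>

lemma sym_cons_Cons:
  assumes w: "\<And>x As Bs. mset As = mset Bs \<Longrightarrow> w x As = w x Bs"
  shows "sym_cons w (y # Bs) = cscale (1 / of_nat (Suc (length Bs)))
           (w y Bs + cscale (of_nat (length Bs)) (sym_cons (\<lambda>x Cs. w x (y # Cs)) Bs))"
proof
  fix \<alpha>
  have "of_nat (count_list (y # Bs) x) * w x (remove1 x (y # Bs)) \<alpha>
     = (if x = y then w y Bs \<alpha> else 0) + of_nat (count_list Bs x) * w x (y # remove1 x Bs) \<alpha>" for x
  proof (cases "x = y \<and> y \<in> set Bs")
    case True
    (* If y also occurs in Bs, removing the first occurrence is compared with removing a later one. *)
    then have "w x (y # remove1 x Bs) = w x Bs" by (intro w) auto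
    with True show ?thesis by (simp add: algebra_simps)
  qed (auto simp: count_notin)
  then have "sym_cons w (y # Bs) \<alpha> = (w y Bs \<alpha> + (\<Sum>x\<in>UNIV. of_nat (count_list Bs x) * w x (y # remove1 x Bs) \<alpha>))
      / of_nat (Suc (length Bs))"
    by (simp add: sym_cons_apply sum.distrib del: count_list.simps remove1.simps)
  also have "(\<Sum>x\<in>UNIV. of_nat (count_list Bs x) * w x (y # remove1 x Bs) \<alpha>)
      = of_nat (length Bs) * sym_cons (\<lambda>x Cs. w x (y # Cs)) Bs \<alpha>"
    by (cases Bs) (simp_all add: sym_cons_apply del: of_nat_Suc)
  finally show "sym_cons w (y # Bs) \<alpha> = cscale (1 / of_nat (Suc (length Bs)))
           (w y Bs + cscale (of_nat (length Bs)) (sym_cons (\<lambda>x Cs. w x (y # Cs)) Bs)) \<alpha>"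
    by (simp add: cscale_def)
qed

text \<open>
  Symmetrization is the orthogonal projection to the symmetric tensors, so it can be dropped in the pairing with a
  symmetric \<open>f\<close>, and the first letter of the string is split off. The induction follows \<open>sym_cons_Cons\<close>.
\<close>

lemma level_ip_sym_cons:
  assumes f: "\<And>As Bs. mset As = mset Bs \<Longrightarrow> f As = f Bs"
    and w: "\<And>x As Bs. mset As = mset Bs \<Longrightarrow> w x As = w x Bs"
  shows "(\<Sum>As\<in>I0 (Suc m). level_ip d (f As) (sym_cons w As)) = (\<Sum>x\<in>UNIV. \<Sum>Bs\<in>I0 m. level_ip d (f (x # Bs)) (w x Bs))"
  using assms
proof (induction m arbitrary: f w)
  case 0
  show ?case unfolding sum_I0_Suc
    by (intro sum.cong refl) (auto simp: sym_cons_Cons[of w, OF "0.prems"(2)] I0_def)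
next
  case (Suc m)
  let ?R = "\<Sum>x\<in>UNIV. \<Sum>Bs\<in>I0 (Suc m). level_ip d (f (x # Bs)) (w x Bs)"
  have IH: "(\<Sum>Bs\<in>I0 (Suc m). level_ip d (f (x # Bs)) (sym_cons (\<lambda>y Cs. w y (x # Cs)) Bs))
     = (\<Sum>y\<in>UNIV. \<Sum>Cs\<in>I0 m. level_ip d (f (x # y # Cs)) (w y (x # Cs)))" for x
    by (rule Suc.IH[of "\<lambda>Bs. f (x # Bs)" "\<lambda>y Cs. w y (x # Cs)"]; rule Suc.prems; simp)
  have "(\<Sum>x\<in>UNIV. \<Sum>Bs\<in>I0 (Suc m). level_ip d (f (x # Bs)) (sym_cons (\<lambda>y Cs. w y (x # Cs)) Bs))
      = (\<Sum>x\<in>UNIV. \<Sum>y\<in>UNIV. \<Sum>Cs\<in>I0 m. level_ip d (f (y # x # Cs)) (w y (x # Cs)))"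
    unfolding IH
  proof (intro sum.cong refl)
    fix x y Cs show "level_ip d (f (x # y # Cs)) (w y (x # Cs)) = level_ip d (f (y # x # Cs)) (w y (x # Cs))"
      by (subst Suc.prems(1)[of "x # y # Cs" "y # x # Cs"]) simp_all
  qed
  also have "\<dots> = ?R"
    unfolding sum_I0_Suc by (rule sum.swap)
  finally have R: "(\<Sum>x\<in>UNIV. \<Sum>Bs\<in>I0 (Suc m). level_ip d (f (x # Bs)) (sym_cons (\<lambda>y Cs. w y (x # Cs)) Bs)) = ?R" .
  have "(\<Sum>As\<in>I0 (Suc (Suc m)). level_ip d (f As) (sym_cons w As))
      = (\<Sum>x\<in>UNIV. \<Sum>Bs\<in>I0 (Suc m). (level_ip d (f (x # Bs)) (w x Bs)
          + of_nat (Suc m) * level_ip d (f (x # Bs)) (sym_cons (\<lambda>y Cs. w y (x # Cs)) Bs)) / of_nat (Suc (Suc m)))"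
    unfolding sum_I0_Suc[of _ "Suc m"]
    by (intro sum.cong refl)
       (auto simp: sym_cons_Cons[of w, OF Suc.prems(2)] I0_def level_ip_cscale level_ip_add simp del: of_nat_Suc)
  also have "\<dots> = (?R + of_nat (Suc m) * ?R) / of_nat (Suc (Suc m))"
    unfolding sum_divide_distrib[symmetric] sum.distrib sum_distrib_left[symmetric] R ..
  also have "\<dots> = (of_nat (Suc (Suc m)) * ?R) / of_nat (Suc (Suc m))"
    by (simp add: algebra_simps)
  finally show ?case by (simp del: of_nat_Suc)
qed

lemma level_ip_sym_cons':
  assumes "\<And>As Bs. mset As = mset Bs \<Longrightarrow> f As = f Bs"
    and "\<And>x As Bs. mset As = mset Bs \<Longrightarrow> w x As = w x Bs"
  shows "(\<Sum>As\<in>I0 (Suc m). level_ip d (sym_cons w As) (f As)) = (\<Sum>x\<in>UNIV. \<Sum>Bs\<in>I0 m. level_ip d (w x Bs) (f (x # Bs)))"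
  using arg_cong[OF level_ip_sym_cons[of f w d m, OF assms], of cnj] by (simp add: level_ip_cnj)

definition valued :: "('i \<Rightarrow> complex) set \<Rightarrow> ('i \<Rightarrow> 'm \<Rightarrow> complex) \<Rightarrow> bool" where
  "valued V c \<longleftrightarrow> (\<forall>\<alpha>. (\<lambda>I. c I \<alpha>) \<in> V)"

lemma valued_V0: "valued (V0 k) c \<longleftrightarrow>
    (\<forall>As. length As \<noteq> k \<longrightarrow> c As = 0) \<and> (\<forall>As Bs. mset As = mset Bs \<longrightarrow> c As = c Bs)"
  unfolding valued_def V0_def I0_def fun_eq_iff mem_Collect_eq zero_fun_apply by blast

lemma valued_V1: "valued (V1 k) c \<longleftrightarrow>
    (\<forall>A As. length As \<noteq> k - 1 \<longrightarrow> c (A, As) = 0) \<and>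
    (\<forall>A As Bs. mset As = mset Bs \<longrightarrow> c (A, As) = c (A, Bs))"
  unfolding valued_def V1_def I1_def fun_eq_iff mem_Collect_eq zero_fun_apply split_paired_All case_prod_conv by blast

lemma valued_V2: "valued (V2 k) c \<longleftrightarrow>
    (\<forall>A B As. length As \<noteq> k - 2 \<longrightarrow> c (A, B, As) = 0) \<and>
    (\<forall>A B As Bs. mset As = mset Bs \<longrightarrow> c (A, B, As) = c (A, B, Bs)) \<and>
    (\<forall>A B As. c (A, B, As) = cscale (- 1) (c (B, A, As)))"
  unfolding valued_def V2_def I2_def fun_eq_iff mem_Collect_eq zero_fun_apply cscale_def mult_minus1
    split_paired_All case_prod_conv by blast

definition coeff_ip :: "'i set \<Rightarrow> int \<Rightarrow> ('i \<Rightarrow> ('j::finite) multi \<Rightarrow> complex) \<Rightarrow> ('i \<Rightarrow> 'j multi \<Rightarrow> complex) \<Rightarrow> complex" where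
  "coeff_ip S d f g = (\<Sum>I\<in>S. level_ip d (f I) (g I))"

type_synonym ('n, 'i) coeffs = "'i \<Rightarrow> ('n \<times> 4) multi \<Rightarrow> complex"

text \<open>
  Tuples vanish off their index set, and so do the results, because a string and its extension by one letter
  have the right lengths simultaneously.
\<close>

definition D0_fock :: "('n::finite, idx0) coeffs \<Rightarrow> ('n, 'n idx1) coeffs" where
  "D0_fock f = (\<lambda>(A, As). \<Sum>A'\<in>UNIV. Z_fock A A' (f (A' # As)))"

definition D1_fock :: "('n::finite, 'n idx1) coeffs \<Rightarrow> ('n, 'n idx2) coeffs" where
  "D1_fock h = (\<lambda>(A, B, As). \<Sum>A'\<in>UNIV. Z_fock A A' (h (B, A' # As)) - Z_fock B A' (h (A, A' # As)))"

text \<open>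
  The adjoint on symmetric tuples is the transpose of the defining sum, followed by symmetrization. In
  \<open>D1_fock_adj\<close> the factor 2 comes from the antisymmetry in the two unprimed indices.
\<close>

definition D0_fock_adj :: "('n::finite, 'n idx1) coeffs \<Rightarrow> ('n, idx0) coeffs" where
  "D0_fock_adj v = sym_cons (\<lambda>A' Bs. \<Sum>A\<in>UNIV. Z_fock_adj A A' (v (A, Bs)))"

definition D1_fock_adj :: "('n::finite, 'n idx2) coeffs \<Rightarrow> ('n, 'n idx1) coeffs" where
  "D1_fock_adj p = (\<lambda>(B, Bs). cscale 2 (sym_cons (\<lambda>A' Cs. \<Sum>A\<in>UNIV. Z_fock_adj A A' (p (A, B, Cs))) Bs))"

lemma sum_zero_fun: "(\<And>x. x \<in> X \<Longrightarrow> c x = 0) \<Longrightarrow> (\<Sum>x\<in>X. c x) = (0 :: 'a \<Rightarrow> complex)"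
  by (rule sum.neutral) auto

lemma valued_D0_fock: assumes f: "valued (V0 k) f" and k: "k \<ge> 1" shows "valued (V1 k) (D0_fock f)"
  unfolding valued_V1
proof (intro conjI allI impI)
  fix A :: "'a unprimed" and As :: "primed list" assume "length As \<noteq> k - 1"
  then have "Z_fock A A' (f (A' # As)) = 0" for A'
    using f[unfolded valued_V0, THEN conjunct1, rule_format, of "A' # As"] k by auto
  then show "D0_fock f (A, As) = 0" unfolding D0_fock_def case_prod_conv by (intro sum_zero_fun)
next
  fix A :: "'a unprimed" and As Bs :: "primed list" assume "mset As = mset Bs"
  then have "f (A' # As) = f (A' # Bs)" for A'
    using f[unfolded valued_V0, THEN conjunct2, rule_format, of "A' # As" "A' # Bs"] by simp
  then show "D0_fock f (A, As) = D0_fock f (A, Bs)" by (simp add: D0_fock_def)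
qed

lemma valued_D1_fock: assumes h: "valued (V1 k) h" and k: "k \<ge> 2" shows "valued (V2 k) (D1_fock h)"
  unfolding valued_V2
proof (intro conjI allI impI)
  fix A B :: "'a unprimed" and As :: "primed list" assume "length As \<noteq> k - 2"
  then have "h (A, A' # As) = 0" for A A'
    using h[unfolded valued_V1, THEN conjunct1, rule_format, of "A' # As"] k by auto
  then show "D1_fock h (A, B, As) = 0" unfolding D1_fock_def case_prod_conv
    by (intro sum_zero_fun) (simp del: zero_fun_def)
next
  fix A B :: "'a unprimed" and As Bs :: "primed list" assume "mset As = mset Bs"
  then have "h (A, A' # As) = h (A, A' # Bs)" for A A'
    using h[unfolded valued_V1, THEN conjunct2, rule_format, of "A' # As" "A' # Bs"] by simp
  then show "D1_fock h (A, B, As) = D1_fock h (A, B, Bs)" by (simp add: D1_fock_def)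
next
  fix A B :: "'a unprimed" and As :: "primed list"
  show "D1_fock h (A, B, As) = cscale (- 1) (D1_fock h (B, A, As))"
  proof
    fix \<alpha> show "D1_fock h (A, B, As) \<alpha> = cscale (- 1) (D1_fock h (B, A, As)) \<alpha>"
      by (simp add: D1_fock_def cscale_def sum_fun_apply sum_negf[symmetric] minus_diff_eq del: sum_negf)
  qed
qed

lemma sym_cons_eq_0:
  assumes "\<And>x Bs. length Bs \<noteq> m \<Longrightarrow> w x Bs = 0" "length As \<noteq> Suc m"
  shows "sym_cons w As = 0"
proof -
  have "cscale (of_nat (count_list As x)) (w x (remove1 x As)) = 0" for x
  proof (cases "x \<in> set As")
    case True
    then have "w x (remove1 x As) = 0"
      using assms(2) length_pos_if_in_set[OF True] by (intro assms(1)) (auto simp: length_remove1)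
    then show ?thesis by (auto simp: cscale_def fun_eq_iff)
  qed (simp add: count_notin)
  then show ?thesis unfolding sym_cons_def by (subst sum.neutral) auto
qed

lemma valued_D0_fock_adj: assumes v: "valued (V1 k) v" and k: "k \<ge> 1" shows "valued (V0 k) (D0_fock_adj v)"
proof -
  have s: "(\<Sum>A\<in>UNIV. Z_fock_adj A A' (v (A, As))) = (\<Sum>A\<in>UNIV. Z_fock_adj A A' (v (A, Bs)))" if "mset As = mset Bs" for A' As Bs
  proof -
    have "v (A, As) = v (A, Bs)" for A
      using v[unfolded valued_V1, THEN conjunct2, rule_format, OF that] .
    then show ?thesis by simp
  qed
  have z: "(\<Sum>A\<in>UNIV. Z_fock_adj A A' (v (A, As))) = 0" if "length As \<noteq> k - 1" for A' As
  proof (rule sum_zero_fun)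
    fix A have "v (A, As) = 0" using v[unfolded valued_V1, THEN conjunct1, rule_format, OF that] .
    then show "Z_fock_adj A A' (v (A, As)) = 0" by (simp only: Z_fock_adj_0)
  qed
  have "D0_fock_adj v As = 0" if "length As \<noteq> k" for As
    unfolding D0_fock_adj_def using that k by (intro sym_cons_eq_0[where m = "k - 1"] z) auto
  moreover have "D0_fock_adj v As = D0_fock_adj v Bs" if "mset As = mset Bs" for As Bs
    unfolding D0_fock_adj_def by (rule sym_cons_cong[OF s that])
  ultimately show ?thesis unfolding valued_V0 by blast
qed

lemma valued_D1_fock_adj: assumes p: "valued (V2 k) p" and k: "k \<ge> 2" shows "valued (V1 k) (D1_fock_adj p)"
proof -
  have s: "(\<Sum>A\<in>UNIV. Z_fock_adj A A' (p (A, B, As))) = (\<Sum>A\<in>UNIV. Z_fock_adj A A' (p (A, B, Bs)))"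
    if "mset As = mset Bs" for A' B As Bs
  proof -
    have "p (A, B, As) = p (A, B, Bs)" for A
      using p[unfolded valued_V2, THEN conjunct2, THEN conjunct1, rule_format, OF that] .
    then show ?thesis by simp
  qed
  have z: "(\<Sum>A\<in>UNIV. Z_fock_adj A A' (p (A, B, As))) = 0" if "length As \<noteq> k - 2" for A' B As
  proof (rule sum_zero_fun)
    fix A have "p (A, B, As) = 0" using p[unfolded valued_V2, THEN conjunct1, rule_format, OF that] .
    then show "Z_fock_adj A A' (p (A, B, As)) = 0" by (simp only: Z_fock_adj_0)
  qed
  have "D1_fock_adj p (B, As) = 0" if "length As \<noteq> k - 1" for B As
  proof -
    have "sym_cons (\<lambda>A' Cs. \<Sum>A\<in>UNIV. Z_fock_adj A A' (p (A, B, Cs))) As = 0"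
      using that k by (intro sym_cons_eq_0[where m = "k - 2"] z) auto
    then show ?thesis by (simp only: D1_fock_adj_def case_prod_conv cscale_zero)
  qed
  moreover have "D1_fock_adj p (B, As) = D1_fock_adj p (B, Bs)" if "mset As = mset Bs" for B As Bs
    using sym_cons_cong[OF s that] by (simp only: D1_fock_adj_def case_prod_conv)
  ultimately show ?thesis unfolding valued_V1 by blast
qed

lemma sum_I1: "(\<Sum>I\<in>I1 k. g I) = (\<Sum>A\<in>UNIV. \<Sum>As\<in>I0 (k - 1). g (A, As))"
  by (simp add: I1_eq sum.cartesian_product)

lemma sum_I2: "(\<Sum>I\<in>I2 k. g I) = (\<Sum>A\<in>UNIV. \<Sum>B\<in>UNIV. \<Sum>As\<in>I0 (k - 2). g (A, B, As))"
  by (simp add: I2_eq sum.cartesian_product)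

lemma coeff_ip_D0_fock:
  assumes f: "valued (V0 k) f" and v: "valued (V1 k) v" and k: "k \<ge> 1"
  shows "coeff_ip (I1 k) (d - 1) (D0_fock f) v = coeff_ip (I0 k) d f (D0_fock_adj v)"
proof -
  obtain m where m: "k = Suc m" using k by (cases k) auto
  have vs: "v (A, As) = v (A, Bs)" if "mset As = mset Bs" for A As Bs
    using v[unfolded valued_V1, THEN conjunct2, rule_format, OF that] .
  have fs: "f As = f Bs" if "mset As = mset Bs" for As Bs
    using f[unfolded valued_V0, THEN conjunct2, rule_format, OF that] .
  have ws: "(\<Sum>A\<in>UNIV. Z_fock_adj A A' (v (A, As))) = (\<Sum>A\<in>UNIV. Z_fock_adj A A' (v (A, Bs)))"
    if "mset As = mset Bs" for A' As Bs
    using vs[OF that] by simp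
  have "coeff_ip (I0 k) d f (D0_fock_adj v) = (\<Sum>x\<in>UNIV. \<Sum>Bs\<in>I0 m. level_ip d (f (x # Bs)) (\<Sum>A\<in>UNIV. Z_fock_adj A x (v (A, Bs))))"
    unfolding coeff_ip_def D0_fock_adj_def m by (rule level_ip_sym_cons[OF fs ws])
  also have "\<dots> = (\<Sum>x\<in>UNIV. \<Sum>Bs\<in>I0 m. \<Sum>A\<in>UNIV. level_ip (d - 1) (Z_fock A x (f (x # Bs))) (v (A, Bs)))"
    by (simp only: level_ip_sum_right level_ip_Z_fock)
  also have "\<dots> = (\<Sum>A\<in>UNIV. \<Sum>Bs\<in>I0 m. \<Sum>x\<in>UNIV. level_ip (d - 1) (Z_fock A x (f (x # Bs))) (v (A, Bs)))"
    by (subst sum.swap, subst (2) sum.swap, subst sum.swap, rule refl)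
  also have "\<dots> = coeff_ip (I1 k) (d - 1) (D0_fock f) v"
    by (simp add: coeff_ip_def D0_fock_def sum_I1 level_ip_sum_left m)
  finally show ?thesis ..
qed

text \<open>
  By antisymmetry of \<open>p\<close> the two halves of \<open>D\<^sub>1 h\<close> contribute equally.
\<close>

lemma coeff_ip_D1_fock:
  assumes h: "valued (V1 k) h" and p: "valued (V2 k) p" and k: "k \<ge> 2"
  shows "coeff_ip (I2 k) (d - 1) (D1_fock h) p = coeff_ip (I1 k) d h (D1_fock_adj p)"
proof -
  obtain m where m: "k = Suc (Suc m)" using k by (metis One_nat_def Suc_1 Suc_le_D Suc_le_mono)
  have ps: "p (A, B, As) = p (A, B, Bs)" if "mset As = mset Bs" for A B As Bs
    using p[unfolded valued_V2, THEN conjunct2, THEN conjunct1, rule_format, OF that] .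
  have pa: "p (A, B, As) = cscale (- 1) (p (B, A, As))" for A B As
    using p[unfolded valued_V2, THEN conjunct2, THEN conjunct2, rule_format] .
  have hs: "h (B, As) = h (B, Bs)" if "mset As = mset Bs" for B As Bs
    using h[unfolded valued_V1, THEN conjunct2, rule_format, OF that] .
  have ws: "(\<Sum>A\<in>UNIV. Z_fock_adj A A' (p (A, B, As))) = (\<Sum>A\<in>UNIV. Z_fock_adj A A' (p (A, B, Bs)))"
    if "mset As = mset Bs" for A' B As Bs
    using ps[OF that] by simp
  let ?t = "\<lambda>A B Cs x. level_ip (d - 1) (Z_fock A x (h (B, x # Cs))) (p (A, B, Cs))"
  have "coeff_ip (I1 k) d h (D1_fock_adj p)
      = 2 * (\<Sum>B\<in>UNIV. \<Sum>As\<in>I0 (Suc m). level_ip d (h (B, As)) (sym_cons (\<lambda>A' Cs. \<Sum>A\<in>UNIV. Z_fock_adj A A' (p (A, B, Cs))) As))"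
    by (simp add: coeff_ip_def D1_fock_adj_def sum_I1 m level_ip_cscale sum_distrib_left)
  also have "\<dots> = 2 * (\<Sum>B\<in>UNIV. \<Sum>x\<in>UNIV. \<Sum>Cs\<in>I0 m. level_ip d (h (B, x # Cs)) (\<Sum>A\<in>UNIV. Z_fock_adj A x (p (A, B, Cs))))"
    by (intro arg_cong[where f = "(*) 2"] sum.cong refl level_ip_sym_cons[OF hs ws])
  also have "\<dots> = 2 * (\<Sum>B\<in>UNIV. \<Sum>x\<in>UNIV. \<Sum>Cs\<in>I0 m. \<Sum>A\<in>UNIV. ?t A B Cs x)"
    by (simp only: level_ip_sum_right level_ip_Z_fock)
  also have "(\<Sum>B\<in>UNIV. \<Sum>x\<in>UNIV. \<Sum>Cs\<in>I0 m. \<Sum>A\<in>UNIV. ?t A B Cs x)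
      = (\<Sum>B\<in>UNIV. \<Sum>A\<in>UNIV. \<Sum>Cs\<in>I0 m. \<Sum>x\<in>UNIV. ?t A B Cs x)"
    by (intro sum.cong refl) (subst sum.swap, subst (2) sum.swap, subst sum.swap, rule refl)
  also have "\<dots> = (\<Sum>A\<in>UNIV. \<Sum>B\<in>UNIV. \<Sum>Cs\<in>I0 m. \<Sum>x\<in>UNIV. ?t A B Cs x)"
    by (rule sum.swap)
  finally have 1: "coeff_ip (I1 k) d h (D1_fock_adj p) = 2 * (\<Sum>A\<in>UNIV. \<Sum>B\<in>UNIV. \<Sum>Cs\<in>I0 m. \<Sum>x\<in>UNIV. ?t A B Cs x)" .
  have "coeff_ip (I2 k) (d - 1) (D1_fock h) p = (\<Sum>A\<in>UNIV. \<Sum>B\<in>UNIV. \<Sum>Cs\<in>I0 m. \<Sum>x\<in>UNIV.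
      ?t A B Cs x - level_ip (d - 1) (Z_fock B x (h (A, x # Cs))) (p (A, B, Cs)))"
    by (simp add: coeff_ip_def D1_fock_def sum_I2 m level_ip_sum_left level_ip_diff)
  also have "\<dots> = (\<Sum>A\<in>UNIV. \<Sum>B\<in>UNIV. \<Sum>Cs\<in>I0 m. \<Sum>x\<in>UNIV. ?t A B Cs x + ?t B A Cs x)"
    by (intro sum.cong refl) (subst (2) pa, simp add: level_ip_cscale)
  also have "\<dots> = (\<Sum>A\<in>UNIV. \<Sum>B\<in>UNIV. \<Sum>Cs\<in>I0 m. \<Sum>x\<in>UNIV. ?t A B Cs x)
       + (\<Sum>A\<in>UNIV. \<Sum>B\<in>UNIV. \<Sum>Cs\<in>I0 m. \<Sum>x\<in>UNIV. ?t B A Cs x)"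
    by (simp only: sum.distrib)
  also have "(\<Sum>A\<in>UNIV. \<Sum>B\<in>UNIV. \<Sum>Cs\<in>I0 m. \<Sum>x\<in>UNIV. ?t B A Cs x)
      = (\<Sum>A\<in>UNIV. \<Sum>B\<in>UNIV. \<Sum>Cs\<in>I0 m. \<Sum>x\<in>UNIV. ?t A B Cs x)"
    by (rule sum.swap)
  finally show ?thesis unfolding 1 by simp
qed

text \<open>
  The fields commute and \<open>f\<close> is symmetric, so the two terms cancel.
\<close>

lemma D1_fock_D0_fock: assumes f: "valued (V0 k) f" shows "D1_fock (D0_fock f) = 0"
proof
  fix I :: "'a idx2"
  obtain A B As where I: "I = (A, B, As)" by (cases I) auto
  have fs: "f As = f Bs" if "mset As = mset Bs" for As Bs
    using f[unfolded valued_V0, THEN conjunct2, rule_format, OF that] .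
  have "(\<Sum>x\<in>UNIV. Z_fock A x (D0_fock f (B, x # As))) = (\<Sum>x\<in>UNIV. \<Sum>y\<in>UNIV. Z_fock A x (Z_fock B y (f (y # x # As))))"
    by (simp add: D0_fock_def Z_fock_sum)
  also have "\<dots> = (\<Sum>x\<in>UNIV. \<Sum>y\<in>UNIV. Z_fock B y (Z_fock A x (f (x # y # As))))"
    by (intro sum.cong refl, subst Z_fock_commute, subst fs[of "_ # _ # As"]) (auto simp: add_mset_commute)
  also have "\<dots> = (\<Sum>y\<in>UNIV. \<Sum>x\<in>UNIV. Z_fock B y (Z_fock A x (f (x # y # As))))"
    by (rule sum.swap)
  also have "\<dots> = (\<Sum>y\<in>UNIV. Z_fock B y (D0_fock f (A, y # As)))"
    by (simp add: D0_fock_def Z_fock_sum)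
  finally show "D1_fock (D0_fock f) I = 0 I"
    by (simp add: I D1_fock_def fun_eq_iff sum_fun_apply sum_subtractf)
qed


lemma level_ip_Z_fock_adj: "level_ip d (Z_fock_adj A A' c') c = level_ip (d - 1) c' (Z_fock A A' c)"
  using arg_cong[OF level_ip_Z_fock[of d A A' c c'], of cnj] by (simp add: level_ip_cnj)

text \<open>
  Moving both raising operators to the other side costs one commutator.
\<close>

lemma level_ip_Z_fock_adj_Z_fock_adj:
  "level_ip (d + 1) (Z_fock_adj A A' a) (Z_fock_adj B B' b) = level_ip (d - 1) (Z_fock B B' a) (Z_fock A A' b) + (if A = B \<and> A' = B' then 8 * level_ip d a b else 0)"
proof -
  have "level_ip (d + 1) (Z_fock_adj A A' a) (Z_fock_adj B B' b) = level_ip d (Z_fock B B' (Z_fock_adj A A' a)) b"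
    using level_ip_Z_fock[of "d + 1" B B' "Z_fock_adj A A' a" b] by simp
  also have "\<dots> = level_ip d (Z_fock_adj A A' (Z_fock B B' a)) b + (if A = B \<and> A' = B' then 8 * level_ip d a b else 0)"
    unfolding Z_fock_Z_fock_adj level_ip_add by (auto simp: level_ip_cscale)
  finally show ?thesis by (simp add: level_ip_Z_fock_adj)
qed

text \<open>
  With \<open>k = m + 2\<close> and \<open>D\<^sub>0\<^sup>* f = sym_cons w\<close>. By \<open>sym_cons_Cons\<close>, \<open>k |D\<^sub>0\<^sup>* f|\<^sup>2\<close> is \<open>|w|\<^sup>2\<close> plus \<open>k - 1\<close> times a sum \<open>Q\<close> of mixed
  terms, in which one primed index has been exchanged. Commuting the operators in \<open>Q\<close> gives
  \<open>Q = R + 8 |f|\<^sup>2\<close> with \<open>R = \<Sum> \<langle>C\<^sub>B\<^sub>A, C\<^sub>A\<^sub>B\<rangle>\<close>. Finally \<open>D\<^sub>1 f\<close> is the antisymmetrization of \<open>C\<close>, so that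
  \<open>|D\<^sub>1 f|\<^sup>2 = 2 |C|\<^sup>2 - 2 R\<close>.
\<close>

lemma energy_identity:
  fixes f :: "('n::finite, 'n idx1) coeffs"
  assumes f: "valued (V1 (Suc (Suc m))) f"
  defines "w \<equiv> \<lambda>A' Bs. \<Sum>A\<in>UNIV. Z_fock_adj A A' (f (A, Bs))"
    and "C \<equiv> \<lambda>A B Cs. \<Sum>A'\<in>UNIV. Z_fock A A' (f (B, A' # Cs))"
  shows "of_nat (Suc (Suc m)) * coeff_ip (I0 (Suc (Suc m))) (d + 1) (D0_fock_adj f) (D0_fock_adj f)
     + of_nat (Suc m) / 2 * coeff_ip (I2 (Suc (Suc m))) (d - 1) (D1_fock f) (D1_fock f)
   = (\<Sum>x\<in>UNIV. \<Sum>Bs\<in>I0 (Suc m). level_ip (d + 1) (w x Bs) (w x Bs))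
     + of_nat (Suc m) * ((\<Sum>A\<in>UNIV. \<Sum>B\<in>UNIV. \<Sum>Cs\<in>I0 m. level_ip (d - 1) (C A B Cs) (C A B Cs))
     + 8 * coeff_ip (I1 (Suc (Suc m))) d f f)"
proof -
  define X where "X = coeff_ip (I0 (Suc (Suc m))) (d + 1) (D0_fock_adj f) (D0_fock_adj f)"
  define Y where "Y = coeff_ip (I2 (Suc (Suc m))) (d - 1) (D1_fock f) (D1_fock f)"
  define P where "P = (\<Sum>x\<in>UNIV. \<Sum>Bs\<in>I0 (Suc m). level_ip (d + 1) (w x Bs) (w x Bs))"
  define Q where "Q = (\<Sum>x\<in>UNIV. \<Sum>y\<in>UNIV. \<Sum>Cs\<in>I0 m. level_ip (d + 1) (w y (x # Cs)) (w x (y # Cs)))"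
  define N where "N = (\<Sum>A\<in>UNIV. \<Sum>B\<in>UNIV. \<Sum>Cs\<in>I0 m. level_ip (d - 1) (C A B Cs) (C A B Cs))"
  define R where "R = (\<Sum>A\<in>UNIV. \<Sum>B\<in>UNIV. \<Sum>Cs\<in>I0 m. level_ip (d - 1) (C B A Cs) (C A B Cs))"
  have fs: "f (B, As) = f (B, Bs)" if "mset As = mset Bs" for B As Bs
    using f[unfolded valued_V1, THEN conjunct2, rule_format, OF that] .
  have ws: "w x As = w x Bs" if "mset As = mset Bs" for x As Bs
    using fs[OF that] by (simp add: w_def)
  have symw: "sym_cons w As = sym_cons w Bs" if "mset As = mset Bs" for As Bs
    by (rule sym_cons_cong[OF ws that])
  have D0_fock_adj: "D0_fock_adj f = sym_cons w" by (simp add: D0_fock_adj_def w_def)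
  have "X = (\<Sum>x\<in>UNIV. \<Sum>Bs\<in>I0 (Suc m). level_ip (d + 1) (sym_cons w (x # Bs)) (w x Bs))"
    unfolding X_def coeff_ip_def D0_fock_adj by (rule level_ip_sym_cons[OF symw ws])
  also have "\<dots> = (\<Sum>x\<in>UNIV. \<Sum>Bs\<in>I0 (Suc m). (level_ip (d + 1) (w x Bs) (w x Bs) +
      of_nat (Suc m) * level_ip (d + 1) (sym_cons (\<lambda>y Cs. w y (x # Cs)) Bs) (w x Bs)) / of_nat (Suc (Suc m)))"
    by (intro sum.cong refl) (simp add: sym_cons_Cons[of w, OF ws] level_ip_cscale level_ip_add I0_def del: of_nat_Suc)
  also have "\<dots> = (P + of_nat (Suc m) *
     (\<Sum>x\<in>UNIV. \<Sum>Bs\<in>I0 (Suc m). level_ip (d + 1) (sym_cons (\<lambda>y Cs. w y (x # Cs)) Bs) (w x Bs))) / of_nat (Suc (Suc m))"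
    unfolding sum_divide_distrib[symmetric] sum.distrib sum_distrib_left[symmetric] P_def ..
  also have "(\<Sum>x\<in>UNIV. \<Sum>Bs\<in>I0 (Suc m). level_ip (d + 1) (sym_cons (\<lambda>y Cs. w y (x # Cs)) Bs) (w x Bs)) = Q"
    unfolding Q_def
  proof (rule sum.cong[OF refl])
    fix x
    have "w y (x # As) = w y (x # Bs)" if "mset As = mset Bs" for y As Bs
      by (rule ws) (simp add: that)
    from level_ip_sym_cons'[of "w x" "\<lambda>y Cs. w y (x # Cs)", OF ws this]
    show "(\<Sum>Bs\<in>I0 (Suc m). level_ip (d + 1) (sym_cons (\<lambda>y Cs. w y (x # Cs)) Bs) (w x Bs))
      = (\<Sum>y\<in>UNIV. \<Sum>Cs\<in>I0 m. level_ip (d + 1) (w y (x # Cs)) (w x (y # Cs)))" .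
  qed
  finally have 1: "of_nat (Suc (Suc m)) * X = P + of_nat (Suc m) * Q"
    by (simp del: of_nat_Suc)

  have "Q = (\<Sum>x\<in>UNIV. \<Sum>y\<in>UNIV. \<Sum>Cs\<in>I0 m. \<Sum>A\<in>UNIV. \<Sum>B\<in>UNIV.
      level_ip (d - 1) (Z_fock B x (f (A, x # Cs))) (Z_fock A y (f (B, y # Cs)))
      + (if A = B \<and> y = x then 8 * level_ip d (f (A, x # Cs)) (f (B, y # Cs)) else 0))"
    unfolding Q_def w_def level_ip_sum_left level_ip_sum_right
    by (subst (2) sum.swap) (simp only: level_ip_Z_fock_adj_Z_fock_adj)
  also have "\<dots> = (\<Sum>x\<in>UNIV. \<Sum>y\<in>UNIV. \<Sum>Cs\<in>I0 m. \<Sum>A\<in>UNIV. \<Sum>B\<in>UNIV.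
      level_ip (d - 1) (Z_fock B x (f (A, x # Cs))) (Z_fock A y (f (B, y # Cs))))
      + (\<Sum>x\<in>UNIV. \<Sum>y\<in>UNIV. \<Sum>Cs\<in>I0 m. \<Sum>A\<in>UNIV. \<Sum>B\<in>UNIV.
         if A = B \<and> y = x then 8 * level_ip d (f (A, x # Cs)) (f (B, y # Cs)) else 0)"
    by (simp only: sum.distrib)
  also have "(\<Sum>x\<in>UNIV. \<Sum>y\<in>UNIV. \<Sum>Cs\<in>I0 m. \<Sum>A\<in>UNIV. \<Sum>B\<in>UNIV.
         if A = B \<and> y = x then 8 * level_ip d (f (A, x # Cs)) (f (B, y # Cs)) else 0)
      = (\<Sum>x\<in>UNIV. \<Sum>y\<in>UNIV. if y = x then \<Sum>Cs\<in>I0 m. \<Sum>A\<in>UNIV. 8 * level_ip d (f (A, x # Cs)) (f (A, x # Cs)) else 0)"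
    by (intro sum.cong refl) auto
  also have "\<dots> = 8 * (\<Sum>x\<in>UNIV. \<Sum>Cs\<in>I0 m. \<Sum>A\<in>UNIV. level_ip d (f (A, x # Cs)) (f (A, x # Cs)))"
    by (simp add: sum_distrib_left)
  also have "(\<Sum>x\<in>UNIV. \<Sum>Cs\<in>I0 m. \<Sum>A\<in>UNIV. level_ip d (f (A, x # Cs)) (f (A, x # Cs)))
      = coeff_ip (I1 (Suc (Suc m))) d f f"
    unfolding coeff_ip_def sum_I1 diff_Suc_1 sum_I0_Suc
    by (subst (2) sum.swap, subst sum.swap, rule refl)
  also have "(\<Sum>x\<in>UNIV. \<Sum>y\<in>UNIV. \<Sum>Cs\<in>I0 m. \<Sum>A\<in>UNIV. \<Sum>B\<in>UNIV.
      level_ip (d - 1) (Z_fock B x (f (A, x # Cs))) (Z_fock A y (f (B, y # Cs)))) = 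
      (\<Sum>Cs\<in>I0 m. \<Sum>A\<in>UNIV. \<Sum>B\<in>UNIV. \<Sum>x\<in>UNIV. \<Sum>y\<in>UNIV. 
      level_ip (d - 1) (Z_fock B x (f (A, x # Cs))) (Z_fock A y (f (B, y # Cs))))"
    unfolding sum.swap[of _ "I0 m" "UNIV :: primed set"] sum.swap[of _ "UNIV :: 'n unprimed set" "UNIV :: primed set"] ..
  also have "\<dots> = R"
    unfolding R_def C_def level_ip_sum_left level_ip_sum_right
    unfolding sum.swap[of _ "I0 m" "UNIV :: 'n unprimed set"]
    by (rule sum.cong[OF refl], rule sum.cong[OF refl], rule sum.cong[OF refl], rule sum.swap)
  finally have 2: "Q = R + 8 * coeff_ip (I1 (Suc (Suc m))) d f f" .
  have "D1_fock f (A, B, Cs) = C A B Cs - C B A Cs" for A B Cs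
    by (simp add: D1_fock_def C_def fun_eq_iff sum_fun_apply sum_subtractf)
  then have "Y = (\<Sum>A\<in>UNIV. \<Sum>B\<in>UNIV. \<Sum>Cs\<in>I0 m. level_ip (d - 1) (C A B Cs) (C A B Cs) - level_ip (d - 1) (C B A Cs) (C A B Cs)
       - (level_ip (d - 1) (C A B Cs) (C B A Cs) - level_ip (d - 1) (C B A Cs) (C B A Cs)))"
    by (simp add: Y_def coeff_ip_def sum_I2 level_ip_diff)
  also have "\<dots> = N - R - ((\<Sum>A\<in>UNIV. \<Sum>B\<in>UNIV. \<Sum>Cs\<in>I0 m. level_ip (d - 1) (C A B Cs) (C B A Cs))
         - (\<Sum>A\<in>UNIV. \<Sum>B\<in>UNIV. \<Sum>Cs\<in>I0 m. level_ip (d - 1) (C B A Cs) (C B A Cs)))"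
    by (simp only: sum_subtractf N_def R_def)
  also have "(\<Sum>A\<in>UNIV. \<Sum>B\<in>UNIV. \<Sum>Cs\<in>I0 m. level_ip (d - 1) (C A B Cs) (C B A Cs)) = R"
    unfolding R_def by (rule sum.swap)
  also have "(\<Sum>A\<in>UNIV. \<Sum>B\<in>UNIV. \<Sum>Cs\<in>I0 m. level_ip (d - 1) (C B A Cs) (C B A Cs)) = N"
    unfolding N_def by (rule sum.swap)
  finally have 3: "Y = 2 * N - 2 * R" by simp
  have "of_nat (Suc (Suc m)) * X + of_nat (Suc m) / 2 * Y
      = P + of_nat (Suc m) * (N + 8 * coeff_ip (I1 (Suc (Suc m))) d f f)"
    unfolding 1 2 3 by (simp add: field_simps)
  then show ?thesis unfolding X_def Y_def P_def N_def .
qed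

lemma coeff_ip_nonneg: "0 \<le> Re (coeff_ip S d f f)"
  by (simp add: coeff_ip_def sum_nonneg level_ip_self_nonneg)

text \<open>
  Drop the squares \<open>|w|\<^sup>2\<close> and \<open>|C|\<^sup>2\<close> in the identity and divide by \<open>k\<close>: the constant is \<open>8 (k - 1) / k \<ge> 4\<close>, and the
  factor \<open>(k - 1) / (2 k)\<close> of \<open>|D\<^sub>1 f|\<^sup>2\<close> is at most 1.
\<close>

lemma energy_estimate:
  assumes f: "valued (V1 k) f" and k: "k \<ge> 2"
  shows "4 * Re (coeff_ip (I1 k) d f f) \<le> Re (coeff_ip (I0 k) (d + 1) (D0_fock_adj f) (D0_fock_adj f)) + Re (coeff_ip (I2 k) (d - 1) (D1_fock f) (D1_fock f))"
proof -
  obtain m where m: "k = Suc (Suc m)" using k by (metis One_nat_def Suc_1 Suc_le_D Suc_le_mono)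
  define w where "w = (\<lambda>A' Bs. \<Sum>A\<in>UNIV. Z_fock_adj A A' (f (A, Bs)))"
  define C where "C = (\<lambda>A B Cs. \<Sum>A'\<in>UNIV. Z_fock A A' (f (B, A' # Cs)))"
  define X where "X = Re (coeff_ip (I0 k) (d + 1) (D0_fock_adj f) (D0_fock_adj f))"
  define Y where "Y = Re (coeff_ip (I2 k) (d - 1) (D1_fock f) (D1_fock f))"
  define F where "F = Re (coeff_ip (I1 k) d f f)"
  define P where "P = (\<Sum>x\<in>UNIV. \<Sum>Bs\<in>I0 (Suc m). Re (level_ip (d + 1) (w x Bs) (w x Bs)))"
  define N where "N = (\<Sum>A\<in>UNIV. \<Sum>B\<in>UNIV. \<Sum>Cs\<in>I0 m. Re (level_ip (d - 1) (C A B Cs) (C A B Cs)))"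
  have nn: "0 \<le> Y" "0 \<le> F" "0 \<le> P" "0 \<le> N"
    by (auto simp: Y_def F_def P_def N_def intro!: coeff_ip_nonneg sum_nonneg level_ip_self_nonneg)
  have Re_mult: "Re (of_nat n * z) = real n * Re z" "Re (of_nat n / 2 * z) = real n / 2 * Re z" for n z
    by simp_all
  from arg_cong[OF energy_identity[OF f[unfolded m], of d], of Re]
  have "real (Suc (Suc m)) * X + real (Suc m) / 2 * Y = P + real (Suc m) * (N + 8 * F)"
    unfolding X_def Y_def P_def N_def F_def C_def w_def m plus_complex.sel Re_mult Re_sum by simp
  then have "real m * X + (real m * Y) / 2 + 2 * X + Y / 2 = P + N + real m * N + 8 * F + 8 * (real m * F)"
    by (simp add: algebra_simps add_divide_distrib)
  moreover have "0 \<le> real m * N" "0 \<le> real m * F" "0 \<le> real m * Y"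
    using nn by simp_all
  moreover have "(real m + 2) * (4 * F) = 4 * (real m * F) + 8 * F"
    "(real m + 2) * (X + Y) = real m * X + real m * Y + 2 * X + 2 * Y"
    by (simp_all add: algebra_simps)
  ultimately have "(real m + 2) * (4 * F) \<le> (real m + 2) * (X + Y)"
    using nn by linarith
  then show ?thesis unfolding X_def Y_def F_def by simp
qed

section \<open>Bijectivity of the box operator on each level\<close>

text \<open>
  The image of a maximal independent subset of \<open>W\<close> is independent and of the same size; hence it cannot be
  enlarged inside \<open>W\<close>, and it spans \<open>W\<close>.
\<close>

lemma (in vector_space) injective_imp_surjective_on_finite_subspace:
  assumes T: "Vector_Spaces.linear scale scale T" and W: "subspace W" and S: "finite S" "W \<subseteq> span S"
    and TW: "T ` W \<subseteq> W" and inj: "\<And>w. w \<in> W \<Longrightarrow> T w = 0 \<Longrightarrow> w = 0"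
  shows "W \<subseteq> T ` W"
proof -
  interpret p: vector_space_pair scale scale ..
  obtain B where B: "B \<subseteq> W" "independent B" "W \<subseteq> span B"
    using maximal_independent_subset[of W] by blast
  have WB: "W = span B" using B W by (meson span_minimal subset_antisym)
  have fin: "finite B"
    using independent_span_bound[OF S(1) B(2)] B(1) S(2) by blast
  have bound: "card C \<le> card B" if "independent C" "C \<subseteq> W" for C
    using independent_span_bound[OF fin that(1) order_trans[OF that(2) B(3)]] by simp
  have injW: "inj_on T (span B)"
    unfolding p.linear_inj_on_iff_eq_0[OF T subspace_span]
  proof (intro ballI impI)
    fix x assume "x \<in> span B" "T x = 0"
    then show "x = 0" by (rule inj[unfolded WB])
  qed
  then have ind: "independent (T ` B)" and card: "card (T ` B) = card B"
    using p.linear_independent_injective_image[OF T B(2) injW] card_image[OF inj_on_subset[OF injW span_superset]]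
    by simp_all
  have "w \<in> span (T ` B)" if w: "w \<in> W" for w
  proof (rule ccontr)
    assume n: "w \<notin> span (T ` B)"
    then have "independent (insert w (T ` B))" using ind by (rule independent_insertI)
    moreover have "insert w (T ` B) \<subseteq> W" using w B(1) TW by auto
    ultimately have "card (insert w (T ` B)) \<le> card B" using bound by blast
    moreover have "w \<notin> T ` B" using n span_superset by blast
    ultimately show False using fin card by simp
  qed
  then show ?thesis using p.linear_span_image[OF T, of B] WB by auto
qed

lemma coeff_ip_cnj: "cnj (coeff_ip S d f g) = coeff_ip S d g f"
  by (simp add: coeff_ip_def level_ip_cnj)

lemma coeff_ip_add: "coeff_ip S d (f + g) h = coeff_ip S d f h + coeff_ip S d g h"
  by (simp add: coeff_ip_def level_ip_add sum.distrib)

lemma coeff_ip_self: "coeff_ip S d f f = of_real (\<Sum>I\<in>S. \<Sum>\<alpha>\<in>level d. (cmod (f I \<alpha>))\<^sup>2)"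
  by (simp add: coeff_ip_def level_ip_self del: of_real_power)

lemma coeff_ip_D1_fock_adj:
  assumes "valued (V1 k) h" "valued (V2 k) p" "k \<ge> 2"
  shows "coeff_ip (I1 k) d (D1_fock_adj p) h = coeff_ip (I2 k) (d - 1) p (D1_fock h)"
  using arg_cong[OF coeff_ip_D1_fock[OF assms, of d], of cnj] by (simp add: coeff_ip_cnj)

definition Box_fock :: "('n::finite, 'n idx1) coeffs \<Rightarrow> ('n, 'n idx1) coeffs" where
  "Box_fock f = D0_fock (D0_fock_adj f) + D1_fock_adj (D1_fock f)"

lemma V1_add: "valued (V1 k) f \<Longrightarrow> valued (V1 k) g \<Longrightarrow> valued (V1 k) (f + g)"
proof -
  assume f: "valued (V1 k) f" and g: "valued (V1 k) g"
  note fg = f[unfolded valued_V1] g[unfolded valued_V1]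
  show ?thesis
    unfolding valued_V1
  proof (intro conjI allI impI)
    fix A and As :: "primed list" assume "length As \<noteq> k - 1"
    then have "f (A, As) = 0" "g (A, As) = 0" using fg by blast+
    then show "(f + g) (A, As) = 0" by (simp only: plus_fun_apply add_0)
  next
    fix A and As Bs :: "primed list" assume m: "mset As = mset Bs"
    have "f (A, As) = f (A, Bs)" "g (A, As) = g (A, Bs)"
      by (rule fg(1)[THEN conjunct2, rule_format, OF m], rule fg(2)[THEN conjunct2, rule_format, OF m])
    then show "(f + g) (A, As) = (f + g) (A, Bs)" by (simp only: plus_fun_apply)
  qed
qed

lemma valued_map:
  assumes "valued (V1 k) f" "g 0 = 0" "\<And>I. h I = g (f I)"
  shows "valued (V1 k) h"
proof -
  note f = assms(1)[unfolded valued_V1]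
  show ?thesis unfolding valued_V1 assms(3)
  proof (intro conjI allI impI)
    fix A and As :: "primed list" assume "length As \<noteq> k - 1"
    with f have "f (A, As) = 0" by blast
    then show "g (f (A, As)) = 0" by (simp only: assms(2))
  next
    fix A and As Bs :: "primed list" assume m: "mset As = mset Bs"
    show "g (f (A, As)) = g (f (A, Bs))"
      by (intro arg_cong[where f = g] f[THEN conjunct2, rule_format] m)
  qed
qed

lemma V1_outside: "valued (V1 k) c \<Longrightarrow> I \<notin> I1 k \<Longrightarrow> c I \<alpha> = 0"
  unfolding valued_def V1_def by blast

lemma valued_Box_fock: "valued (V1 k) f \<Longrightarrow> k \<ge> 2 \<Longrightarrow> valued (V1 k) (Box_fock f)"
  unfolding Box_fock_def by (intro V1_add valued_D0_fock valued_D0_fock_adj valued_D1_fock_adj valued_D1_fock) auto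

lemma coeff_ip_Box_fock:
  assumes f: "valued (V1 k) f" and g: "valued (V1 k) g" and k: "k \<ge> 2"
  shows "coeff_ip (I1 k) d (Box_fock f) g = coeff_ip (I0 k) (d + 1) (D0_fock_adj f) (D0_fock_adj g) + coeff_ip (I2 k) (d - 1) (D1_fock f) (D1_fock g)"
proof -
  have k1: "k \<ge> 1" using k by simp
  show ?thesis
    using coeff_ip_D0_fock[OF valued_D0_fock_adj[OF f k1] g k1, of "d + 1"] coeff_ip_D1_fock_adj[OF g valued_D1_fock[OF f k] k, of d]
    by (simp add: Box_fock_def coeff_ip_add)
qed

lemma Box_fock_estimate:
  assumes "valued (V1 k) f" "k \<ge> 2"
  shows "4 * Re (coeff_ip (I1 k) d f f) \<le> Re (coeff_ip (I1 k) d (Box_fock f) f)"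
  using energy_estimate[OF assms] by (simp add: coeff_ip_Box_fock assms)

subsection \<open>Linearity\<close>

definition tuple_scale :: "complex \<Rightarrow> ('i \<Rightarrow> 'm \<Rightarrow> complex) \<Rightarrow> 'i \<Rightarrow> 'm \<Rightarrow> complex" where
  "tuple_scale s c = (\<lambda>I. cscale s (c I))"

lemma sym_cons_add: "sym_cons (\<lambda>x As. u x As + v x As) As = sym_cons u As + sym_cons v As"
  by (simp add: fun_eq_iff sym_cons_apply ring_distribs sum.distrib add_divide_distrib)

lemma sym_cons_cscale: "sym_cons (\<lambda>x As. cscale s (u x As)) As = cscale s (sym_cons u As)"
  by (simp add: fun_eq_iff sym_cons_apply cscale_def sum_distrib_left algebra_simps)

lemma Z_fock_adj_sum_add: "(\<Sum>A\<in>X. Z_fock_adj A A' (f A + g A)) = (\<Sum>A\<in>X. Z_fock_adj A A' (f A)) + (\<Sum>A\<in>X. Z_fock_adj A A' (g A))"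
  by (simp only: Z_fock_adj_add sum.distrib)

lemma Z_fock_adj_sum_cscale: "(\<Sum>A\<in>X. Z_fock_adj A A' (cscale s (f A))) = cscale s (\<Sum>A\<in>X. Z_fock_adj A A' (f A))"
  by (simp only: Z_fock_adj_cscale cscale_sum)

lemma D0_fock_adj_add: "D0_fock_adj (f + g) = D0_fock_adj f + D0_fock_adj g"
  by (rule ext) (simp only: D0_fock_adj_def plus_fun_apply Z_fock_adj_sum_add sym_cons_add)

lemma D0_fock_adj_scale: "D0_fock_adj (tuple_scale s f) = tuple_scale s (D0_fock_adj f)"
  by (rule ext) (simp only: D0_fock_adj_def tuple_scale_def Z_fock_adj_sum_cscale sym_cons_cscale)

lemma D1_fock_adj_add: "D1_fock_adj (f + g) = D1_fock_adj f + D1_fock_adj g"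
  by (rule ext, clarify) (simp only: D1_fock_adj_def plus_fun_apply Z_fock_adj_sum_add sym_cons_add case_prod_conv cscale_add)

lemma D1_fock_adj_scale: "D1_fock_adj (tuple_scale s f) = tuple_scale s (D1_fock_adj f)"
  by (rule ext, clarify) (simp only: D1_fock_adj_def tuple_scale_def Z_fock_adj_sum_cscale sym_cons_cscale case_prod_conv cscale_cscale mult.commute)

lemma D0_fock_add: "D0_fock (f + g) = D0_fock f + D0_fock g"
  by (rule ext, clarify) (simp only: D0_fock_def plus_fun_apply Z_fock_add sum.distrib case_prod_conv)

lemma D0_fock_scale: "D0_fock (tuple_scale s f) = tuple_scale s (D0_fock f)"
  by (rule ext, clarify) (simp only: D0_fock_def tuple_scale_def Z_fock_cscale cscale_sum case_prod_conv)

lemma D1_fock_add: "D1_fock (f + g) = D1_fock f + D1_fock g"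
  by (rule ext, clarify)
     (simp only: D1_fock_def plus_fun_apply Z_fock_add sum.distrib[symmetric] case_prod_conv add_diff_add)

lemma cscale_diff: "cscale s (a - b) = cscale s a - cscale s b"
  by (simp add: cscale_def fun_eq_iff algebra_simps)

lemma D1_fock_scale: "D1_fock (tuple_scale s f) = tuple_scale s (D1_fock f)"
  by (rule ext, clarify) (simp only: D1_fock_def tuple_scale_def Z_fock_cscale cscale_sum case_prod_conv cscale_diff)

lemma tuple_scale_add: "tuple_scale s (f + g) = tuple_scale s f + tuple_scale s g"
  by (simp add: tuple_scale_def cscale_def fun_eq_iff algebra_simps)

lemma Box_fock_add: "Box_fock (f + g) = Box_fock f + Box_fock g"
  by (simp only: Box_fock_def D0_fock_add D0_fock_adj_add D1_fock_add D1_fock_adj_add add.assoc add.left_commute)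

lemma Box_fock_scale: "Box_fock (tuple_scale s f) = tuple_scale s (Box_fock f)"
  by (simp only: Box_fock_def D0_fock_scale D0_fock_adj_scale D1_fock_scale D1_fock_adj_scale tuple_scale_add)

interpretation coeff_space: vector_space "tuple_scale :: complex \<Rightarrow> ('i \<Rightarrow> 'm \<Rightarrow> complex) \<Rightarrow> _"
  by unfold_locales (auto simp: tuple_scale_def cscale_def fun_eq_iff algebra_simps)

lemma linear_Box_fock: "Vector_Spaces.linear tuple_scale tuple_scale (Box_fock :: ('n::finite, 'n idx1) coeffs \<Rightarrow> _)"
  by unfold_locales (simp_all only: Box_fock_add Box_fock_scale)

subsection \<open>Restriction to a level\<close>

definition level_part :: "int \<Rightarrow> (('j::finite) multi \<Rightarrow> complex) \<Rightarrow> 'j multi \<Rightarrow> complex" where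
  "level_part d c \<alpha> = (if \<alpha> \<in> level d then c \<alpha> else 0)"

definition coeff_part :: "int \<Rightarrow> ('i \<Rightarrow> ('j::finite) multi \<Rightarrow> complex) \<Rightarrow> 'i \<Rightarrow> 'j multi \<Rightarrow> complex" where
  "coeff_part d f = (\<lambda>I. level_part d (f I))"

lemma annihilate_level_part: "annihilate j (level_part d c) = level_part (d - 1) (annihilate j c)"
  by (simp only: fun_eq_iff annihilate_def level_part_def upd_Suc_in_level) simp

lemma create_level_part: "create j (level_part d c) = level_part (d + 1) (create j c)"
proof
  fix \<alpha> :: "'a multi"
  show "create j (level_part d c) \<alpha> = level_part (d + 1) (create j c) \<alpha>"
  proof (cases "\<alpha> j")
    case (Suc n)
    then have "\<alpha>(j := \<alpha> j - 1) \<in> level d \<longleftrightarrow> \<alpha> \<in> level (d + 1)"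
      using upd_Suc_in_level[of "\<alpha>(j := \<alpha> j - 1)" j "d + 1"] by (simp add: fun_upd_idem)
    then show ?thesis by (simp only: create_def level_part_def) simp
  qed (simp add: create_def level_part_def)
qed

lemma Z_fock_level_part: "Z_fock A A' (level_part d c) = level_part (d - 1) (Z_fock A A' c)"
  by (simp add: fun_eq_iff Z_fock_apply annihilate_level_part) (simp add: level_part_def Z_fock_apply)

lemma Z_fock_adj_level_part: "Z_fock_adj A A' (level_part d c) = level_part (d + 1) (Z_fock_adj A A' c)"
  by (simp add: fun_eq_iff Z_fock_adj_apply create_level_part) (simp add: level_part_def Z_fock_adj_apply)

lemma level_part_sum: "(\<Sum>x\<in>X. level_part d (c x)) = level_part d (\<Sum>x\<in>X. c x)"
  by (simp add: fun_eq_iff level_part_def sum_fun_apply)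

lemma level_part_diff: "level_part d a - level_part d b = level_part d (a - b)"
  by (simp add: fun_eq_iff level_part_def)

lemma level_part_cscale: "cscale s (level_part d c) = level_part d (cscale s c)"
  by (simp add: fun_eq_iff level_part_def cscale_def)

lemma sym_cons_level_part: "sym_cons (\<lambda>x As. level_part d (w x As)) As = level_part d (sym_cons w As)"
  by (simp only: sym_cons_def level_part_cscale level_part_sum)

lemma D0_fock_coeff_part: "D0_fock (coeff_part d f) = coeff_part (d - 1) (D0_fock f)"
  by (rule ext, clarify) (simp only: D0_fock_def coeff_part_def Z_fock_level_part level_part_sum case_prod_conv)

lemma D1_fock_coeff_part: "D1_fock (coeff_part d f) = coeff_part (d - 1) (D1_fock f)"
  by (rule ext, clarify) (simp only: D1_fock_def coeff_part_def Z_fock_level_part level_part_sum level_part_diff case_prod_conv)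

lemma D0_fock_adj_coeff_part: "D0_fock_adj (coeff_part d f) = coeff_part (d + 1) (D0_fock_adj f)"
  by (rule ext) (simp only: D0_fock_adj_def coeff_part_def Z_fock_adj_level_part level_part_sum sym_cons_level_part)

lemma D1_fock_adj_coeff_part: "D1_fock_adj (coeff_part d f) = coeff_part (d + 1) (D1_fock_adj f)"
  by (rule ext, clarify) (simp only: D1_fock_adj_def coeff_part_def Z_fock_adj_level_part level_part_sum sym_cons_level_part level_part_cscale case_prod_conv)

lemma Box_fock_coeff_part: "Box_fock (coeff_part d f) = coeff_part d (Box_fock f)"
  by (simp add: Box_fock_def D0_fock_coeff_part D0_fock_adj_coeff_part D1_fock_coeff_part D1_fock_adj_coeff_part del: plus_fun_def)
     (simp add: coeff_part_def fun_eq_iff level_part_def)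

lemma level_part_zero: "level_part d 0 = 0"
  by (simp add: fun_eq_iff level_part_def)

lemma valued_coeff_part: "valued (V1 k) f \<Longrightarrow> valued (V1 k) (coeff_part d f)"
  by (rule valued_map[where g = "level_part d"]) (simp_all only: coeff_part_def level_part_zero)

lemma valued_tuple_scale: "valued (V1 k) f \<Longrightarrow> valued (V1 k) (tuple_scale s f)"
  by (rule valued_map[where g = "cscale s"]) (simp_all only: tuple_scale_def cscale_zero)

lemma valued_zero: "valued (V1 k) 0"
  unfolding valued_V1 zero_fun_apply by blast

lemma coeff_part_simps: "coeff_part d 0 = 0" "coeff_part d (f + g) = coeff_part d f + coeff_part d g"
    "coeff_part d (tuple_scale s f) = tuple_scale s (coeff_part d f)"
  by (auto simp: coeff_part_def level_part_def tuple_scale_def cscale_def fun_eq_iff)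

lemma coeff_ip_self_eq_0:
  assumes "finite S" "Re (coeff_ip S d f f) = 0" "I \<in> S" "\<alpha> \<in> level d"
  shows "f I \<alpha> = 0"
  using assms by (auto simp: coeff_ip_self sum_nonneg_eq_0_iff sum_nonneg simp del: of_real_sum of_real_power)

text \<open>
  The estimate makes the block injective, and finite dimension makes it surjective.
\<close>

lemma Box_fock_surj_level:
  fixes c :: "('n::finite, 'n idx1) coeffs"
  assumes c: "valued (V1 k) c" and k: "k \<ge> 2"
  shows "\<exists>u. valued (V1 k) u \<and> coeff_part d u = u \<and> Box_fock u = coeff_part d c"
proof -
  define W where "W = {u :: ('n, 'n idx1) coeffs. valued (V1 k) u \<and> coeff_part d u = u}"
  (* The unit vectors of the coefficient space of level d. *)
  define e :: "'n idx1 \<times> ('n \<times> 4) multi \<Rightarrow> ('n, 'n idx1) coeffs"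
    where "e = (\<lambda>(I, \<alpha>) J \<beta>. if J = I \<and> \<beta> = \<alpha> then 1 else 0)"
  have zero: "u I \<alpha> = 0" if "u \<in> W" "\<not> (I \<in> I1 k \<and> \<alpha> \<in> level d)" for u I \<alpha>
  proof (cases "\<alpha> \<in> level d")
    case True
    with that show ?thesis using V1_outside[of k u I] by (auto simp: W_def)
  next
    case False
    from that have "u I \<alpha> = coeff_part d u I \<alpha>" by (simp add: W_def)
    with False show ?thesis by (simp add: coeff_part_def level_part_def)
  qed
  have sub: "W \<subseteq> coeff_space.span (e ` (I1 k \<times> level d))"
  proof
    fix u assume u: "u \<in> W"
    have "u = (\<Sum>p\<in>I1 k \<times> level d. tuple_scale (u (fst p) (snd p)) (e p))"
    proof (intro ext)
      fix J \<beta>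
      have "(\<Sum>p\<in>I1 k \<times> level d. tuple_scale (u (fst p) (snd p)) (e p)) J \<beta>
          = (\<Sum>p\<in>I1 k \<times> level d. if p = (J, \<beta>) then u J \<beta> else 0)"
        unfolding sum_fun_apply by (intro sum.cong refl) (auto simp: tuple_scale_def cscale_def e_def split: prod.split if_splits)
      also have "\<dots> = u J \<beta>" using zero[OF u, of J \<beta>] by simp
      finally show "u J \<beta> = (\<Sum>p\<in>I1 k \<times> level d. tuple_scale (u (fst p) (snd p)) (e p)) J \<beta>" ..
    qed
    also have "\<dots> \<in> coeff_space.span (e ` (I1 k \<times> level d))"
      by (intro coeff_space.span_sum coeff_space.span_scale coeff_space.span_base) auto
    finally show "u \<in> coeff_space.span (e ` (I1 k \<times> level d))" .
  qed
  have subsp: "coeff_space.subspace W"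
    by (rule coeff_space.subspaceI) (simp_all only: W_def mem_Collect_eq coeff_part_simps valued_zero V1_add valued_tuple_scale simp_thms)
  have TW: "Box_fock ` W \<subseteq> W"
  proof (rule image_subsetI)
    fix u assume "u \<in> W"
    then show "Box_fock u \<in> W"
      using valued_Box_fock[of k u] k Box_fock_coeff_part[of d u] by (simp add: W_def)
  qed
  have inj: "u = 0" if u: "u \<in> W" and B: "Box_fock u = 0" for u
  proof (intro ext)
    fix I \<alpha>
    have v: "valued (V1 k) u" using u by (simp add: W_def)
    have "coeff_ip (I1 k) d (Box_fock u) u = 0" unfolding B by (simp add: coeff_ip_def)
    then have "Re (coeff_ip (I1 k) d u u) = 0"
      using Box_fock_estimate[OF v k, of d] coeff_ip_nonneg[of "I1 k" d u] by simp
    then show "u I \<alpha> = 0 I \<alpha>"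
      using coeff_ip_self_eq_0[OF finite_I1, of k d u I \<alpha>] zero[OF u, of I \<alpha>] by auto
  qed
  have "W \<subseteq> Box_fock ` W"
    by (rule coeff_space.injective_imp_surjective_on_finite_subspace[OF linear_Box_fock subsp _ sub TW inj]) auto
  moreover have "coeff_part d c \<in> W"
    using valued_coeff_part[OF c] by (auto simp: W_def coeff_part_def level_part_def fun_eq_iff)
  ultimately show ?thesis unfolding W_def by fastforce
qed

text \<open>
  The solutions of the single levels are glued together: each coefficient belongs to exactly one level, and the
  operator does not mix levels.
\<close>

lemma Box_fock_surj:
  fixes c :: "('n::finite, 'n idx1) coeffs"
  assumes c: "valued (V1 k) c" and k: "k \<ge> 2"
  shows "\<exists>u. valued (V1 k) u \<and> Box_fock u = c"
proof -
  obtain U where U: "\<And>d. valued (V1 k) (U d)" "\<And>d. coeff_part d (U d) = U d" "\<And>d. Box_fock (U d) = coeff_part d c"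
    using Box_fock_surj_level[OF c k] by metis
  define dg :: "('n \<times> 4) multi \<Rightarrow> int" where "dg = (\<lambda>\<alpha>. int (\<Sum>j\<in>UNIV. \<alpha> j))"
  have lv: "\<alpha> \<in> level d \<longleftrightarrow> d = dg \<alpha>" for \<alpha> d by (auto simp: level_def dg_def)
  define u where "u = (\<lambda>I \<alpha>. U (dg \<alpha>) I \<alpha>)"
  have ru: "coeff_part d u = U d" for d
    by (subst U(2)[symmetric]) (auto simp: coeff_part_def level_part_def u_def lv fun_eq_iff)
  have "valued (V1 k) u" using U(1) by (simp add: valued_def u_def)
  moreover have "Box_fock u = c"
  proof (intro ext)
    fix I \<alpha>
    have "Box_fock u I \<alpha> = coeff_part (dg \<alpha>) (Box_fock u) I \<alpha>" by (simp add: coeff_part_def level_part_def lv)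
    also have "\<dots> = coeff_part (dg \<alpha>) c I \<alpha>" by (simp only: Box_fock_coeff_part[symmetric] ru U(3))
    also have "\<dots> = c I \<alpha>" by (simp add: coeff_part_def level_part_def lv)
    finally show "Box_fock u I \<alpha> = c I \<alpha>" .
  qed
  ultimately show ?thesis by blast
qed

lemma Box_fock_inj:
  fixes u :: "('n::finite, 'n idx1) coeffs"
  assumes u: "valued (V1 k) u" and k: "k \<ge> 2" and B: "Box_fock u = 0"
  shows "u = 0"
proof (intro ext)
  fix I and \<alpha> :: "('n \<times> 4) multi"
  define d where "d = int (\<Sum>j\<in>UNIV. \<alpha> j)"
  have "coeff_ip (I1 k) d (Box_fock u) u = 0" unfolding B by (simp add: coeff_ip_def)
  then have "Re (coeff_ip (I1 k) d u u) = 0"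
    using Box_fock_estimate[OF u k, of d] coeff_ip_nonneg[of "I1 k" d u] by simp
  then have "u I \<alpha> = 0" if "I \<in> I1 k"
    using coeff_ip_self_eq_0[OF finite_I1 _ that, of d u \<alpha>] by (simp add: level_def d_def del: of_nat_sum)
  moreover have "u I \<alpha> = 0" if "I \<notin> I1 k" using V1_outside[OF u that] .
  ultimately show "u I \<alpha> = 0 I \<alpha>" by auto
qed

section \<open>Differential equations in terms of Hermite coefficients\<close>

definition hcoeff :: "('n::finite pt \<Rightarrow> complex) \<Rightarrow> ('n \<times> 4) multi \<Rightarrow> complex" where
  "hcoeff f \<alpha> = l2ip gauss f (\<lambda>x. complex_of_real (herm \<alpha> x))"

lemma hcoeff_eq: "hcoeff f \<alpha> = (\<integral>x. f x * of_real (herm \<alpha> x) \<partial>gauss)"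
  by (simp add: hcoeff_def l2ip_def)

lemma level_int: "level (int d) = {\<alpha>. (\<Sum>j\<in>UNIV. \<alpha> j) = d}"
  by (auto simp: level_def simp del: of_nat_sum)

lemma sqint_herm: "sqint gauss (\<lambda>x. complex_of_real (herm \<alpha> x))"
  by (intro sqint_polynomial real_polynomial_function_herm)

lemma hermite_onb:
  "graded_onb (gauss :: 'n::finite pt measure) (\<lambda>\<alpha> x. complex_of_real (herm \<alpha> x)) (\<lambda>\<alpha>. \<Sum>j\<in>UNIV. \<alpha> j)"
proof -
  interpret finite_measure "gauss :: 'n pt measure" by (rule finite_measure_gauss)
  show ?thesis
  proof
    show "sqint gauss (\<lambda>x. complex_of_real (herm \<alpha> x))" for \<alpha> :: "'n \<times> 4 \<Rightarrow> nat" by (rule sqint_herm)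
    show "l2ip gauss (\<lambda>x. complex_of_real (herm \<alpha> x)) (\<lambda>x. complex_of_real (herm \<beta> x)) = (if \<alpha> = \<beta> then 1 else 0)" for \<alpha> \<beta> :: "'n \<times> 4 \<Rightarrow> nat"
    proof -
      have "l2ip gauss (\<lambda>x. complex_of_real (herm \<alpha> x)) (\<lambda>x. complex_of_real (herm \<beta> x))
          = of_real (\<integral>x. herm \<alpha> x * herm \<beta> x \<partial>gauss)"
        unfolding l2ip_def by (simp flip: of_real_mult)
      then show ?thesis by (simp add: herm_orthonormal)
    qed
    show "finite {\<alpha> :: 'n \<times> 4 \<Rightarrow> nat. (\<Sum>j\<in>UNIV. \<alpha> j) = d}" for d
      using finite_level[of "int d"] by (simp add: level_int)
    show "AE x in gauss. f x = 0" if "sqint gauss f" "\<And>\<alpha>. l2ip gauss f (\<lambda>x. complex_of_real (herm \<alpha> x)) = 0"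
      for f :: "'n pt \<Rightarrow> complex"
      using that by (intro perp_polynomials_eq_0 perp_polynomialsI) (auto simp: l2ip_def)
  qed
qed

interpretation H: graded_onb "gauss :: 'n::finite pt measure" "\<lambda>\<alpha> x. complex_of_real (herm \<alpha> x)" "\<lambda>\<alpha>. \<Sum>j\<in>UNIV. \<alpha> j"
  by (rule hermite_onb)

lemma hcoeff_unique: "sqint gauss f \<Longrightarrow> sqint gauss g \<Longrightarrow> (\<And>\<alpha>. hcoeff f \<alpha> = hcoeff g \<alpha>) \<Longrightarrow> AE x in lborel. f x = g x"
  using H.coeff_unique[of f g] by (simp add: hcoeff_def AE_gauss)

lemma hcoeff_Parseval: "sqint gauss f \<Longrightarrow> sqint gauss g \<Longrightarrow> (\<lambda>d. level_ip (int d) (hcoeff f) (hcoeff g)) sums l2ip gauss f g"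
  using H.Parseval[of f g] by (simp add: level_ip_def level_int hcoeff_def)

lemma hcoeff_exists:
  assumes "summable (\<lambda>d. Re (level_ip (int d) c c))"
  shows "\<exists>f. sqint gauss f \<and> hcoeff f = c"
proof -
  have "summable (\<lambda>d. \<Sum>\<alpha> | (\<Sum>j\<in>UNIV. \<alpha> j) = d. (cmod (c \<alpha>))\<^sup>2)"
    using assms by (simp add: level_ip_self level_int del: of_real_sum of_real_power)
  then show ?thesis by (rule H.Riesz_Fischer) (auto simp: hcoeff_def fun_eq_iff)
qed

lemma integrable_compact_support:
  fixes f :: "'a::euclidean_space \<Rightarrow> 'b::{banach, second_countable_topology}"
  assumes "continuous_on UNIV f" "compact K" "\<And>x. x \<notin> K \<Longrightarrow> f x = 0"
  shows "integrable lborel f"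
proof -
  have "integrable lborel (\<lambda>x. indicator K x *\<^sub>R f x)"
    using assms by (intro borel_integrable_compact) (auto intro: continuous_on_subset)
  also have "(\<lambda>x. indicator K x *\<^sub>R f x) = f" using assms(3) by (auto simp: fun_eq_iff indicator_def)
  finally show ?thesis .
qed

lemma has_derivative_along:
  assumes "(f has_derivative f') (at x)"
  shows "((\<lambda>t. f (x + t *\<^sub>R v)) has_vector_derivative f' v) (at 0)"
proof -
  have "((\<lambda>t. f (x + t *\<^sub>R v)) has_derivative (\<lambda>t. f' (t *\<^sub>R v))) (at 0)"
    by (rule has_derivative_compose[of "\<lambda>t. x + t *\<^sub>R v" _ 0 UNIV f, simplified]) (auto intro!: derivative_eq_intros assms)
  then show ?thesis
    by (simp add: has_vector_derivative_def linear_scale[OF has_derivative_linear[OF assms]])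
qed

lemma directional_eq:
  assumes "f differentiable (at x)" "((\<lambda>t. f (x + t *\<^sub>R v)) has_vector_derivative D) (at 0)"
  shows "frechet_derivative f (at x) v = D"
  using has_derivative_along[OF assms(1)[unfolded frechet_derivative_works], of v] assms(2)
  by (rule vector_derivative_unique_at)

definition coord_deriv :: "'n::finite \<times> 4 \<Rightarrow> ('n pt \<Rightarrow> complex) \<Rightarrow> 'n pt \<Rightarrow> complex" where
  "coord_deriv j \<psi> x = partial (fst j) (snd j) \<psi> x"

lemma coord_deriv_eq: "coord_deriv j \<psi> x = frechet_derivative \<psi> (at x) (basis_vec j)"
  by (simp add: coord_deriv_def partial_def basis_vec_def)

lemma test_function_facts:
  assumes \<psi>: "\<psi> \<in> test_functions"
  obtains K where "compact K" "\<And>x. x \<notin> K \<Longrightarrow> \<psi> x = 0" "\<And>j x. x \<notin> K \<Longrightarrow> coord_deriv j \<psi> x = 0"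
    "continuous_on UNIV \<psi>" "\<And>j. continuous_on UNIV (coord_deriv j \<psi>)"
    "\<And>x. \<psi> differentiable (at x)"
proof -
  obtain K where K: "compact K" "\<And>x. x \<notin> K \<Longrightarrow> \<psi> x = 0" and sm: "smooth \<psi>"
    using \<psi> by (auto simp: test_functions_def)
  have c: "continuous_on UNIV f" if "smooth f" for f :: "'a pt \<Rightarrow> complex"
    using smooth_differentiable[OF that] by (auto intro!: continuous_at_imp_continuous_on differentiable_imp_continuous_within)
  have "coord_deriv j \<psi> x = 0" if x: "x \<notin> K" for j x
  proof -
    have "open (- K)" using K(1) by (simp add: compact_imp_closed open_Compl)
    then have "(\<psi> has_derivative (\<lambda>v. 0)) (at x)"
      by (rule has_derivative_transform_within_open[of "\<lambda>_. 0", rotated]) (use x K(2) in auto)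
    then show ?thesis by (simp add: coord_deriv_eq frechet_derivative_at[symmetric])
  qed
  moreover have "continuous_on UNIV (coord_deriv j \<psi>)" for j
    unfolding coord_deriv_eq[abs_def] by (intro c smooth_dirderiv sm)
  ultimately show thesis using that[OF K] c[OF sm] smooth_differentiable[OF sm] by blast
qed

lemma test_by_parts:
  assumes \<psi>: "\<psi> \<in> test_functions"
  shows "(\<integral>x. coord_deriv j \<psi> x * of_real (herm \<alpha> x) \<partial>lborel)
    = - (of_real (2 * sqrt (real (\<alpha> j))) * (\<integral>x. \<psi> x * of_real (herm (\<alpha>(j := \<alpha> j - 1)) x) \<partial>lborel))"
proof -
  obtain K where K: "compact K" "\<And>x. x \<notin> K \<Longrightarrow> \<psi> x = 0" "\<And>j x. x \<notin> K \<Longrightarrow> coord_deriv j \<psi> x = 0"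
    "continuous_on UNIV \<psi>" "\<And>j. continuous_on UNIV (coord_deriv j \<psi>)" "\<And>x. \<psi> differentiable (at x)"
    by (rule test_function_facts[OF \<psi>]) blast
  have hc: "continuous_on UNIV (herm \<beta>)" for \<beta> :: "('a \<times> 4) multi"
    using real_polynomial_function_herm[of \<beta>] by (simp add: continuous_on_polymonial_function real_polynomial_function_eq)
  let ?h = "\<lambda>x. complex_of_real (herm \<alpha> x)" and ?h' = "\<lambda>x. of_real (2 * sqrt (real (\<alpha> j))) * complex_of_real (herm (\<alpha>(j := \<alpha> j - 1)) x)"
  have i1: "integrable lborel (\<lambda>x. coord_deriv j \<psi> x * ?h x)"
    by (rule integrable_compact_support[OF _ K(1)]) (auto intro!: continuous_intros K(5) hc simp: K(3))
  have i2: "integrable lborel (\<lambda>x. \<psi> x * ?h' x)"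
    by (rule integrable_compact_support[OF _ K(1)]) (auto intro!: continuous_intros K(4) hc simp: K(2))
  have "(\<integral>x. \<psi> x * ?h' x + coord_deriv j \<psi> x * ?h x \<partial>lborel) = 0"
  proof (rule integral_directional_derivative_eq_0[where F = "\<lambda>x. \<psi> x * ?h x" and v = "basis_vec j"])
    fix x
    have "((\<lambda>t. \<psi> (x + t *\<^sub>R basis_vec j)) has_vector_derivative coord_deriv j \<psi> x) (at 0)"
      unfolding coord_deriv_eq using K(6)[of x] by (intro has_derivative_along) (simp add: frechet_derivative_works)
    moreover have "((\<lambda>t. ?h (x + t *\<^sub>R basis_vec j)) has_vector_derivative ?h' x) (at 0)"
      using bounded_linear.has_vector_derivative[OF bounded_linear_of_real
         herm_deriv[of \<alpha> x j, unfolded has_real_derivative_iff_has_vector_derivative]] by simp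
    ultimately show "((\<lambda>t. \<psi> (x + t *\<^sub>R basis_vec j) * ?h (x + t *\<^sub>R basis_vec j)) has_vector_derivative \<psi> x * ?h' x + coord_deriv j \<psi> x * ?h x) (at 0)"
      using has_vector_derivative_mult by fastforce
  next
    show "continuous_on UNIV (\<lambda>x. \<psi> x * ?h' x + coord_deriv j \<psi> x * ?h x)"
      by (intro continuous_intros K hc)
    show "integrable lborel (\<lambda>x. \<psi> x * ?h x)"
      by (rule integrable_compact_support[OF _ K(1)]) (auto intro!: continuous_intros K(4) hc simp: K(2))
    show "integrable lborel (\<lambda>x. \<psi> x * ?h' x + coord_deriv j \<psi> x * ?h x)" using i1 i2 by simp
  qed
  then have "(\<integral>x. \<psi> x * ?h' x \<partial>lborel) + (\<integral>x. coord_deriv j \<psi> x * ?h x \<partial>lborel) = 0" using i1 i2 by simp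
  then have "(\<integral>x. coord_deriv j \<psi> x * ?h x \<partial>lborel) = - (\<integral>x. \<psi> x * ?h' x \<partial>lborel)" by (simp add: add_eq_0_iff2)
  also have "(\<integral>x. \<psi> x * ?h' x \<partial>lborel) = (\<integral>x. of_real (2 * sqrt (real (\<alpha> j))) * (\<psi> x * of_real (herm (\<alpha>(j := \<alpha> j - 1)) x)) \<partial>lborel)"
    by (simp only: mult.left_commute)
  also have "\<dots> = of_real (2 * sqrt (real (\<alpha> j))) * (\<integral>x. \<psi> x * of_real (herm (\<alpha>(j := \<alpha> j - 1)) x) \<partial>lborel)"
    by (rule integral_mult_right_zero)
  finally show ?thesis .
qed

text \<open>
  Integration against \<open>\<psi>\<close> with respect to Lebesgue measure is the weighted inner product with
  \<open>gauss_lift \<psi>\<close>. In this way a test function is expanded into Hermite functions.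
\<close>

definition gauss_lift :: "('n::finite pt \<Rightarrow> complex) \<Rightarrow> 'n pt \<Rightarrow> complex" where
  "gauss_lift \<psi> x = cnj (\<psi> x) * of_real (exp (2 * (norm x)\<^sup>2))"

lemma sqint_gauss_lift:
  assumes "continuous_on UNIV \<psi>" "compact K" "\<And>x. x \<notin> K \<Longrightarrow> \<psi> x = 0"
  shows "sqint gauss (gauss_lift \<psi>)"
  unfolding sqint_gauss_iff
proof
  have c: "continuous_on UNIV (gauss_lift \<psi>)" unfolding gauss_lift_def by (intro continuous_intros assms)
  then show "gauss_lift \<psi> \<in> borel_measurable borel" by (rule borel_measurable_continuous_onI)
  show "integrable lborel (\<lambda>x. (cmod (gauss_lift \<psi> x))\<^sup>2 * exp (- 2 * (norm x)\<^sup>2))"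
    by (rule integrable_compact_support[OF _ assms(2)]) (auto intro!: continuous_intros assms(1) simp: gauss_lift_def assms(3))
qed

lemma l2ip_gauss_lift:
  assumes "g \<in> borel_measurable borel" "continuous_on UNIV \<psi>"
  shows "l2ip gauss g (gauss_lift \<psi>) = (\<integral>x. g x * \<psi> x \<partial>lborel)"
proof -
  have [measurable]: "g \<in> borel_measurable borel" "\<psi> \<in> borel_measurable borel"
    using assms by (auto intro: borel_measurable_continuous_onI)
  have e: "exp (- 2 * (norm x)\<^sup>2) *\<^sub>R (g x * cnj (gauss_lift \<psi> x)) = g x * \<psi> x" for x
  proof -
    have "complex_of_real (exp (- 2 * (norm x)\<^sup>2)) * of_real (exp (2 * (norm x)\<^sup>2)) = 1"
      unfolding of_real_mult[symmetric] exp_add[symmetric] by simp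
    then show ?thesis by (simp add: gauss_lift_def scaleR_conv_of_real mult_ac)
  qed
  have "l2ip gauss g (gauss_lift \<psi>) = (\<integral>x. exp (- 2 * (norm x)\<^sup>2) *\<^sub>R (g x * cnj (gauss_lift \<psi> x)) \<partial>lborel)"
    unfolding l2ip_def by (rule integral_gauss) (simp add: gauss_lift_def)
  then show ?thesis unfolding e .
qed

lemma hcoeff_gauss_lift:
  assumes "continuous_on UNIV \<psi>"
  shows "hcoeff (gauss_lift \<psi>) \<alpha> = cnj (\<integral>x. \<psi> x * of_real (herm \<alpha> x) \<partial>lborel)"
proof -
  have "hcoeff (gauss_lift \<psi>) \<alpha> = cnj (l2ip gauss (\<lambda>x. complex_of_real (herm \<alpha> x)) (gauss_lift \<psi>))"
    by (simp add: hcoeff_def l2ip_cnj)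
  also have "l2ip gauss (\<lambda>x. complex_of_real (herm \<alpha> x)) (gauss_lift \<psi>) = (\<integral>x. complex_of_real (herm \<alpha> x) * \<psi> x \<partial>lborel)"
    using sqintD[OF sqint_herm[of \<alpha>]] by (intro l2ip_gauss_lift assms) simp
  finally show ?thesis by (simp add: mult.commute)
qed

text \<open>
  Integration by parts: the transpose of \<open>\<partial>\<^sub>j\<close> acts on the expansion of a test function as minus the
  creation operator.
\<close>

lemma hcoeff_gauss_lift_coord_deriv: "\<psi> \<in> test_functions \<Longrightarrow> hcoeff (gauss_lift (coord_deriv j \<psi>)) = cscale (- 1) (create j (hcoeff (gauss_lift \<psi>)))"
proof
  fix \<alpha> assume \<psi>: "\<psi> \<in> test_functions"
  obtain K where K: "continuous_on UNIV \<psi>" "\<And>j. continuous_on UNIV (coord_deriv j \<psi>)"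
    by (rule test_function_facts[OF \<psi>]) blast
  show "hcoeff (gauss_lift (coord_deriv j \<psi>)) \<alpha> = cscale (- 1) (create j (hcoeff (gauss_lift \<psi>))) \<alpha>"
    unfolding hcoeff_gauss_lift[OF K(2)] test_by_parts[OF \<psi>] cscale_def create_def hcoeff_gauss_lift[OF K(1)] by simp
qed

lemma level_ip_neg [simp]: "d < 0 \<Longrightarrow> level_ip d a b = 0"
proof -
  assume "d < 0"
  then have "level d = ({} :: 'a multi set)"
    unfolding level_def by (auto simp del: of_nat_sum)
  then show ?thesis by (simp add: level_ip_def)
qed

text \<open>
  The equation \<open>g = \<Sum>\<^sub>j \<partial>\<^sub>j F\<^sub>j\<close> in the sense of distributions.
\<close>

definition weak_divergence :: "('n::finite pt \<Rightarrow> complex) \<Rightarrow> ('n \<times> 4 \<Rightarrow> 'n pt \<Rightarrow> complex) \<Rightarrow> bool" where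
  "weak_divergence g F \<longleftrightarrow> (\<forall>\<psi>\<in>test_functions. distr_of g \<psi> = (\<Sum>j\<in>UNIV. - distr_of (F j) (coord_deriv j \<psi>)))"

text \<open>
  By Parseval both sides are series over the degree. The terms of the right-hand side are those of the
  left-hand side, moved up by one degree. Only whole levels are compared, because the series for a single
  \<open>\<partial>\<^sub>j F\<^sub>j\<close> may diverge.
\<close>

lemma weak_divergenceI:
  fixes g :: "'n::finite pt \<Rightarrow> complex"
  assumes g: "sqint gauss g" and F: "\<And>j. sqint gauss (F j)"
    and eq: "hcoeff g = (\<Sum>j\<in>UNIV. annihilate j (hcoeff (F j)))"
  shows "weak_divergence g F"
  unfolding weak_divergence_def
proof
  fix \<psi> :: "'n pt \<Rightarrow> complex" assume \<psi>: "\<psi> \<in> test_functions"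
  obtain K where K: "compact K" "\<And>x. x \<notin> K \<Longrightarrow> \<psi> x = 0" "\<And>j x. x \<notin> K \<Longrightarrow> coord_deriv j \<psi> x = 0"
    "continuous_on UNIV \<psi>" "\<And>j. continuous_on UNIV (coord_deriv j \<psi>)" "\<And>x. \<psi> differentiable (at x)"
    by (rule test_function_facts[OF \<psi>]) blast
  have gm: "g \<in> borel_measurable borel" "\<And>j. F j \<in> borel_measurable borel"
    using sqintD[OF g] sqintD[OF F] by simp_all
  let ?W = "hcoeff (gauss_lift \<psi>)"
  have 1: "(\<lambda>d. level_ip (int d) (hcoeff g) ?W) sums distr_of g \<psi>"
    using hcoeff_Parseval[OF g sqint_gauss_lift[OF K(4) K(1,2)]] unfolding l2ip_gauss_lift[OF gm(1) K(4)] distr_of_def .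
  have "(\<lambda>d. - level_ip (int d) (hcoeff (F j)) (hcoeff (gauss_lift (coord_deriv j \<psi>)))) sums - distr_of (F j) (coord_deriv j \<psi>)" for j
    using hcoeff_Parseval[OF F sqint_gauss_lift[OF K(5) K(1,3)], of j] unfolding l2ip_gauss_lift[OF gm(2) K(5)] distr_of_def
    by (rule sums_minus)
  then have "(\<lambda>d. \<Sum>j\<in>UNIV. - level_ip (int d) (hcoeff (F j)) (hcoeff (gauss_lift (coord_deriv j \<psi>)))) sums (\<Sum>j\<in>UNIV. - distr_of (F j) (coord_deriv j \<psi>))"
    by (rule sums_sum)
  moreover have "(\<Sum>j\<in>UNIV. - level_ip (int d) (hcoeff (F j)) (hcoeff (gauss_lift (coord_deriv j \<psi>)))) = level_ip (int d - 1) (hcoeff g) ?W" for d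
    unfolding hcoeff_gauss_lift_coord_deriv[OF \<psi>] eq level_ip_sum_left level_ip_annihilate by (simp add: level_ip_cscale)
  ultimately have 2: "(\<lambda>d. level_ip (int d - 1) (hcoeff g) ?W) sums (\<Sum>j\<in>UNIV. - distr_of (F j) (coord_deriv j \<psi>))" by simp
  have "(\<lambda>d. level_ip (int d - 1) (hcoeff g) ?W) sums distr_of g \<psi>"
    by (rule sums_Suc_imp) (simp_all add: 1)
  then show "distr_of g \<psi> = (\<Sum>j\<in>UNIV. - distr_of (F j) (coord_deriv j \<psi>))" using 2 by (rule sums_unique2)
qed

text \<open>
  Test functions that approximate a multiple of \<open>herm \<alpha> * exp (-2 |x|\<^sup>2)\<close>; the latter reads off the coefficient
  of index \<open>\<alpha>\<close> of a distribution equation.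
\<close>

definition herm_test :: "nat \<Rightarrow> ('n::finite \<times> 4) multi \<Rightarrow> 'n pt \<Rightarrow> complex" where
  "herm_test m \<alpha> x = of_real (cutoff m x) * (of_real (herm \<alpha> x) * of_real (exp (- 2 * (norm x)\<^sup>2)))"

lemma herm_test_function: "herm_test m \<alpha> \<in> test_functions"
proof -
  have "smooth (\<lambda>x::'a pt. complex_of_real (exp (0 + (- 2) * (norm x)\<^sup>2)))"
    using smooth_radial(1)[where h = "\<lambda>_. exp"] DERIV_exp by blast
  then have "smooth (\<lambda>x::'a pt. complex_of_real (exp (- 2 * (norm x)\<^sup>2)))" by (simp only: add_0)
  then have "smooth (herm_test m \<alpha>)"
    unfolding herm_test_def[abs_def]
    by (intro smooth_mult[OF smooth_cutoff] smooth_mult[OF smooth_polynomial[OF real_polynomial_function_herm]])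
  moreover have "herm_test m \<alpha> x = 0" if "x \<notin> cball 0 (real (Suc m))" for x
    using cutoff_outside[of m x] that by (simp add: herm_test_def del: of_nat_Suc)
  ultimately show ?thesis unfolding test_functions_def by (auto intro!: exI[of _ "cball 0 (real (Suc m))"])
qed

lemma coord_deriv_herm_test:
  "coord_deriv j (herm_test m \<alpha>) x = of_real (exp (- 2 * (norm x)\<^sup>2)) *
     (of_real (cutoff_deriv m x * (coord j x * herm \<alpha> x))
      - of_real (2 * sqrt (real (Suc (\<alpha> j)))) * of_real (cutoff m x * herm (\<alpha>(j := Suc (\<alpha> j))) x))"
proof -
  let ?E = "\<lambda>x::'a pt. exp (- 2 * (norm x)\<^sup>2)"
  have hE: "((\<lambda>t. herm \<alpha> (x + t *\<^sub>R basis_vec j) * ?E (x + t *\<^sub>R basis_vec j)) has_real_derivative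
     2 * sqrt (real (\<alpha> j)) * herm (\<alpha>(j := \<alpha> j - 1)) x * ?E (x + 0 *\<^sub>R basis_vec j)
      + (- 4 * coord j x * ?E x) * herm \<alpha> (x + 0 *\<^sub>R basis_vec j)) (at 0)"
    by (intro DERIV_mult herm_deriv gauss_deriv)
  have "herm_test m \<alpha> differentiable (at x)"
    by (rule test_function_facts[OF herm_test_function]) blast
  moreover have "((\<lambda>t. herm_test m \<alpha> (x + t *\<^sub>R basis_vec j)) has_vector_derivative
     (of_real (cutoff m (x + 0 *\<^sub>R basis_vec j)) * of_real (2 * sqrt (real (\<alpha> j)) * herm (\<alpha>(j := \<alpha> j - 1)) x * ?E (x + 0 *\<^sub>R basis_vec j) + (- 4 * coord j x * ?E x) * herm \<alpha> (x + 0 *\<^sub>R basis_vec j))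
      + of_real (cutoff_deriv m x * (x \<bullet> basis_vec j)) * of_real (herm \<alpha> (x + 0 *\<^sub>R basis_vec j) * ?E (x + 0 *\<^sub>R basis_vec j)))) (at 0)"
    unfolding herm_test_def of_real_mult[symmetric, of "herm _ _"]
    by (intro has_vector_derivative_mult has_derivative_along[OF cutoff_has_derivative]
        bounded_linear.has_vector_derivative[OF bounded_linear_of_real]
        hE[unfolded has_real_derivative_iff_has_vector_derivative])
  ultimately have "coord_deriv j (herm_test m \<alpha>) x = of_real (cutoff m x) * of_real (2 * sqrt (real (\<alpha> j)) * herm (\<alpha>(j := \<alpha> j - 1)) x * ?E x + (- 4 * coord j x * ?E x) * herm \<alpha> x)
      + of_real (cutoff_deriv m x * (x \<bullet> basis_vec j)) * of_real (herm \<alpha> x * ?E x)"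
    unfolding coord_deriv_eq by (subst directional_eq) simp_all
  also have "2 * sqrt (real (\<alpha> j)) * herm (\<alpha>(j := \<alpha> j - 1)) x * ?E x + (- 4 * coord j x * ?E x) * herm \<alpha> x
      = - (2 * sqrt (real (Suc (\<alpha> j))) * herm (\<alpha>(j := Suc (\<alpha> j))) x * ?E x)"
  proof -
    have "(- 4 * coord j x * ?E x) * herm \<alpha> x = - ((4 * coord j x * herm \<alpha> x) * ?E x)" by simp
    then show ?thesis unfolding herm_rec by (simp add: distrib_right del: of_nat_Suc)
  qed
  also have "x \<bullet> basis_vec j = coord j x"
    by (simp add: inner_coord coord_basis_vec if_distrib[where f = "(*) _"] eq_commute cong: if_cong)
  finally show ?thesis by (simp add: algebra_simps fun_upd_def del: of_nat_Suc)
qed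

lemma continuous_bump: "continuous_on UNIV (bump n)"
  by (intro continuous_at_imp_continuous_on ballI DERIV_isCont[OF bump_deriv])

lemma cutoff_measurable [measurable]: "(cutoff m :: 'a::euclidean_space \<Rightarrow> real) \<in> borel_measurable borel"
proof -
  have "continuous_on UNIV (\<lambda>x::'a. bump 0 (1 + (- 1 / (real (Suc m))\<^sup>2) * (norm x)\<^sup>2))"
    by (rule continuous_on_compose2[OF continuous_bump]) (auto intro!: continuous_intros)
  then show ?thesis unfolding cutoff_def[abs_def] by (rule borel_measurable_continuous_onI)
qed

lemma cutoff_deriv_measurable [measurable]: "(cutoff_deriv m :: 'a::euclidean_space \<Rightarrow> real) \<in> borel_measurable borel"
proof -
  have "continuous_on UNIV (\<lambda>x::'a. bump (Suc 0) (1 + (- 1 / (real (Suc m))\<^sup>2) * (norm x)\<^sup>2) * (- 2 / (real (Suc m))\<^sup>2))"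
    by (intro continuous_on_mult_right continuous_on_compose2[OF continuous_bump]) (auto intro!: continuous_intros)
  then show ?thesis unfolding cutoff_deriv_def[abs_def] by (rule borel_measurable_continuous_onI)
qed

lemma cutoff_limit:
  assumes f: "sqint gauss f"
  shows "(\<lambda>m. \<integral>x. f x * of_real (cutoff m x * herm \<alpha> x) \<partial>gauss) \<longlonglongrightarrow> of_real (bump 0 1) * hcoeff f \<alpha>"
proof -
  have [measurable]: "f \<in> borel_measurable borel" using sqintD[OF f] by simp
  have [measurable]: "herm \<alpha> \<in> borel_measurable borel" by (intro real_polynomial_measurable real_polynomial_function_herm)
  have "(\<lambda>m. \<integral>x. f x * of_real (cutoff m x * herm \<alpha> x) \<partial>gauss) \<longlonglongrightarrow> (\<integral>x. f x * of_real (bump 0 1 * herm \<alpha> x) \<partial>gauss)"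
  proof (rule integral_dominated_convergence)
    show "integrable gauss (\<lambda>x. norm (f x * of_real (herm \<alpha> x)))"
      by (intro integrable_norm sqint_integrable_mult' f sqint_herm)
    show "AE x in gauss. (\<lambda>m. f x * of_real (cutoff m x * herm \<alpha> x)) \<longlonglongrightarrow> f x * of_real (bump 0 1 * herm \<alpha> x)"
      by (intro AE_I2 tendsto_intros cutoff_tendsto)
    show "AE x in gauss. norm (f x * of_real (cutoff m x * herm \<alpha> x)) \<le> norm (f x * of_real (herm \<alpha> x))" for m
      by (intro AE_I2) (simp add: norm_mult abs_mult mult_left_mono mult_left_le_one_le cutoff_bound)
  qed measurable
  also have "(\<integral>x. f x * of_real (bump 0 1 * herm \<alpha> x) \<partial>gauss) = of_real (bump 0 1) * hcoeff f \<alpha>"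
    unfolding hcoeff_eq of_real_mult mult.left_commute[of "f _"] by (rule integral_mult_right_zero)
  finally show ?thesis .
qed

lemma cutoff_deriv_le: "\<bar>cutoff_deriv m x\<bar> \<le> 4"
proof -
  have "(1::real) \<le> (real (Suc m))\<^sup>2" by simp
  then have "4 / (real (Suc m))\<^sup>2 \<le> 4" by (simp add: divide_le_eq)
  then show ?thesis using cutoff_deriv_bound[of m x] by linarith
qed

lemma cutoff_deriv_limit:
  assumes f: "sqint gauss f" and p: "real_polynomial_function p"
  shows "(\<lambda>m. \<integral>x. f x * of_real (cutoff_deriv m x * p x) \<partial>gauss) \<longlonglongrightarrow> 0"
proof -
  have [measurable]: "f \<in> borel_measurable borel" using sqintD[OF f] by simp
  have [measurable]: "p \<in> borel_measurable borel" by (intro real_polynomial_measurable p)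
  have "(\<lambda>m. \<integral>x. f x * of_real (cutoff_deriv m x * p x) \<partial>gauss) \<longlonglongrightarrow> (\<integral>x. f x * of_real (0 * p x) \<partial>gauss)"
  proof (rule integral_dominated_convergence)
    show "integrable gauss (\<lambda>x. 4 * norm (f x * of_real (p x)))"
      by (intro integrable_mult_right integrable_norm sqint_integrable_mult' f sqint_polynomial p)
    have "(\<lambda>m. cutoff_deriv m x) \<longlonglongrightarrow> 0" for x :: "'a pt"
    proof (rule Lim_null_comparison[OF always_eventually])
      show "\<forall>m. norm (cutoff_deriv m x) \<le> 4 / (real (Suc m))\<^sup>2" using cutoff_deriv_bound[of _ x] by simp
      show "(\<lambda>m. 4 / (real (Suc m))\<^sup>2) \<longlonglongrightarrow> 0" by real_asymp
    qed
    then show "AE x in gauss. (\<lambda>m. f x * of_real (cutoff_deriv m x * p x)) \<longlonglongrightarrow> f x * of_real (0 * p x)"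
      by (intro AE_I2 tendsto_intros)
    have "cmod (f x) * (\<bar>cutoff_deriv m x\<bar> * \<bar>p x\<bar>) \<le> cmod (f x) * (4 * \<bar>p x\<bar>)" for m x
      by (intro mult_left_mono mult_right_mono cutoff_deriv_le) auto
    then show "AE x in gauss. norm (f x * of_real (cutoff_deriv m x * p x)) \<le> 4 * norm (f x * of_real (p x))" for m
      by (intro AE_I2) (simp add: norm_mult abs_mult mult.left_commute)
  qed measurable
  then show ?thesis by simp
qed

text \<open>
  Apply the equation to \<open>herm_test m \<alpha>\<close> and let \<open>m\<close> tend to infinity: the terms in which the cut-off has been
  differentiated disappear, and the factor \<open>bump 0 1\<close> is common to all the others.
\<close>

lemma weak_divergenceD:
  fixes g :: "'n::finite pt \<Rightarrow> complex"
  assumes g: "sqint gauss g" and F: "\<And>j. sqint gauss (F j)" and w: "weak_divergence g F"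
  shows "hcoeff g = (\<Sum>j\<in>UNIV. annihilate j (hcoeff (F j)))"
proof
  fix \<alpha> :: "('n \<times> 4) multi"
  have gm: "g \<in> borel_measurable borel" "\<And>j. F j \<in> borel_measurable borel"
    using sqintD[OF g] sqintD[OF F] by simp_all
  note [measurable] = gm
  have hm [measurable]: "herm \<beta> \<in> borel_measurable borel" for \<beta> :: "('n \<times> 4) multi"
    by (intro real_polynomial_measurable real_polynomial_function_herm)
  have pj: "real_polynomial_function (\<lambda>x. coord j x * herm \<alpha> x)" for j
    by (intro real_polynomial_function.intros(4) real_polynomial_function.intros(1) bounded_linear_coord real_polynomial_function_herm)
  have pm [measurable]: "(\<lambda>x. coord j x * herm \<alpha> x) \<in> borel_measurable borel" for j
    by (intro real_polynomial_measurable pj)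
  define a where "a = (\<lambda>m (j::'n \<times> 4). \<integral>x. F j x * of_real (cutoff_deriv m x * (coord j x * herm \<alpha> x)) \<partial>gauss)"
  define b where "b = (\<lambda>m j. \<integral>x. F j x * of_real (cutoff m x * herm (\<alpha>(j := Suc (\<alpha> j))) x) \<partial>gauss)"
  have gd: "distr_of g (herm_test m \<alpha>) = (\<integral>x. g x * of_real (cutoff m x * herm \<alpha> x) \<partial>gauss)" for m
    unfolding distr_of_def by (subst integral_gauss) (auto simp: herm_test_def scaleR_conv_of_real mult_ac)
  have Fd: "distr_of (F j) (coord_deriv j (herm_test m \<alpha>)) = a m j - of_real (2 * sqrt (real (Suc (\<alpha> j)))) * b m j" for m j
  proof -
    let ?c = "complex_of_real (2 * sqrt (real (Suc (\<alpha> j))))"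
    let ?u = "\<lambda>x. complex_of_real (cutoff_deriv m x * (coord j x * herm \<alpha> x))"
    let ?v = "\<lambda>x. complex_of_real (cutoff m x * herm (\<alpha>(j := Suc (\<alpha> j))) x)"
    have u: "sqint gauss ?u"
      unfolding of_real_mult[of "cutoff_deriv _ _"]
      by (rule sqint_bounded_mult[OF sqint_polynomial[OF pj[of j]], where B = 4]) (simp_all add: cutoff_deriv_le)
    have v: "sqint gauss ?v"
      unfolding of_real_mult[of "cutoff _ _"]
      by (rule sqint_bounded_mult[OF sqint_herm, where B = 1]) (simp_all add: cutoff_bound)
    note i = sqint_integrable_mult'[OF F[of j] u] sqint_integrable_mult'[OF F[of j] v]
    have "distr_of (F j) (coord_deriv j (herm_test m \<alpha>)) = (\<integral>x. exp (- 2 * (norm x)\<^sup>2) *\<^sub>R (F j x * ?u x - ?c * (F j x * ?v x)) \<partial>lborel)"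
      unfolding distr_of_def coord_deriv_herm_test
      by (intro Bochner_Integration.integral_cong refl) (simp add: scaleR_conv_of_real algebra_simps del: of_nat_Suc)
    also have "\<dots> = (\<integral>x. F j x * ?u x - ?c * (F j x * ?v x) \<partial>gauss)"
      by (rule integral_gauss[symmetric]) measurable
    also have "\<dots> = (\<integral>x. F j x * ?u x \<partial>gauss) - (\<integral>x. ?c * (F j x * ?v x) \<partial>gauss)"
      by (intro Bochner_Integration.integral_diff integrable_mult_right i)
    also have "(\<integral>x. ?c * (F j x * ?v x) \<partial>gauss) = ?c * b m j"
      unfolding b_def by (rule integral_mult_right_zero)
    finally show ?thesis by (simp only: a_def)
  qed
  have "(\<lambda>m. \<Sum>j\<in>UNIV. - (a m j - of_real (2 * sqrt (real (Suc (\<alpha> j)))) * b m j))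
     \<longlonglongrightarrow> (\<Sum>j\<in>UNIV. - (0 - of_real (2 * sqrt (real (Suc (\<alpha> j)))) * (of_real (bump 0 1) * hcoeff (F j) (\<alpha>(j := Suc (\<alpha> j))))))"
    unfolding a_def b_def by (intro tendsto_intros cutoff_limit cutoff_deriv_limit F pj)
  moreover have "(\<Sum>j\<in>UNIV. - (a m j - of_real (2 * sqrt (real (Suc (\<alpha> j)))) * b m j)) = distr_of g (herm_test m \<alpha>)" for m
    using w herm_test_function[of m \<alpha>] unfolding weak_divergence_def Fd[symmetric] by simp
  ultimately have "(\<lambda>m. distr_of g (herm_test m \<alpha>))
     \<longlonglongrightarrow> (\<Sum>j\<in>UNIV. - (0 - of_real (2 * sqrt (real (Suc (\<alpha> j)))) * (of_real (bump 0 1) * hcoeff (F j) (\<alpha>(j := Suc (\<alpha> j))))))"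
    by simp
  moreover have "(\<lambda>m. distr_of g (herm_test m \<alpha>)) \<longlonglongrightarrow> of_real (bump 0 1) * hcoeff g \<alpha>"
    unfolding gd by (rule cutoff_limit[OF g])
  ultimately have "of_real (bump 0 1) * hcoeff g \<alpha> = (\<Sum>j\<in>UNIV. - (0 - of_real (2 * sqrt (real (Suc (\<alpha> j)))) * (of_real (bump 0 1) * hcoeff (F j) (\<alpha>(j := Suc (\<alpha> j))))))"
    by (intro LIMSEQ_unique)
  also have "\<dots> = of_real (bump 0 1) * (\<Sum>j\<in>UNIV. annihilate j (hcoeff (F j))) \<alpha>"
    by (simp add: sum_fun_apply annihilate_def sum_distrib_left mult.left_commute del: of_nat_Suc)
  finally show "hcoeff g \<alpha> = (\<Sum>j\<in>UNIV. annihilate j (hcoeff (F j))) \<alpha>"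
    using bump_0(4)[of 1] by simp
qed

lemma weak_divergence_iff:
  assumes "sqint gauss g" "\<And>j. sqint gauss (F j)"
  shows "weak_divergence g F \<longleftrightarrow> hcoeff g = (\<Sum>j\<in>UNIV. annihilate j (hcoeff (F j)))"
  using assms weak_divergenceI weak_divergenceD by blast

section \<open>Fields and their coefficients\<close>

abbreviation (input) sqnorm :: "'n::finite pt \<Rightarrow> real" where
  "sqnorm \<equiv> (\<lambda>x. (norm x)\<^sup>2)"

definition field_coeff :: "('n::finite pt \<Rightarrow> 'i \<Rightarrow> complex) \<Rightarrow> ('n, 'i) coeffs" where
  "field_coeff f I = hcoeff (\<lambda>x. f x I)"

lemma L2_iff: "f \<in> L2 sqnorm V \<longleftrightarrow> (\<forall>x. f x \<in> V) \<and> (\<forall>I. sqint gauss (\<lambda>x. f x I))"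
  by (auto simp: L2_def sqint_gauss_iff)

lemma sqint_L2: "f \<in> L2 sqnorm V \<Longrightarrow> sqint gauss (\<lambda>x. f x I)"
  by (simp add: L2_iff)

lemma ip_gauss:
  assumes f: "f \<in> L2 sqnorm V" and g: "g \<in> L2 sqnorm V"
  shows "ip sqnorm S f g = (\<Sum>I\<in>S. l2ip gauss (\<lambda>x. f x I) (\<lambda>x. g x I))"
proof -
  have i: "integrable gauss (\<lambda>x. f x I * cnj (g x I))" for I
    by (intro sqint_integrable_mult sqint_L2[OF f] sqint_L2[OF g])
  then have m: "(\<lambda>x. f x I * cnj (g x I)) \<in> borel_measurable borel" for I
    using borel_measurable_integrable[OF i] by simp
  have "ip sqnorm S f g = (\<integral>x. exp (- 2 * (norm x)\<^sup>2) *\<^sub>R (\<Sum>I\<in>S. f x I * cnj (g x I)) \<partial>lborel)"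
    unfolding ip_def by (simp add: scaleR_conv_of_real mult.commute)
  also have "\<dots> = (\<integral>x. (\<Sum>I\<in>S. f x I * cnj (g x I)) \<partial>gauss)"
    by (rule integral_gauss[symmetric]) (intro borel_measurable_sum m)
  also have "\<dots> = (\<Sum>I\<in>S. l2ip gauss (\<lambda>x. f x I) (\<lambda>x. g x I))"
    unfolding l2ip_def by (rule Bochner_Integration.integral_sum[OF i])
  finally show ?thesis .
qed

lemma ip_sums:
  assumes f: "f \<in> L2 sqnorm V" and g: "g \<in> L2 sqnorm V"
  shows "(\<lambda>d. coeff_ip S (int d) (field_coeff f) (field_coeff g)) sums ip sqnorm S f g"
  unfolding ip_gauss[OF f g] coeff_ip_def field_coeff_def
  by (intro sums_sum hcoeff_Parseval sqint_L2[OF f] sqint_L2[OF g])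

lemma hcoeff_zero: "hcoeff (\<lambda>x. 0) = 0"
  by (simp add: fun_eq_iff hcoeff_eq)

lemma hcoeff_neg: "hcoeff (cscale (- 1) h) \<alpha> = - hcoeff h \<alpha>"
  by (simp add: hcoeff_eq cscale_def)

lemma hcoeff_add: "sqint gauss f \<Longrightarrow> sqint gauss g \<Longrightarrow> hcoeff (\<lambda>x. f x + g x) = hcoeff f + hcoeff g"
  by (simp add: fun_eq_iff hcoeff_def l2ip_add sqint_herm)

lemma hcoeff_cmult: "hcoeff (\<lambda>x. c * f x) = cscale c (hcoeff f)"
  by (simp add: fun_eq_iff hcoeff_def l2ip_cmult cscale_def)

lemma hcoeff_sum: "(\<And>i. i \<in> X \<Longrightarrow> sqint gauss (f i)) \<Longrightarrow> hcoeff (\<lambda>x. \<Sum>i\<in>X. f i x) = (\<Sum>i\<in>X. hcoeff (f i))"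
  by (simp add: fun_eq_iff hcoeff_def l2ip_sum sqint_herm sum_fun_apply)

text \<open>
  A function with prescribed coefficients. The fields have to satisfy their symmetry relations at every
  point, not only almost everywhere. Choosing the function from the coefficients alone preserves equality of
  components; making the choice odd also preserves antisymmetry, and it gives the zero function for zero
  coefficients.
\<close>

definition odd_rep :: "(('n::finite \<times> 4) multi \<Rightarrow> complex) \<Rightarrow> 'n pt \<Rightarrow> complex" where
  "odd_rep c x = ((SOME f. sqint gauss f \<and> hcoeff f = c) x - (SOME f. sqint gauss f \<and> hcoeff f = cscale (- 1) c) x) / 2"

lemma odd_rep_zero: "odd_rep 0 x = 0"
  by (simp add: odd_rep_def)

lemma odd_rep_neg: "odd_rep (cscale (- 1) c) x = - odd_rep c x"
  by (simp add: odd_rep_def field_simps)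

lemma odd_rep:
  assumes c: "summable (\<lambda>d. Re (level_ip (int d) c c))"
  shows "sqint gauss (odd_rep c)" "hcoeff (odd_rep c) = c"
proof -
  have c': "summable (\<lambda>d. Re (level_ip (int d) (cscale (- 1) c) (cscale (- 1) c)))" using c by (simp add: level_ip_cscale)
  define f where "f = (SOME f. sqint gauss f \<and> hcoeff f = c)"
  define g where "g = (SOME f. sqint gauss f \<and> hcoeff f = cscale (- 1) c)"
  have f: "sqint gauss f" "hcoeff f = c" unfolding f_def using someI_ex[OF hcoeff_exists[OF c]] by auto
  have g: "sqint gauss g" "hcoeff g = cscale (- 1) c" unfolding g_def using someI_ex[OF hcoeff_exists[OF c']] by auto
  have odd_rep: "odd_rep c = (\<lambda>x. (1/2) * f x + (- 1/2) * g x)" by (simp add: odd_rep_def f_def g_def fun_eq_iff field_simps)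
  show "sqint gauss (odd_rep c)" unfolding odd_rep by (intro sqint_add sqint_cmult f g)
  have "hcoeff (odd_rep c) = cscale (1/2) c + cscale (- 1/2) (cscale (- 1) c)"
    unfolding odd_rep by (simp only: hcoeff_add hcoeff_cmult sqint_cmult f g)
  then show "hcoeff (odd_rep c) = c" by (simp add: cscale_def fun_eq_iff)
qed

text \<open>
  The three spaces of tuples are cut out by vanishing off \<open>S\<close>, by equalities between the components in
  \<open>E\<close>, and by changes of sign between the components in \<open>N\<close>. Such relations pass through every odd map that is applied
  to the components.
\<close>

locale tuple_space =
  fixes V :: "('i \<Rightarrow> complex) set" and S :: "'i set" and E N :: "('i \<times> 'i) set"
  assumes finite_S: "finite S"
    and mem_V: "v \<in> V \<longleftrightarrow> (\<forall>I. I \<notin> S \<longrightarrow> v I = 0) \<and> (\<forall>(I, J)\<in>E. v I = v J) \<and> (\<forall>(I, J)\<in>N. v I = - v J)"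
begin

lemma support: "v \<in> V \<Longrightarrow> I \<notin> S \<Longrightarrow> v I = 0"
  unfolding mem_V by blast

lemma lincomb: "v \<in> V \<Longrightarrow> w \<in> V \<Longrightarrow> (\<lambda>I. a * v I + b * w I) \<in> V"
  unfolding mem_V by (simp add: case_prod_beta)

lemma valued_iff: "valued V c \<longleftrightarrow>
    (\<forall>I. I \<notin> S \<longrightarrow> c I = 0) \<and> (\<forall>(I, J)\<in>E. c I = c J) \<and> (\<forall>(I, J)\<in>N. c I = cscale (- 1) (c J))"
  unfolding valued_def mem_V fun_eq_iff zero_fun_apply cscale_def mult_minus1 by blast

lemma odd_image:
  assumes "valued V c" "r 0 = 0" "\<And>h. r (cscale (- 1) h) = - r h"
  shows "(\<lambda>I. r (c I)) \<in> V"
proof -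
  note c = assms(1)[unfolded valued_iff]
  show ?thesis unfolding mem_V
  proof (intro conjI allI impI ballI; clarify?)
    fix I assume "I \<notin> S"
    then have "c I = 0" using c by blast
    then show "r (c I) = 0" by (simp only: assms(2))
  next
    fix I J assume "(I, J) \<in> E"
    then have "c I = c J" using c by blast
    then show "r (c I) = r (c J)" by (simp only:)
  next
    fix I J assume "(I, J) \<in> N"
    then have "c I = cscale (- 1) (c J)" using c by blast
    then show "r (c I) = - r (c J)" by (simp only: assms(3))
  qed
qed

lemma valued_field_coeff:
  fixes f :: "'n::finite pt \<Rightarrow> 'i \<Rightarrow> complex"
  assumes "f \<in> L2 sqnorm V"
  shows "valued V (field_coeff f)"
  unfolding valued_def field_coeff_def
proof
  fix \<alpha> :: "('n \<times> 4) multi"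
  show "(\<lambda>I. hcoeff (\<lambda>x. f x I) \<alpha>) \<in> V"
    using assms by (intro odd_image[of "\<lambda>I x. f x I" "\<lambda>h. hcoeff h \<alpha>"]) (simp_all add: L2_iff valued_def hcoeff_neg hcoeff_zero[folded zero_fun_def])
qed

lemma valued_coeff_part: "valued V c \<Longrightarrow> valued V (coeff_part d c)"
proof -
  assume c: "valued V c"
  show ?thesis unfolding valued_def coeff_part_def
  proof
    fix \<alpha> show "(\<lambda>I. level_part d (c I) \<alpha>) \<in> V"
      by (rule odd_image[OF c, of "\<lambda>h. level_part d h \<alpha>"]) (simp_all add: level_part_def cscale_def)
  qed
qed

lemma valued_diff: "valued V c \<Longrightarrow> valued V c' \<Longrightarrow> valued V (c - c')"
  unfolding valued_def mem_V minus_fun_apply' by (simp add: case_prod_beta)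

lemma valued_support: "valued V c \<Longrightarrow> I \<notin> S \<Longrightarrow> c I = 0"
  unfolding valued_iff by blast

lemma field_coeff_unique:
  fixes f g :: "'n::finite pt \<Rightarrow> 'i \<Rightarrow> complex"
  assumes f: "f \<in> L2 sqnorm V" and g: "g \<in> L2 sqnorm V" and eq: "field_coeff f = field_coeff g"
  shows "ae_eq f g"
proof -
  have "AE x in lborel. f x I = g x I" for I
    using eq by (intro hcoeff_unique sqint_L2[OF f] sqint_L2[OF g]) (simp add: field_coeff_def fun_eq_iff)
  then have "AE x in lborel. \<forall>I\<in>S. f x I = g x I"
    using finite_S by (intro AE_finite_allI) auto
  then show ?thesis unfolding ae_eq_def
  proof eventually_elim
    case (elim x)
    show ?case
    proof
      fix I show "f x I = g x I"
        using elim f g support[of "f x" I] support[of "g x" I] by (cases "I \<in> S") (auto simp: L2_iff)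
    qed
  qed
qed

lemma field_coeff_exists:
  fixes c :: "('n::finite, 'i) coeffs"
  assumes c: "valued V c" and sm: "summable (\<lambda>d. Re (coeff_ip S (int d) c c))"
  shows "\<exists>f\<in>L2 sqnorm V. field_coeff f = c"
proof -
  have s: "summable (\<lambda>d. Re (level_ip (int d) (c I) (c I)))" for I
  proof (cases "I \<in> S")
    case True
    show ?thesis
    proof (rule summable_comparison_test'[OF sm])
      fix d
      show "norm (Re (level_ip (int d) (c I) (c I))) \<le> Re (coeff_ip S (int d) c c)"
        using member_le_sum[OF True, of "\<lambda>I. Re (level_ip (int d) (c I) (c I))"] finite_S
        by (simp add: coeff_ip_def level_ip_self_nonneg)
    qed
  next
    case False
    then have "c I = 0" by (rule valued_support[OF c])
    then show ?thesis by (simp only: level_ip_zero) simp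
  qed
  define f where "f = (\<lambda>x I. odd_rep (c I) x)"
  have "f x \<in> V" for x
    unfolding f_def by (rule odd_image[OF c, of "\<lambda>h. odd_rep h x"]) (simp_all add: odd_rep_zero odd_rep_neg del: zero_fun_def)
  then have "f \<in> L2 sqnorm V" by (simp add: L2_iff f_def odd_rep s)
  moreover have "field_coeff f = c" by (simp add: fun_eq_iff field_coeff_def f_def odd_rep s)
  ultimately show ?thesis by blast
qed

end

lemma field_coeff_cong:
  assumes "f \<in> L2 sqnorm V" "g \<in> L2 sqnorm V'" "ae_eq f g"
  shows "field_coeff f = field_coeff g"
proof
  fix I
  have "AE x in gauss. f x I = g x I"
    using assms(3) unfolding ae_eq_def AE_gauss by eventually_elim simp
  then show "field_coeff f I = field_coeff g I"
    using l2ip_cong_AE[OF sqint_L2[OF assms(1)] sqint_L2[OF assms(2)] sqint_herm]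
    by (auto simp: field_coeff_def hcoeff_def fun_eq_iff)
qed

lemma tuple_space_V0: "tuple_space (V0 k) (I0 k) {(As, Bs). mset As = mset Bs} {}"
  by unfold_locales (simp, simp only: V0_def mem_Collect_eq, blast)

lemma tuple_space_V1:
  "tuple_space (V1 k) (I1 k :: 'n::finite idx1 set) {((A, As), (A', Bs)). A = A' \<and> mset As = mset Bs} {}"
  by unfold_locales (simp, simp only: V1_def mem_Collect_eq, blast)

lemma tuple_space_V2:
  "tuple_space (V2 k) (I2 k :: 'n::finite idx2 set) {((A, B, As), (A', B', Bs)). A = A' \<and> B = B' \<and> mset As = mset Bs}
     {((A, B, As), (B', A', Bs)). A = A' \<and> B = B' \<and> As = Bs}"
  by unfold_locales (simp, simp only: V2_def mem_Collect_eq, blast)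

interpretation F0: tuple_space "V0 k" "I0 k" "{(As, Bs). mset As = mset Bs}" "{}" for k
  by (rule tuple_space_V0)
interpretation F1: tuple_space "V1 k" "I1 k :: 'n::finite idx1 set" "{((A, As), (A', Bs)). A = A' \<and> mset As = mset Bs}" "{}" for k
  by (rule tuple_space_V1)
interpretation F2: tuple_space "V2 k" "I2 k :: 'n::finite idx2 set" "{((A, B, As), (A', B', Bs)). A = A' \<and> B = B' \<and> mset As = mset Bs}"
     "{((A, B, As), (B', A', Bs)). A = A' \<and> B = B' \<and> As = Bs}" for k
  by (rule tuple_space_V2)

section \<open>The operators in terms of coefficients\<close>

lemma Z_up_coord_deriv: "Z_up A A' \<psi> x = (\<Sum>j\<in>UNIV. \<zeta> A A' j * coord_deriv j \<psi> x)"
proof -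
  have *: "(1::4) \<noteq> 2" "(1::4) \<noteq> 3" "(1::4) \<noteq> 4" "(2::4) \<noteq> 3" "(2::4) \<noteq> 4" "(3::4) \<noteq> 4"
    "(2::4) \<noteq> 1" "(3::4) \<noteq> 1" "(4::4) \<noteq> 1" "(3::4) \<noteq> 2" "(4::4) \<noteq> 2" "(4::4) \<noteq> 3"
    by simp_all
  have "(\<Sum>j\<in>UNIV. \<zeta> A A' j * coord_deriv j \<psi> x) = (\<Sum>l\<in>UNIV. if l = fst A then Z_up A A' \<psi> x else 0)"
    unfolding sum_prod_4
    using two_cases[of "snd A"] two_cases[of A']
    by (intro sum.cong refl) (auto simp: \<zeta>_def Z_up_def Z_def coord_deriv_def * Let_def)
  then show ?thesis by simp
qed

lemma integrable_test:
  assumes f: "sqint gauss f" and \<psi>: "\<psi> \<in> test_functions"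
  shows "integrable lborel (\<lambda>x. f x * coord_deriv j \<psi> x)"
proof -
  obtain K where K: "compact K" "\<And>x. x \<notin> K \<Longrightarrow> coord_deriv j \<psi> x = 0" "continuous_on UNIV (coord_deriv j \<psi>)"
    by (rule test_function_facts[OF \<psi>]) blast
  have s: "sqint gauss (gauss_lift (coord_deriv j \<psi>))" by (rule sqint_gauss_lift[OF K(3,1,2)])
  have m: "(\<lambda>x. f x * cnj (gauss_lift (coord_deriv j \<psi>) x)) \<in> borel_measurable borel"
    using borel_measurable_integrable[OF sqint_integrable_mult[OF f s]] by simp
  have "integrable lborel (\<lambda>x. exp (- 2 * (norm x)\<^sup>2) *\<^sub>R (f x * cnj (gauss_lift (coord_deriv j \<psi>) x)))"
    using sqint_integrable_mult[OF f s] integrable_gauss[OF m] by simp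
  also have "(\<lambda>x. exp (- 2 * (norm x)\<^sup>2) *\<^sub>R (f x * cnj (gauss_lift (coord_deriv j \<psi>) x))) = (\<lambda>x. f x * coord_deriv j \<psi> x)"
  proof
    fix x :: "'a pt"
    have "complex_of_real (exp (- 2 * (norm x)\<^sup>2)) * of_real (exp (2 * (norm x)\<^sup>2)) = 1"
      unfolding of_real_mult[symmetric] exp_add[symmetric] by simp
    then show "exp (- 2 * (norm x)\<^sup>2) *\<^sub>R (f x * cnj (gauss_lift (coord_deriv j \<psi>) x)) = f x * coord_deriv j \<psi> x"
      by (simp add: gauss_lift_def scaleR_conv_of_real mult_ac)
  qed
  finally show ?thesis .
qed

text \<open>
  A system in the fields \<open>Z\<^sub>A\<^bsup>A'\<^esup>\<close> is a divergence equation whose flux collects the coefficients of each coordinate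
  derivative. Both operators of the complex are of this form.
\<close>

lemma Z_system_iff:
  fixes g :: "'n::finite pt \<Rightarrow> complex" and X :: "'x set"
  assumes X: "finite X" and g: "sqint gauss g" and u: "\<And>i. i \<in> X \<Longrightarrow> sqint gauss (u i)"
  shows "(\<forall>\<psi>\<in>test_functions. distr_of g \<psi> = (\<Sum>i\<in>X. s i * Z_up_distr (a i) (b i) (distr_of (u i)) \<psi>))
    \<longleftrightarrow> hcoeff g = (\<Sum>i\<in>X. cscale (s i) (Z_fock (a i) (b i) (hcoeff (u i))))"
proof -
  define F where "F = (\<lambda>j x. \<Sum>i\<in>X. (s i * \<zeta> (a i) (b i) j) * u i x)"
  have F: "sqint gauss (F j)" for j unfolding F_def by (intro sqint_sum sqint_cmult u)
  have "(\<Sum>j\<in>UNIV. - distr_of (F j) (coord_deriv j \<psi>)) = (\<Sum>i\<in>X. s i * Z_up_distr (a i) (b i) (distr_of (u i)) \<psi>)"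
    if \<psi>: "\<psi> \<in> test_functions" for \<psi>
  proof -
    have "distr_of (F j) (coord_deriv j \<psi>) = (\<Sum>i\<in>X. (s i * \<zeta> (a i) (b i) j) * distr_of (u i) (coord_deriv j \<psi>))" for j
      unfolding distr_of_def F_def sum_distrib_right mult.assoc[of "s _ * _"]
      by (subst Bochner_Integration.integral_sum) (auto intro!: integrable_mult_right integrable_test u \<psi>)
    then have "(\<Sum>j\<in>UNIV. - distr_of (F j) (coord_deriv j \<psi>)) = (\<Sum>i\<in>X. \<Sum>j\<in>UNIV. - ((s i * \<zeta> (a i) (b i) j) * distr_of (u i) (coord_deriv j \<psi>)))"
      by (simp add: sum_negf[symmetric] del: sum_negf) (rule sum.swap)
    also have "\<dots> = (\<Sum>i\<in>X. s i * Z_up_distr (a i) (b i) (distr_of (u i)) \<psi>)"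
    proof (rule sum.cong[OF refl])
      fix i assume i: "i \<in> X"
      have "distr_of (u i) (Z_up (a i) (b i) \<psi>) = (\<integral>x. (\<Sum>j\<in>UNIV. \<zeta> (a i) (b i) j * (u i x * coord_deriv j \<psi> x)) \<partial>lborel)"
        by (simp add: distr_of_def Z_up_coord_deriv sum_distrib_left mult.left_commute)
      also have "\<dots> = (\<Sum>j\<in>UNIV. \<zeta> (a i) (b i) j * distr_of (u i) (coord_deriv j \<psi>))"
        unfolding distr_of_def
        by (subst Bochner_Integration.integral_sum) (auto intro!: integrable_mult_right integrable_test u i \<psi>)
      finally show "(\<Sum>j\<in>UNIV. - ((s i * \<zeta> (a i) (b i) j) * distr_of (u i) (coord_deriv j \<psi>))) = s i * Z_up_distr (a i) (b i) (distr_of (u i)) \<psi>"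
        by (simp add: Z_up_distr_def sum_distrib_left sum_negf mult.assoc)
    qed
    finally show ?thesis .
  qed
  then have "(\<forall>\<psi>\<in>test_functions. distr_of g \<psi> = (\<Sum>i\<in>X. s i * Z_up_distr (a i) (b i) (distr_of (u i)) \<psi>)) \<longleftrightarrow> weak_divergence g F"
    by (simp add: weak_divergence_def)
  also have "\<dots> \<longleftrightarrow> hcoeff g = (\<Sum>j\<in>UNIV. annihilate j (hcoeff (F j)))" by (rule weak_divergence_iff[OF g F])
  also have "(\<Sum>j\<in>UNIV. annihilate j (hcoeff (F j))) = (\<Sum>i\<in>X. cscale (s i) (Z_fock (a i) (b i) (hcoeff (u i))))"
  proof
    fix \<alpha>
    have "hcoeff (F j) = (\<Sum>i\<in>X. cscale (s i * \<zeta> (a i) (b i) j) (hcoeff (u i)))" for j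
      unfolding F_def by (subst hcoeff_sum) (simp_all add: sqint_cmult u hcoeff_cmult)
    then have "(\<Sum>j\<in>UNIV. annihilate j (hcoeff (F j))) \<alpha> = (\<Sum>j\<in>UNIV. \<Sum>i\<in>X. s i * (\<zeta> (a i) (b i) j * annihilate j (hcoeff (u i)) \<alpha>))"
      by (simp add: sum_fun_apply annihilate_def cscale_def sum_distrib_left mult_ac del: of_nat_Suc)
    also have "\<dots> = (\<Sum>i\<in>X. cscale (s i) (Z_fock (a i) (b i) (hcoeff (u i)))) \<alpha>"
      by (subst sum.swap) (simp add: sum_fun_apply cscale_def Z_fock_apply sum_distrib_left)
    finally show "(\<Sum>j\<in>UNIV. annihilate j (hcoeff (F j))) \<alpha> = (\<Sum>i\<in>X. cscale (s i) (Z_fock (a i) (b i) (hcoeff (u i)))) \<alpha>" .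
  qed
  finally show ?thesis .
qed

lemma D0_iff:
  assumes k: "k \<ge> 1"
  shows "(f, g) \<in> D0 k sqnorm \<longleftrightarrow> f \<in> L2 sqnorm (V0 k) \<and> g \<in> L2 sqnorm (V1 k) \<and> field_coeff g = D0_fock (field_coeff f)"
proof -
  have "(\<forall>(A, As) \<in> I1 k. \<forall>\<psi> \<in> test_functions.
        distr_of (\<lambda>x. g x (A, As)) \<psi> = (\<Sum>A'\<in>UNIV. Z_up_distr A A' (distr_of (\<lambda>x. f x (A' # As))) \<psi>))
      \<longleftrightarrow> field_coeff g = D0_fock (field_coeff f)" if f: "f \<in> L2 sqnorm (V0 k)" and g: "g \<in> L2 sqnorm (V1 k)"
  proof -
    have "(\<forall>\<psi> \<in> test_functions. distr_of (\<lambda>x. g x (A, As)) \<psi> = (\<Sum>A'\<in>UNIV. Z_up_distr A A' (distr_of (\<lambda>x. f x (A' # As))) \<psi>))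
      \<longleftrightarrow> field_coeff g (A, As) = D0_fock (field_coeff f) (A, As)" for A As
      using Z_system_iff[of UNIV "\<lambda>x. g x (A, As)" "\<lambda>A' x. f x (A' # As)" "\<lambda>_. 1" "\<lambda>_. A" "\<lambda>A'. A'"]
        sqint_L2[OF f] sqint_L2[OF g] by (simp add: field_coeff_def D0_fock_def)
    moreover have "field_coeff g (A, As) = D0_fock (field_coeff f) (A, As)" if "(A, As) \<notin> I1 k" for A As
      using F1.valued_support[OF F1.valued_field_coeff[OF g] that] F1.valued_support[OF valued_D0_fock[OF F0.valued_field_coeff[OF f] k] that]
      by (simp only:)
    ultimately show ?thesis unfolding fun_eq_iff[of "field_coeff g"] split_paired_All by auto
  qed
  then show ?thesis unfolding D0_def mem_Collect_eq case_prod_conv by blast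
qed

lemma D1_iff:
  assumes k: "k \<ge> 2"
  shows "(h, g) \<in> D1 k sqnorm \<longleftrightarrow> h \<in> L2 sqnorm (V1 k) \<and> g \<in> L2 sqnorm (V2 k) \<and> field_coeff g = D1_fock (field_coeff h)"
proof -
  have "(\<forall>(A, B, As) \<in> I2 k. \<forall>\<psi> \<in> test_functions.
        distr_of (\<lambda>x. g x (A, B, As)) \<psi> = (\<Sum>A'\<in>UNIV. Z_up_distr A A' (distr_of (\<lambda>x. h x (B, A' # As))) \<psi>
                  - Z_up_distr B A' (distr_of (\<lambda>x. h x (A, A' # As))) \<psi>))
      \<longleftrightarrow> field_coeff g = D1_fock (field_coeff h)" if h: "h \<in> L2 sqnorm (V1 k)" and g: "g \<in> L2 sqnorm (V2 k)"
  proof -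
    have pairs: "(\<Sum>i\<in>UNIV. t i) = (\<Sum>A'\<in>UNIV. t (A', True) + t (A', False))" for t :: "primed \<times> bool \<Rightarrow> 'c::comm_monoid_add"
    proof -
      have "(\<Sum>i\<in>UNIV. t i) = (\<Sum>(A', b)\<in>UNIV \<times> UNIV. t (A', b))" by simp
      also have "\<dots> = (\<Sum>A'\<in>UNIV. \<Sum>b\<in>UNIV. t (A', b))" by (simp only: sum.cartesian_product)
      finally show ?thesis by (simp add: UNIV_bool add.commute)
    qed
    have scm: "Z_fock A A' u + cscale (- 1) (Z_fock B B' v) = Z_fock A A' u - Z_fock B B' v" for A A' B B' and u v :: "('a \<times> 4) multi \<Rightarrow> complex"
      by (simp add: cscale_def fun_eq_iff)
    have "(\<forall>\<psi> \<in> test_functions. distr_of (\<lambda>x. g x (A, B, As)) \<psi> = (\<Sum>A'\<in>UNIV. Z_up_distr A A' (distr_of (\<lambda>x. h x (B, A' # As))) \<psi>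
                  - Z_up_distr B A' (distr_of (\<lambda>x. h x (A, A' # As))) \<psi>))
      \<longleftrightarrow> field_coeff g (A, B, As) = D1_fock (field_coeff h) (A, B, As)" for A B As
      (* The Boolean component distinguishes the two terms of the antisymmetrization. *)
      using Z_system_iff[of UNIV "\<lambda>x. g x (A, B, As)" "\<lambda>i x. h x (if snd i then B else A, fst i # As)"
          "\<lambda>i. if snd i then 1 else - 1" "\<lambda>i. if snd i then A else B" fst]
        sqint_L2[OF h] sqint_L2[OF g] unfolding pairs by (simp add: field_coeff_def D1_fock_def scm)
    moreover have "field_coeff g (A, B, As) = D1_fock (field_coeff h) (A, B, As)" if "(A, B, As) \<notin> I2 k" for A B As
      using F2.valued_support[OF F2.valued_field_coeff[OF g] that] F2.valued_support[OF valued_D1_fock[OF F1.valued_field_coeff[OF h] k] that]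
      by (simp only:)
    ultimately show ?thesis unfolding fun_eq_iff[of "field_coeff g"] split_paired_All by auto
  qed
  then show ?thesis unfolding D1_def mem_Collect_eq case_prod_conv by blast
qed

lemma coeff_ip_neg [simp]: "d < 0 \<Longrightarrow> coeff_ip S d a b = 0"
  by (simp add: coeff_ip_def)

lemma coeff_ip_diff_right: "coeff_ip S d a (b - c) = coeff_ip S d a b - coeff_ip S d a c"
  by (simp add: coeff_ip_def level_ip_diff sum_subtractf)

lemma level_ip_level_part: "level_ip e (level_part d a) b = (if e = d then level_ip d a b else 0)"
proof (cases "e = d")
  case False
  then have "level_part d a \<alpha> = 0" if "\<alpha> \<in> level e" for \<alpha>
    using that by (auto simp: level_part_def level_def)
  then show ?thesis using False by (simp add: level_ip_def)
qed (simp add: level_ip_def level_part_def)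

lemma coeff_ip_coeff_part: "coeff_ip S e (coeff_part d a) b = (if e = d then coeff_ip S d a b else 0)"
  by (simp add: coeff_ip_def coeff_part_def level_ip_level_part)

lemma coeff_ip_coeff_part_sums: "(\<lambda>n. coeff_ip S (int n) (coeff_part d a) b) sums coeff_ip S d a b"
proof (cases "d < 0")
  case False
  then have "coeff_ip S (int n) (coeff_part d a) b = (if n = nat d then coeff_ip S d a b else 0)" for n
    by (auto simp: coeff_ip_coeff_part)
  then show ?thesis using sums_single[of "nat d" "\<lambda>_. coeff_ip S d a b"] by simp
qed (simp add: coeff_ip_coeff_part)

lemma summable_coeff_part: "summable (\<lambda>n. Re (coeff_ip S (int n) (coeff_part d a) (coeff_part d a)))"
  by (rule sums_summable[OF sums_Re[OF coeff_ip_coeff_part_sums]])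

text \<open>
  If \<open>u\<close> has the coefficients given by the formal adjoint, the two inner products agree level by level, up to a
  shift of the degree. Conversely, each level of the difference \<open>w\<close> of the coefficients is orthogonal to
  itself, as the part of \<open>w\<close> on one level is the coefficient family of an element of the domain.
\<close>

lemma adjoint_iff:
  fixes P :: "('n::finite, 'i) coeffs \<Rightarrow> ('n, 'j) coeffs" and Q :: "('n, 'j) coeffs \<Rightarrow> ('n, 'i) coeffs"
  assumes V: "tuple_space V S E N" and W: "tuple_space W S' E' N'"
    and T: "\<And>f g. (f, g) \<in> T \<longleftrightarrow> f \<in> L2 sqnorm V \<and> g \<in> L2 sqnorm W \<and> field_coeff g = P (field_coeff f)"
    and P: "\<And>c. valued V c \<Longrightarrow> valued W (P c)" and Q: "\<And>c. valued W c \<Longrightarrow> valued V (Q c)"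
    and coeff_part: "\<And>d c. P (coeff_part d c) = coeff_part (d - 1) (P c)"
    and adj: "\<And>d c c'. valued V c \<Longrightarrow> valued W c' \<Longrightarrow> coeff_ip S' (d - 1) (P c) c' = coeff_ip S d c (Q c')"
  shows "(v, u) \<in> adjoint_graph (L2 sqnorm V) (ip sqnorm S) (L2 sqnorm W) (ip sqnorm S') T
    \<longleftrightarrow> v \<in> L2 sqnorm W \<and> u \<in> L2 sqnorm V \<and> field_coeff u = Q (field_coeff v)"
proof -
  interpret V: tuple_space V S E N by (rule V)
  interpret W: tuple_space W S' E' N' by (rule W)
  have "(\<forall>(f, g)\<in>T. ip sqnorm S' g v = ip sqnorm S f u) \<longleftrightarrow> field_coeff u = Q (field_coeff v)"
    if v: "v \<in> L2 sqnorm W" and u: "u \<in> L2 sqnorm V"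
  proof
    assume eq: "field_coeff u = Q (field_coeff v)"
    show "\<forall>(f, g)\<in>T. ip sqnorm S' g v = ip sqnorm S f u"
    proof clarify
      fix f g assume "(f, g) \<in> T"
      then have f: "f \<in> L2 sqnorm V" and g: "g \<in> L2 sqnorm W" and fg: "field_coeff g = P (field_coeff f)" by (simp_all add: T)
      have "coeff_ip S (int d) (field_coeff f) (field_coeff u) = coeff_ip S' (int d - 1) (field_coeff g) (field_coeff v)" for d
        unfolding eq fg by (rule adj[OF V.valued_field_coeff[OF f] W.valued_field_coeff[OF v], symmetric])
      then have "(\<lambda>d. coeff_ip S' (int d - 1) (field_coeff g) (field_coeff v)) sums ip sqnorm S f u"
        using ip_sums[OF f u, of S] by simp
      moreover have "(\<lambda>d. coeff_ip S' (int d - 1) (field_coeff g) (field_coeff v)) sums ip sqnorm S' g v"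
        by (rule sums_Suc_imp) (simp_all add: ip_sums[OF g v])
      ultimately show "ip sqnorm S' g v = ip sqnorm S f u" by (rule sums_unique2[symmetric])
    qed
  next
    assume a: "\<forall>(f, g)\<in>T. ip sqnorm S' g v = ip sqnorm S f u"
    define w where "w = field_coeff u - Q (field_coeff v)"
    have w: "valued V w" unfolding w_def by (intro V.valued_diff V.valued_field_coeff[OF u] Q W.valued_field_coeff[OF v])
    have "coeff_ip S d w w = 0" for d
    proof -
      obtain f where f: "f \<in> L2 sqnorm V" "field_coeff f = coeff_part d w"
        using V.field_coeff_exists[OF V.valued_coeff_part[OF w] summable_coeff_part] by blast
      obtain g where g: "g \<in> L2 sqnorm W" "field_coeff g = coeff_part (d - 1) (P w)"
        using W.field_coeff_exists[OF W.valued_coeff_part[OF P[OF w]] summable_coeff_part] by blast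
      have "(f, g) \<in> T" by (simp add: T f g coeff_part)
      with a have e: "ip sqnorm S' g v = ip sqnorm S f u" by blast
      have "ip sqnorm S f u = coeff_ip S d w (field_coeff u)"
        using ip_sums[OF f(1) u, of S] coeff_ip_coeff_part_sums unfolding f(2) by (rule sums_unique2)
      moreover have "ip sqnorm S' g v = coeff_ip S' (d - 1) (P w) (field_coeff v)"
        using ip_sums[OF g(1) v, of S'] coeff_ip_coeff_part_sums unfolding g(2) by (rule sums_unique2)
      moreover have "coeff_ip S' (d - 1) (P w) (field_coeff v) = coeff_ip S d w (Q (field_coeff v))"
        by (rule adj[OF w W.valued_field_coeff[OF v]])
      ultimately have "coeff_ip S d w (field_coeff u) = coeff_ip S d w (Q (field_coeff v))" using e by simp
      then show ?thesis by (simp only: w_def coeff_ip_diff_right) simp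
    qed
    then have z: "w I \<alpha> = 0" for I \<alpha>
    proof (cases "I \<in> S")
      case True
      then show ?thesis
        using coeff_ip_self_eq_0[OF V.finite_S, of "int (\<Sum>j\<in>UNIV. \<alpha> j)" w I \<alpha>] \<open>\<And>d. coeff_ip S d w w = 0\<close>
        by (simp add: level_def del: of_nat_sum)
    next
      case False
      then have "w I = 0" by (rule V.valued_support[OF w])
      then show ?thesis by simp
    qed
    show "field_coeff u = Q (field_coeff v)"
    proof (intro ext)
      fix I \<alpha> show "field_coeff u I \<alpha> = Q (field_coeff v) I \<alpha>" using z[of I \<alpha>] by (simp add: w_def)
    qed
  qed
  then show ?thesis unfolding adjoint_graph_def by auto
qed

lemma D0_adj_iff:
  assumes k: "k \<ge> 1"
  shows "(v, u) \<in> D0_adj k sqnorm \<longleftrightarrow> v \<in> L2 sqnorm (V1 k) \<and> u \<in> L2 sqnorm (V0 k) \<and> field_coeff u = D0_fock_adj (field_coeff v)"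
  unfolding D0_adj_def
  by (rule adjoint_iff[OF tuple_space_V0 tuple_space_V1 D0_iff[OF k]])
     (simp_all only: valued_D0_fock valued_D0_fock_adj D0_fock_coeff_part coeff_ip_D0_fock k)

lemma D1_adj_iff:
  assumes k: "k \<ge> 2"
  shows "(v, u) \<in> D1_adj k sqnorm \<longleftrightarrow> v \<in> L2 sqnorm (V2 k) \<and> u \<in> L2 sqnorm (V1 k) \<and> field_coeff u = D1_fock_adj (field_coeff v)"
  unfolding D1_adj_def
  by (rule adjoint_iff[OF tuple_space_V1 tuple_space_V2 D1_iff[OF k]])
     (simp_all only: valued_D1_fock valued_D1_fock_adj D1_fock_coeff_part coeff_ip_D1_fock k)

section \<open>The inverse of the box operator on coefficients\<close>

definition N_fock :: "nat \<Rightarrow> ('n::finite, 'n idx1) coeffs \<Rightarrow> ('n, 'n idx1) coeffs" where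
  "N_fock k c = (SOME u. valued (V1 k) u \<and> Box_fock u = c)"

lemma N_fock:
  assumes "valued (V1 k) c" "k \<ge> 2"
  shows "valued (V1 k) (N_fock k c)" "Box_fock (N_fock k c) = c"
  using someI_ex[OF Box_fock_surj[OF assms]] by (simp_all add: N_fock_def)

lemma Box_fock_diff: "Box_fock (u - v) = Box_fock u - Box_fock v"
proof -
  have "Box_fock u = Box_fock (u - v) + Box_fock v" by (subst Box_fock_add[symmetric]) (simp only: diff_add_cancel)
  then show ?thesis by (simp only: add_diff_cancel_right')
qed

lemma N_fock_unique:
  fixes u :: "('n::finite, 'n idx1) coeffs"
  assumes u: "valued (V1 k) u" and k: "k \<ge> 2" and c: "Box_fock u = c"
  shows "N_fock k c = u"
proof -
  have vc: "valued (V1 k) c" using valued_Box_fock[OF u k] by (simp only: c)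
  have "valued (V1 k) (N_fock k c - u)" by (intro F1.valued_diff N_fock vc u k)
  moreover have "Box_fock (N_fock k c - u) = 0" by (simp only: Box_fock_diff N_fock[OF vc k] c diff_self)
  ultimately have "N_fock k c - u = 0" by (rule Box_fock_inj[OF _ k])
  then show ?thesis by (simp only: right_minus_eq)
qed

lemma coeff_ip_zero: "coeff_ip S d a 0 = 0" "coeff_ip S d 0 a = 0"
  by (simp_all only: coeff_ip_def zero_fun_apply level_ip_zero sum.neutral_const)

lemma coeff_ip_Box_fock_symmetric:
  assumes "valued (V1 k) u" "valued (V1 k) v" "k \<ge> 2"
  shows "coeff_ip (I1 k) d (Box_fock u) v = coeff_ip (I1 k) d u (Box_fock v)"
proof -
  have "coeff_ip (I1 k) d u (Box_fock v) = cnj (coeff_ip (I1 k) d (Box_fock v) u)" by (simp only: coeff_ip_cnj)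
  also have "\<dots> = coeff_ip (I1 k) d (Box_fock u) v"
    by (simp only: coeff_ip_Box_fock[OF assms(1,2,3)] coeff_ip_Box_fock[OF assms(2,1,3)] complex_cnj_add coeff_ip_cnj)
  finally show ?thesis ..
qed

text \<open>
  With \<open>X = \<langle>c, u\<rangle> = |D\<^sub>0\<^sup>* u|\<^sup>2 + |D\<^sub>1 u|\<^sup>2\<close> and \<open>4 |u|\<^sup>2 \<le> X\<close>, expanding \<open>0 \<le> |c - 4 u|\<^sup>2\<close> gives \<open>4 X \<le> |c|\<^sup>2\<close>, and all three bounds
  follow.
\<close>

lemma Box_fock_bounds:
  fixes u :: "('n::finite, 'n idx1) coeffs"
  assumes u: "valued (V1 k) u" and k: "k \<ge> 2" and c: "Box_fock u = c"
  shows "Re (coeff_ip (I1 k) d u u) \<le> 1/16 * Re (coeff_ip (I1 k) d c c)"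
    "Re (coeff_ip (I0 k) (d + 1) (D0_fock_adj u) (D0_fock_adj u)) \<le> 1/4 * Re (coeff_ip (I1 k) d c c)"
    "Re (coeff_ip (I2 k) (d - 1) (D1_fock u) (D1_fock u)) \<le> 1/4 * Re (coeff_ip (I1 k) d c c)"
proof -
  define U where "U = Re (coeff_ip (I1 k) d u u)"
  define C where "C = Re (coeff_ip (I1 k) d c c)"
  define X where "X = Re (coeff_ip (I1 k) d c u)"
  define e0 where "e0 = Re (coeff_ip (I0 k) (d + 1) (D0_fock_adj u) (D0_fock_adj u))"
  define e1 where "e1 = Re (coeff_ip (I2 k) (d - 1) (D1_fock u) (D1_fock u))"
  have e: "0 \<le> e0" "0 \<le> e1" by (simp_all add: e0_def e1_def coeff_ip_nonneg)
  have X: "X = e0 + e1" using coeff_ip_Box_fock[OF u u k, of d] by (simp add: X_def e0_def e1_def c)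
  have UX: "4 * U \<le> X" using Box_fock_estimate[OF u k, of d] by (simp add: U_def X_def c)
  have "coeff_ip (I1 k) d (c - tuple_scale 4 u) (c - tuple_scale 4 u) = coeff_ip (I1 k) d c c - 4 * coeff_ip (I1 k) d c u - 4 * coeff_ip (I1 k) d u c + 16 * coeff_ip (I1 k) d u u"
    by (simp add: coeff_ip_def tuple_scale_def level_ip_diff level_ip_cscale sum_subtractf sum.distrib sum_distrib_left algebra_simps)
  moreover have "Re (coeff_ip (I1 k) d u c) = X" using coeff_ip_cnj[of "I1 k" d c u] by (simp add: X_def flip: coeff_ip_cnj[of _ _ c u])
  ultimately have "0 \<le> C - 8 * X + 16 * U"
    using coeff_ip_nonneg[of "I1 k" d "c - tuple_scale 4 u"] by (simp add: C_def X_def U_def)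
  with UX e X have "U \<le> 1/16 * C" "e0 \<le> 1/4 * C" "e1 \<le> 1/4 * C" by linarith+
  then show "Re (coeff_ip (I1 k) d u u) \<le> 1/16 * Re (coeff_ip (I1 k) d c c)"
    "Re (coeff_ip (I0 k) (d + 1) (D0_fock_adj u) (D0_fock_adj u)) \<le> 1/4 * Re (coeff_ip (I1 k) d c c)"
    "Re (coeff_ip (I2 k) (d - 1) (D1_fock u) (D1_fock u)) \<le> 1/4 * Re (coeff_ip (I1 k) d c c)"
    by (simp_all add: U_def C_def e0_def e1_def)
qed

text \<open>
  The two parts of \<open>c\<close> are orthogonal because \<open>D\<^sub>1 D\<^sub>0 = 0\<close>. Hence square summability of \<open>c\<close> is inherited by both.
\<close>

lemma Box_fock_parts:
  fixes u :: "('n::finite, 'n idx1) coeffs"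
  assumes u: "valued (V1 k) u" and k: "k \<ge> 2" and c: "Box_fock u = c"
  shows "Re (coeff_ip (I1 k) d (D0_fock (D0_fock_adj u)) (D0_fock (D0_fock_adj u))) + Re (coeff_ip (I1 k) d (D1_fock_adj (D1_fock u)) (D1_fock_adj (D1_fock u))) = Re (coeff_ip (I1 k) d c c)"
proof -
  define a where "a = D0_fock (D0_fock_adj u)"
  define b where "b = D1_fock_adj (D1_fock u)"
  have k1: "k \<ge> 1" using k by simp
  have va: "valued (V1 k) a" unfolding a_def by (intro valued_D0_fock valued_D0_fock_adj u k1)
  have "coeff_ip (I1 k) d b a = coeff_ip (I2 k) (d - 1) (D1_fock u) (D1_fock a)"
    unfolding b_def by (rule coeff_ip_D1_fock_adj[OF va valued_D1_fock[OF u k] k])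
  also have "D1_fock a = 0" unfolding a_def by (rule D1_fock_D0_fock[OF valued_D0_fock_adj[OF u k1]])
  finally have ba: "coeff_ip (I1 k) d b a = 0" by (simp only: coeff_ip_zero)
  then have ab: "coeff_ip (I1 k) d a b = 0" by (metis coeff_ip_cnj complex_cnj_zero)
  have "c = a + b" by (simp only: c[symmetric] Box_fock_def a_def b_def)
  then have "coeff_ip (I1 k) d c c = coeff_ip (I1 k) d a a + coeff_ip (I1 k) d b b + coeff_ip (I1 k) d a b + coeff_ip (I1 k) d b a"
    by (simp add: coeff_ip_def level_ip_add sum.distrib)
  then have "Re (coeff_ip (I1 k) d c c) = Re (coeff_ip (I1 k) d a a) + Re (coeff_ip (I1 k) d b b)" by (simp add: ab ba)
  then show ?thesis by (simp add: a_def b_def)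
qed

section \<open>The inverse on fields\<close>

definition N_field :: "nat \<Rightarrow> ('n::finite, 'n idx1) field \<Rightarrow> ('n, 'n idx1) field" where
  "N_field k f = (SOME u. u \<in> L2 sqnorm (V1 k) \<and> field_coeff u = N_fock k (field_coeff f))"

lemma summable_coeff_ip: "f \<in> L2 sqnorm V \<Longrightarrow> summable (\<lambda>d. Re (coeff_ip S (int d) (field_coeff f) (field_coeff f)))"
  by (rule sums_summable[OF sums_Re[OF ip_sums]])

lemma summable_nonneg_bound:
  assumes "summable g" "\<And>d. 0 \<le> h d" "\<And>d. h d \<le> (g d :: real)"
  shows "summable h"
  by (rule summable_comparison_test'[OF assms(1)]) (use assms in auto)

lemma N_field:
  fixes f :: "('n::finite, 'n idx1) field"
  assumes f: "f \<in> L2 sqnorm (V1 k)" and k: "k \<ge> 2"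
  shows "N_field k f \<in> L2 sqnorm (V1 k)" "field_coeff (N_field k f) = N_fock k (field_coeff f)"
proof -
  note n = N_fock[OF F1.valued_field_coeff[OF f] k]
  have "summable (\<lambda>d. Re (coeff_ip (I1 k) (int d) (N_fock k (field_coeff f)) (N_fock k (field_coeff f))))"
    by (rule summable_nonneg_bound[OF summable_mult[OF summable_coeff_ip[OF f]] coeff_ip_nonneg Box_fock_bounds(1)[OF n(1) k n(2)]])
  then have "\<exists>u. u \<in> L2 sqnorm (V1 k) \<and> field_coeff u = N_fock k (field_coeff f)"
    using F1.field_coeff_exists[OF n(1)] by blast
  from someI_ex[OF this] show "N_field k f \<in> L2 sqnorm (V1 k)" "field_coeff (N_field k f) = N_fock k (field_coeff f)"
    by (simp_all add: N_field_def)
qed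

lemma L2_lincomb:
  fixes f g :: "('n::finite, 'n idx1) field"
  assumes f: "f \<in> L2 sqnorm (V1 k)" and g: "g \<in> L2 sqnorm (V1 k)"
  shows "(\<lambda>x I. a * f x I + b * g x I) \<in> L2 sqnorm (V1 k)" (is "?h \<in> _")
    "field_coeff (\<lambda>x I. a * f x I + b * g x I) = tuple_scale a (field_coeff f) + tuple_scale b (field_coeff g)"
proof -
  have "?h x \<in> V1 k" for x
    using f g by (intro F1.lincomb) (simp_all only: L2_iff simp_thms)
  then show "?h \<in> L2 sqnorm (V1 k)"
    using sqint_L2[OF f] sqint_L2[OF g] by (simp add: L2_iff sqint_add sqint_cmult)
  show "field_coeff ?h = tuple_scale a (field_coeff f) + tuple_scale b (field_coeff g)"
    by (rule ext) (simp only: field_coeff_def tuple_scale_def plus_fun_apply hcoeff_add hcoeff_cmult sqint_cmult sqint_L2[OF f] sqint_L2[OF g])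
qed

text \<open>
  For the converse direction the intermediate fields have to be constructed: \<open>Box_fock_bounds\<close> and \<open>Box_fock_parts\<close> show that
  their coefficients are square summable.
\<close>

lemma Box_iff:
  fixes f g :: "('n::finite, 'n idx1) field"
  assumes k: "k \<ge> 2"
  shows "(f, g) \<in> Box k sqnorm \<longleftrightarrow> f \<in> L2 sqnorm (V1 k) \<and> g \<in> L2 sqnorm (V1 k) \<and> Box_fock (field_coeff f) = field_coeff g"
proof
  have k1: "k \<ge> 1" using k by simp
  assume "(f, g) \<in> Box k sqnorm"
  then obtain u v p q where g: "g \<in> L2 sqnorm (V1 k)" and
    "(f, u) \<in> D0_adj k sqnorm" "(u, v) \<in> D0 k sqnorm" "(f, p) \<in> D1 k sqnorm" "(p, q) \<in> D1_adj k sqnorm"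
    and ae: "ae_eq g (\<lambda>x I. v x I + q x I)"
    unfolding Box_def by blast
  then have f: "f \<in> L2 sqnorm (V1 k)" and v: "v \<in> L2 sqnorm (V1 k)" and q: "q \<in> L2 sqnorm (V1 k)"
    and cu: "field_coeff v = D0_fock (D0_fock_adj (field_coeff f))" and cq: "field_coeff q = D1_fock_adj (D1_fock (field_coeff f))"
    unfolding D0_adj_iff[OF k1] D0_iff[OF k1] D1_iff[OF k] D1_adj_iff[OF k] by simp_all
  have "field_coeff g = field_coeff (\<lambda>x I. 1 * v x I + 1 * q x I)"
    by (rule field_coeff_cong[OF g L2_lincomb(1)[OF v q]]) (use ae in simp)
  also have "\<dots> = Box_fock (field_coeff f)"
    unfolding L2_lincomb(2)[OF v q] Box_fock_def cu cq by (simp add: tuple_scale_def)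
  finally show "f \<in> L2 sqnorm (V1 k) \<and> g \<in> L2 sqnorm (V1 k) \<and> Box_fock (field_coeff f) = field_coeff g" using f g by simp
next
  have k1: "k \<ge> 1" using k by simp
  assume "f \<in> L2 sqnorm (V1 k) \<and> g \<in> L2 sqnorm (V1 k) \<and> Box_fock (field_coeff f) = field_coeff g"
  then have f: "f \<in> L2 sqnorm (V1 k)" and g: "g \<in> L2 sqnorm (V1 k)" and B: "Box_fock (field_coeff f) = field_coeff g" by simp_all
  note c = F1.valued_field_coeff[OF f]
  note sg = summable_coeff_ip[OF g, of "I1 k"]
  have vu: "valued (V0 k) (D0_fock_adj (field_coeff f))" and vp: "valued (V2 k) (D1_fock (field_coeff f))"
    by (intro valued_D0_fock_adj valued_D1_fock c k k1)+
  have "summable (\<lambda>d. Re (coeff_ip (I0 k) (int (Suc d)) (D0_fock_adj (field_coeff f)) (D0_fock_adj (field_coeff f))))"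
  proof (rule summable_nonneg_bound[OF summable_mult[OF sg, of "1/4"] coeff_ip_nonneg])
    show "Re (coeff_ip (I0 k) (int (Suc d)) (D0_fock_adj (field_coeff f)) (D0_fock_adj (field_coeff f))) \<le> 1/4 * Re (coeff_ip (I1 k) (int d) (field_coeff g) (field_coeff g))" for d
      using Box_fock_bounds(2)[OF c k B, of "int d"] by (simp add: add.commute)
  qed
  then have "summable (\<lambda>d. Re (coeff_ip (I0 k) (int d) (D0_fock_adj (field_coeff f)) (D0_fock_adj (field_coeff f))))"
    by (subst (asm) summable_Suc_iff[of "\<lambda>d. Re (coeff_ip (I0 k) (int d) (D0_fock_adj (field_coeff f)) (D0_fock_adj (field_coeff f)))"])
  from F0.field_coeff_exists[OF vu this] obtain u where u: "u \<in> L2 sqnorm (V0 k)" "field_coeff u = D0_fock_adj (field_coeff f)" by blast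
  have "summable (\<lambda>d. Re (coeff_ip (I2 k) (int d) (D1_fock (field_coeff f)) (D1_fock (field_coeff f))))"
  proof (rule summable_nonneg_bound[OF _ coeff_ip_nonneg])
    show "summable (\<lambda>d. 1/4 * Re (coeff_ip (I1 k) (int (Suc d)) (field_coeff g) (field_coeff g)))"
      using sg by (intro summable_mult) (subst summable_Suc_iff)
    show "Re (coeff_ip (I2 k) (int d) (D1_fock (field_coeff f)) (D1_fock (field_coeff f))) \<le> 1/4 * Re (coeff_ip (I1 k) (int (Suc d)) (field_coeff g) (field_coeff g))" for d
      using Box_fock_bounds(3)[OF c k B, of "int (Suc d)"] by simp
  qed
  from F2.field_coeff_exists[OF vp this] obtain p where p: "p \<in> L2 sqnorm (V2 k)" "field_coeff p = D1_fock (field_coeff f)" by blast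
  have parts: "Re (coeff_ip (I1 k) d (D0_fock (D0_fock_adj (field_coeff f))) (D0_fock (D0_fock_adj (field_coeff f)))) \<le> Re (coeff_ip (I1 k) d (field_coeff g) (field_coeff g))"
    "Re (coeff_ip (I1 k) d (D1_fock_adj (D1_fock (field_coeff f))) (D1_fock_adj (D1_fock (field_coeff f)))) \<le> Re (coeff_ip (I1 k) d (field_coeff g) (field_coeff g))" for d
    using Box_fock_parts[OF c k B, of d] coeff_ip_nonneg[of "I1 k" d "D0_fock (D0_fock_adj (field_coeff f))"] coeff_ip_nonneg[of "I1 k" d "D1_fock_adj (D1_fock (field_coeff f))"]
    by simp_all
  from F1.field_coeff_exists[OF valued_D0_fock[OF vu k1] summable_nonneg_bound[OF sg coeff_ip_nonneg parts(1)]]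
  obtain v where v: "v \<in> L2 sqnorm (V1 k)" "field_coeff v = D0_fock (D0_fock_adj (field_coeff f))" by blast
  from F1.field_coeff_exists[OF valued_D1_fock_adj[OF vp k] summable_nonneg_bound[OF sg coeff_ip_nonneg parts(2)]]
  obtain q where q: "q \<in> L2 sqnorm (V1 k)" "field_coeff q = D1_fock_adj (D1_fock (field_coeff f))" by blast
  have "ae_eq g (\<lambda>x I. 1 * v x I + 1 * q x I)"
  proof (rule F1.field_coeff_unique[OF g L2_lincomb(1)[OF v(1) q(1)]])
    show "field_coeff g = field_coeff (\<lambda>x I. 1 * v x I + 1 * q x I)"
      unfolding L2_lincomb(2)[OF v(1) q(1)] v(2) q(2) B[symmetric] Box_fock_def by (simp add: tuple_scale_def)
  qed
  then have "ae_eq g (\<lambda>x I. v x I + q x I)" by simp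
  moreover have "(f, u) \<in> D0_adj k sqnorm" "(u, v) \<in> D0 k sqnorm" "(f, p) \<in> D1 k sqnorm" "(p, q) \<in> D1_adj k sqnorm"
    unfolding D0_adj_iff[OF k1] D0_iff[OF k1] D1_iff[OF k] D1_adj_iff[OF k] by (simp_all only: f u v p q simp_thms)
  ultimately show "(f, g) \<in> Box k sqnorm" unfolding Box_def using g by blast
qed

lemma ip_N_field:
  fixes f g :: "('n::finite, 'n idx1) field"
  assumes f: "f \<in> L2 sqnorm (V1 k)" and g: "g \<in> L2 sqnorm (V1 k)" and k: "k \<ge> 2"
  shows "ip sqnorm (I1 k) (N_field k f) g = ip sqnorm (I1 k) f (N_field k g)"
proof -
  note nf = N_fock[OF F1.valued_field_coeff[OF f] k] and ng = N_fock[OF F1.valued_field_coeff[OF g] k]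
  have "coeff_ip (I1 k) d (N_fock k (field_coeff f)) (field_coeff g) = coeff_ip (I1 k) d (field_coeff f) (N_fock k (field_coeff g))" for d
    using coeff_ip_Box_fock_symmetric[OF nf(1) ng(1) k, of d] unfolding nf(2) ng(2) ..
  then show ?thesis
    using ip_sums[OF N_field(1)[OF f k] g, of "I1 k"] ip_sums[OF f N_field(1)[OF g k], of "I1 k"]
    unfolding N_field(2)[OF f k] N_field(2)[OF g k] by (simp add: sums_unique2)
qed

lemma ip_cong_right:
  assumes f: "f \<in> L2 sqnorm V" and g: "g \<in> L2 sqnorm V" and h: "h \<in> L2 sqnorm V" and "ae_eq g h"
  shows "ip sqnorm S f g = ip sqnorm S f h"
  using ip_sums[OF f g, of S] ip_sums[OF f h, of S] unfolding field_coeff_cong[OF g h assms(4)] by (rule sums_unique2)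

lemma ip_commute:
  assumes f: "f \<in> L2 sqnorm V" and g: "g \<in> L2 sqnorm V"
  shows "cnj (ip sqnorm S f g) = ip sqnorm S g f"
  unfolding ip_gauss[OF f g] ip_gauss[OF g f] by (simp add: l2ip_cnj)

lemma nrm_le:
  assumes "(\<lambda>d. a d) sums nrm2" "f \<in> L2 sqnorm V" "\<And>d. Re (coeff_ip S (int d) (field_coeff f) (field_coeff f)) \<le> r\<^sup>2 * a d" "0 \<le> r"
  shows "nrm sqnorm S f \<le> r * sqrt nrm2"
proof -
  have "Re (ip sqnorm S f f) \<le> r\<^sup>2 * nrm2"
    by (rule sums_le[OF assms(3) sums_Re[OF ip_sums[OF assms(2,2)]] sums_mult[OF assms(1)]])
  then have "sqrt (Re (ip sqnorm S f f)) \<le> sqrt (r\<^sup>2 * nrm2)" by (rule real_sqrt_le_mono)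
  also have "\<dots> = r * sqrt nrm2" using assms(4) by (simp add: real_sqrt_mult)
  finally show ?thesis by (simp add: nrm_def)
qed

lemma ip_self_eq_0:
  fixes f g :: "('n::finite, 'n idx1) field"
  assumes f: "f \<in> L2 sqnorm (V1 k)" and g: "g \<in> L2 sqnorm (V1 k)"
    and eq: "\<And>h. h \<in> L2 sqnorm (V1 k) \<Longrightarrow> ip sqnorm (I1 k) h f = ip sqnorm (I1 k) h g"
  shows "ae_eq f g"
proof (rule F1.field_coeff_unique[OF f g])
  define w where "w = (\<lambda>x I. 1 * f x I + (- 1) * g x I)"
  have w: "w \<in> L2 sqnorm (V1 k)" unfolding w_def by (rule L2_lincomb(1)[OF f g])
  have cw: "field_coeff w = field_coeff f - field_coeff g"
    unfolding w_def L2_lincomb(2)[OF f g] by (simp add: tuple_scale_def cscale_def fun_eq_iff)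
  have "(\<lambda>d. coeff_ip (I1 k) (int d) (field_coeff w) (field_coeff f) - coeff_ip (I1 k) (int d) (field_coeff w) (field_coeff g)) sums
      (ip sqnorm (I1 k) w f - ip sqnorm (I1 k) w g)"
    by (intro sums_diff ip_sums[OF w f] ip_sums[OF w g])
  then have "(\<lambda>d. coeff_ip (I1 k) (int d) (field_coeff w) (field_coeff w)) sums 0"
    unfolding eq[OF w] by (simp only: cw coeff_ip_diff_right) simp
  from sums_Re[OF this] have s: "(\<lambda>d. Re (coeff_ip (I1 k) (int d) (field_coeff w) (field_coeff w))) sums 0" by simp
  have z: "Re (coeff_ip (I1 k) (int d) (field_coeff w) (field_coeff w)) = 0" for d
    using suminf_eq_zero_iff[OF sums_summable[OF s] coeff_ip_nonneg] sums_unique[OF s, symmetric] by blast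
  have "field_coeff w I \<alpha> = 0" for I and \<alpha> :: "('n \<times> 4) multi"
  proof (cases "I \<in> I1 k")
    case True
    show ?thesis
      by (rule coeff_ip_self_eq_0[OF finite_I1 z True, of _ "\<Sum>j\<in>UNIV. \<alpha> j"]) (simp add: level_int del: of_nat_sum)
  next
    case False
    then have "field_coeff w I = 0" by (rule F1.valued_support[OF F1.valued_field_coeff[OF w]])
    then show ?thesis by simp
  qed
  then show "field_coeff f = field_coeff g" by (simp add: cw fun_eq_iff)
qed

theorem theorem1p1:
  fixes k :: nat and \<phi> :: "real^4^'n::finite \<Rightarrow> real"
  assumes "k \<ge> 2" and "\<phi> = (\<lambda>x. (norm x)\<^sup>2)"
  shows "\<exists>N :: ('n, 'n idx1) field \<Rightarrow> ('n, 'n idx1) field.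
    inverse_op (L2 \<phi> (V1 k)) (Box k \<phi>) N \<and>
    bounded_op (L2 \<phi> (V1 k)) (nrm \<phi> (I1 k)) N \<and>
    self_adjoint_op (L2 \<phi> (V1 k)) (ip \<phi> (I1 k)) N \<and>
    nonneg_op (L2 \<phi> (V1 k)) (ip \<phi> (I1 k)) N \<and>
    (\<forall>f \<in> L2 \<phi> (V1 k). nrm \<phi> (I1 k) (N f) \<le> 1/4 * nrm \<phi> (I1 k) f) \<and>
    (\<forall>f \<in> L2 \<phi> (V1 k). N f \<in> Domain (D0_adj k \<phi>) \<and> N f \<in> Domain (D1 k \<phi>)) \<and>
    (\<forall>f. (f, \<lambda>x I. 0) \<in> D1 k \<phi> \<longrightarrow>
       (\<forall>u. (N f, u) \<in> D0_adj k \<phi> \<longrightarrow> canonical_solution k \<phi> f u)) \<and>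
    (\<forall>f \<in> L2 \<phi> (V1 k). \<forall>u. (N f, u) \<in> D0_adj k \<phi> \<longrightarrow>
       nrm \<phi> (I0 k) u \<le> 1/2 * nrm \<phi> (I1 k) f) \<and>
    (\<forall>f \<in> L2 \<phi> (V1 k). \<forall>p. (N f, p) \<in> D1 k \<phi> \<longrightarrow>
       nrm \<phi> (I2 k) p \<le> 1/2 * nrm \<phi> (I1 k) f)"
proof -
  have k: "k \<ge> 2" and k1: "k \<ge> 1" and \<phi>: "\<phi> = sqnorm" using assms by simp_all
  let ?H = "L2 sqnorm (V1 k) :: ('n, 'n idx1) field set"
  let ?N = "N_field k :: ('n, 'n idx1) field \<Rightarrow> ('n, 'n idx1) field"
  have NB: "(?N f, f) \<in> Box k sqnorm" if "f \<in> ?H" for f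
    unfolding Box_iff[OF k] using that N_field[OF that k] N_fock(2)[OF F1.valued_field_coeff[OF that] k] by simp
  have norm_f: "nrm sqnorm (I1 k) f = sqrt (Re (ip sqnorm (I1 k) f f))" for f :: "('n, 'n idx1) field"
    by (simp add: nrm_def)
  have inv: "inverse_op ?H (Box k sqnorm) ?N"
    unfolding inverse_op_def
  proof (intro conjI ballI; clarify?)
    fix f assume "f \<in> ?H" then show "(?N f, f) \<in> Box k sqnorm" by (rule NB)
  next
    fix u f :: "('n, 'n idx1) field" assume "(u, f) \<in> Box k sqnorm"
    then have u: "u \<in> ?H" and f: "f \<in> ?H" and B: "Box_fock (field_coeff u) = field_coeff f" by (simp_all add: Box_iff[OF k])
    show "ae_eq (?N f) u"
      by (rule F1.field_coeff_unique[OF N_field(1)[OF f k] u]) (simp only: N_field(2)[OF f k] N_fock_unique[OF F1.valued_field_coeff[OF u] k B])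
  qed
  have est: "nrm sqnorm (I1 k) (?N f) \<le> 1/4 * nrm sqnorm (I1 k) f" if f: "f \<in> ?H" for f
  proof -
    note n = N_fock[OF F1.valued_field_coeff[OF f] k]
    show ?thesis unfolding norm_f[of f]
    proof (rule nrm_le[OF sums_Re[OF ip_sums[OF f f]] N_field(1)[OF f k]])
      show "Re (coeff_ip (I1 k) (int d) (field_coeff (?N f)) (field_coeff (?N f))) \<le> (1/4)\<^sup>2 * Re (coeff_ip (I1 k) (int d) (field_coeff f) (field_coeff f))" for d
        using Box_fock_bounds(1)[OF n(1) k n(2), of "int d"] unfolding N_field(2)[OF f k] by (simp add: power2_eq_square)
    qed simp
  qed
  have bdd: "bounded_op ?H (nrm sqnorm (I1 k)) ?N"
    unfolding bounded_op_def
  proof (intro conjI ballI allI impI)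
    show "?N f \<in> ?H" if "f \<in> ?H" for f by (rule N_field(1)[OF that k])
    show "ae_eq (?N f) (?N g)" if f: "f \<in> ?H" and g: "g \<in> ?H" and "ae_eq f g" for f g
      by (rule F1.field_coeff_unique[OF N_field(1)[OF f k] N_field(1)[OF g k]])
         (simp only: N_field(2)[OF f k] N_field(2)[OF g k] field_coeff_cong[OF f g that(3)])
    show "ae_eq (?N (\<lambda>x I. a * f x I + b * g x I)) (\<lambda>x I. a * ?N f x I + b * ?N g x I)"
      if f: "f \<in> ?H" and g: "g \<in> ?H" for f g a b
    proof (rule F1.field_coeff_unique[OF N_field(1)[OF L2_lincomb(1)[OF f g] k] L2_lincomb(1)[OF N_field(1)[OF f k] N_field(1)[OF g k]]])
      note nf = N_fock[OF F1.valued_field_coeff[OF f] k] and ng = N_fock[OF F1.valued_field_coeff[OF g] k]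
      have "N_fock k (tuple_scale a (field_coeff f) + tuple_scale b (field_coeff g)) = tuple_scale a (N_fock k (field_coeff f)) + tuple_scale b (N_fock k (field_coeff g))"
        by (rule N_fock_unique[OF _ k]) (intro V1_add valued_tuple_scale nf ng, simp only: Box_fock_add Box_fock_scale nf ng)
      then show "field_coeff (?N (\<lambda>x I. a * f x I + b * g x I)) = field_coeff (\<lambda>x I. a * ?N f x I + b * ?N g x I)"
        by (simp only: N_field(2)[OF L2_lincomb(1)[OF f g] k] L2_lincomb(2)[OF f g]
            L2_lincomb(2)[OF N_field(1)[OF f k] N_field(1)[OF g k]] N_field(2)[OF f k] N_field(2)[OF g k])
    qed
    show "\<exists>C. \<forall>f\<in>?H. nrm sqnorm (I1 k) (?N f) \<le> C * nrm sqnorm (I1 k) f" using est by blast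
  qed
  have sa: "self_adjoint_op ?H (ip sqnorm (I1 k)) ?N"
    unfolding self_adjoint_op_def
  proof (intro set_eqI iffI; clarify)
    fix v u assume "(v, u) \<in> adjoint_graph ?H (ip sqnorm (I1 k)) ?H (ip sqnorm (I1 k)) (op_graph ?H ?N)"
    then have v: "v \<in> ?H" and u: "u \<in> ?H"
      and a: "\<And>f g. (f, g) \<in> op_graph ?H ?N \<Longrightarrow> ip sqnorm (I1 k) g v = ip sqnorm (I1 k) f u"
      by (auto simp: adjoint_graph_def)
    have "ae_eq u (?N v)"
    proof (rule ip_self_eq_0[OF u N_field(1)[OF v k]])
      fix h assume h: "h \<in> ?H"
      have "(h, ?N h) \<in> op_graph ?H ?N" using h N_field(1)[OF h k] by (simp add: op_graph_def ae_eq_def)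
      from a[OF this] show "ip sqnorm (I1 k) h u = ip sqnorm (I1 k) h (?N v)" using ip_N_field[OF h v k] by simp
    qed
    then show "(v, u) \<in> op_graph ?H ?N" using u v by (simp add: op_graph_def)
  next
    fix v u assume "(v, u) \<in> op_graph ?H ?N"
    then have v: "v \<in> ?H" and u: "u \<in> ?H" and uv: "ae_eq u (?N v)" by (simp_all add: op_graph_def)
    have "ip sqnorm (I1 k) g v = ip sqnorm (I1 k) f u" if "(f, g) \<in> op_graph ?H ?N" for f g
    proof -
      from that have f: "f \<in> ?H" and g: "g \<in> ?H" and gf: "ae_eq g (?N f)" by (simp_all add: op_graph_def)
      have "ip sqnorm (I1 k) v g = ip sqnorm (I1 k) v (?N f)"
        by (rule ip_cong_right[OF v g N_field(1)[OF f k] gf])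
      then have "ip sqnorm (I1 k) g v = ip sqnorm (I1 k) (?N f) v"
        using ip_commute[OF v g] ip_commute[OF v N_field(1)[OF f k]] by metis
      also have "\<dots> = ip sqnorm (I1 k) f (?N v)" by (rule ip_N_field[OF f v k])
      also have "\<dots> = ip sqnorm (I1 k) f u" by (rule ip_cong_right[OF f u N_field(1)[OF v k] uv, symmetric])
      finally show ?thesis .
    qed
    then show "(v, u) \<in> adjoint_graph ?H (ip sqnorm (I1 k)) ?H (ip sqnorm (I1 k)) (op_graph ?H ?N)"
      using u v by (auto simp: adjoint_graph_def)
  qed
  have nn: "nonneg_op ?H (ip sqnorm (I1 k)) ?N"
    unfolding nonneg_op_def
  proof (rule ballI)
    fix f assume f: "f \<in> ?H"
    note n = N_fock[OF F1.valued_field_coeff[OF f] k]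
    let ?u = "N_fock k (field_coeff f)"
    have s: "(\<lambda>d. coeff_ip (I1 k) (int d) ?u (field_coeff f)) sums ip sqnorm (I1 k) (?N f) f"
      using ip_sums[OF N_field(1)[OF f k] f, of "I1 k"] unfolding N_field(2)[OF f k] .
    have t: "coeff_ip (I1 k) d ?u (field_coeff f) = coeff_ip (I0 k) (d + 1) (D0_fock_adj ?u) (D0_fock_adj ?u) + coeff_ip (I2 k) (d - 1) (D1_fock ?u) (D1_fock ?u)" for d
      using coeff_ip_Box_fock[OF n(1) n(1) k, of d] coeff_ip_Box_fock_symmetric[OF n(1) n(1) k, of d] unfolding n(2) by simp
    have "Im (coeff_ip (I1 k) d ?u (field_coeff f)) = 0" "0 \<le> Re (coeff_ip (I1 k) d ?u (field_coeff f))" for d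
      unfolding t by (simp_all add: coeff_ip_nonneg) (simp add: coeff_ip_self del: of_real_sum of_real_power)
    then have "Im (ip sqnorm (I1 k) (?N f) f) = 0" "0 \<le> Re (ip sqnorm (I1 k) (?N f) f)"
      using sums_Im[OF s] sums_le[OF _ sums_zero sums_Re[OF s]] by (simp_all add: sums_unique2[OF _ sums_zero])
    then show "ip sqnorm (I1 k) (?N f) f \<in> \<real> \<and> 0 \<le> Re (ip sqnorm (I1 k) (?N f) f)"
      by (simp add: complex_is_Real_iff)
  qed
  have dom: "?N f \<in> Domain (D0_adj k sqnorm) \<and> ?N f \<in> Domain (D1 k sqnorm)" if "f \<in> ?H" for f
    using NB[OF that] unfolding Box_def by blast
  have can: "canonical_solution k sqnorm f u"
    if f0: "(f, \<lambda>x I. 0) \<in> D1 k sqnorm" and u: "(?N f, u) \<in> D0_adj k sqnorm" for f u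
  proof -
    have f: "f \<in> ?H" using f0 by (simp add: D1_iff[OF k])
    have cz: "field_coeff (\<lambda>x I. 0 :: complex) = (0 :: ('n, 'i) coeffs)"
      by (simp add: field_coeff_def fun_eq_iff hcoeff_zero)
    have Df: "D1_fock (field_coeff f) = 0" using f0 by (simp add: D1_iff[OF k] cz)
    note n = N_fock[OF F1.valued_field_coeff[OF f] k]
    (* D1 annihilates f and D0 D0* u, hence also b, and then |b|^2 = <D1 u, D1 b> = 0. *)
    define b where "b = D1_fock_adj (D1_fock (N_fock k (field_coeff f)))"
    have vb: "valued (V1 k) b" unfolding b_def by (intro valued_D1_fock_adj valued_D1_fock n k)
    have fb: "field_coeff f = D0_fock (D0_fock_adj (N_fock k (field_coeff f))) + b" using n(2) by (simp only: Box_fock_def b_def)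
    have "D1_fock (field_coeff f) = D1_fock (D0_fock (D0_fock_adj (N_fock k (field_coeff f)))) + D1_fock b" by (subst fb) (rule D1_fock_add)
    then have Db: "D1_fock b = 0" unfolding Df D1_fock_D0_fock[OF valued_D0_fock_adj[OF n(1) k1]] by simp
    have "coeff_ip (I1 k) d b b = coeff_ip (I2 k) (d - 1) (D1_fock (N_fock k (field_coeff f))) (D1_fock b)" for d
      unfolding b_def by (rule coeff_ip_D1_fock_adj[OF vb[unfolded b_def] valued_D1_fock[OF n(1) k] k])
    then have bb: "coeff_ip (I1 k) d b b = 0" for d unfolding Db by (simp only: coeff_ip_zero)
    have "b I \<alpha> = 0" for I and \<alpha> :: "('n \<times> 4) multi"
    proof (cases "I \<in> I1 k")
      case True
      show ?thesis
        by (rule coeff_ip_self_eq_0[OF finite_I1 _ True, of "int (\<Sum>j\<in>UNIV. \<alpha> j)"]) (simp_all add: bb level_int del: of_nat_sum)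
    next
      case False
      then have "b I = 0" by (rule F1.valued_support[OF vb])
      then show ?thesis by simp
    qed
    then have b0: "b = 0" by (simp add: fun_eq_iff)
    have cu: "u \<in> L2 sqnorm (V0 k)" "field_coeff u = D0_fock_adj (N_fock k (field_coeff f))"
      using u by (simp_all add: D0_adj_iff[OF k1] N_field(2)[OF f k])
    have "field_coeff f = D0_fock (field_coeff u)" using fb unfolding b0 cu(2) by simp
    then have uf: "(u, f) \<in> D0 k sqnorm" using cu(1) f by (simp only: D0_iff[OF k1] simp_thms)
    have "ip sqnorm (I0 k) u h = 0" if h: "h \<in> Bergman k sqnorm" for h
    proof -
      from h have hL: "h \<in> L2 sqnorm (V0 k)" and h0: "(h, \<lambda>x I. 0) \<in> D0 k sqnorm" by (simp_all add: Bergman_def)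
      have "ip sqnorm (I1 k) (\<lambda>x I. 0) (?N f) = ip sqnorm (I0 k) h u"
        using u h0 unfolding D0_adj_def adjoint_graph_def by blast
      then have "ip sqnorm (I0 k) h u = 0" by (simp add: ip_def)
      then show ?thesis using ip_commute[OF hL cu(1), of "I0 k"] by simp
    qed
    with uf show ?thesis by (simp add: canonical_solution_def)
  qed
  have est0: "nrm sqnorm (I0 k) u \<le> 1/2 * nrm sqnorm (I1 k) f" if f: "f \<in> ?H" and u: "(?N f, u) \<in> D0_adj k sqnorm" for f u
  proof -
    note n = N_fock[OF F1.valued_field_coeff[OF f] k]
    have cu: "u \<in> L2 sqnorm (V0 k)" "field_coeff u = D0_fock_adj (N_fock k (field_coeff f))"
      using u by (simp_all add: D0_adj_iff[OF k1] N_field(2)[OF f k])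
    have "(\<lambda>d. coeff_ip (I1 k) (int d - 1) (field_coeff f) (field_coeff f)) sums ip sqnorm (I1 k) f f"
      by (rule sums_Suc_imp) (simp_all add: ip_sums[OF f f])
    note s = sums_Re[OF this]
    show ?thesis unfolding norm_f
    proof (rule nrm_le[OF s cu(1)])
      show "Re (coeff_ip (I0 k) (int d) (field_coeff u) (field_coeff u)) \<le> (1/2)\<^sup>2 * Re (coeff_ip (I1 k) (int d - 1) (field_coeff f) (field_coeff f))" for d
        using Box_fock_bounds(2)[OF n(1) k n(2), of "int d - 1"] unfolding cu(2) by (simp add: power2_eq_square)
    qed simp
  qed
  have est2: "nrm sqnorm (I2 k) p \<le> 1/2 * nrm sqnorm (I1 k) f" if f: "f \<in> ?H" and p: "(?N f, p) \<in> D1 k sqnorm" for f p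
  proof -
    note n = N_fock[OF F1.valued_field_coeff[OF f] k]
    have cp: "p \<in> L2 sqnorm (V2 k)" "field_coeff p = D1_fock (N_fock k (field_coeff f))"
      using p by (simp_all add: D1_iff[OF k] N_field(2)[OF f k])
    define C where "C = (\<lambda>d. Re (coeff_ip (I1 k) (int d) (field_coeff f) (field_coeff f)))"
    have "C sums Re (ip sqnorm (I1 k) f f)" unfolding C_def by (rule sums_Re[OF ip_sums[OF f f]])
    then have s: "(\<lambda>d. C (Suc d)) sums (Re (ip sqnorm (I1 k) f f) - C 0)" by (simp add: sums_Suc_iff)
    have "nrm sqnorm (I2 k) p \<le> 1/2 * sqrt (Re (ip sqnorm (I1 k) f f) - C 0)"
    proof (rule nrm_le[OF s cp(1)])
      show "Re (coeff_ip (I2 k) (int d) (field_coeff p) (field_coeff p)) \<le> (1/2)\<^sup>2 * C (Suc d)" for d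
        using Box_fock_bounds(3)[OF n(1) k n(2), of "int (Suc d)"] unfolding cp(2) C_def by (simp add: power2_eq_square)
    qed simp
    also have "\<dots> \<le> 1/2 * nrm sqnorm (I1 k) f"
      unfolding norm_f by (simp add: C_def coeff_ip_nonneg)
    finally show ?thesis .
  qed
  show ?thesis unfolding \<phi>
    using inv bdd sa nn est dom can est0 est2 by (intro exI[of _ ?N] conjI) blast+
qed

end
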